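(* Let $K$ be an infinite field of arbitrary characteristic, $R=K[[x_1,\ldots,x_s]]$ with maximal ideal $\mathfrak{m}=\langle x_1,\ldots,x_s\rangle$, and $M_{2,2}$ the set of $2\times 2$ matrices with entries in $R$. Let $A\in \mathfrak{m}\cdot M_{2,2}$. Then the following are equivalent: 1. $A$ is finitely $G$-determined. 2. $\dim_K M_{2,2}/\widetilde T_A(GA)<\infty$.
   Context: Let $G=\left(GL(2,R)\times GL(2,R)^{\mathrm{op}}\right)\rtimes \mathrm{Aut}(R)$, where $\mathrm{Aut}(R)$ is the group of $K$-algebra automorphisms of $R$. It acts on $M_{2,2}$ by $(U,V,\phi,A)\mapsto U\cdot\phi(A)\cdot V$, where $\phi(A)=[\phi(a_{ij})]=[a_{ij}(\phi(x_1),\ldots,\phi(x_s))]$ with $\phi(x_i)\in\mathfrak{m}$. Two matrices $A,B$ are $G$-equivalent if $B$ lies in the $G$-orbit $GA$ of $A$. A matrix $A$ is $G$ $k$-determined if every $B\in M_{2,2}$ with $B-A\in\mathfrak{m}^{k+1}\cdot M_{2,2}$ is $G$-equivalent to $A$; $A$ is finitely $G$-determined if it is $G$ $k$-determined for some positive integer $k$. The tangent image of $A$ is the $R$-submodule $\widetilde T_A(GA)=\langle E_{pq}\cdot A : p,q=1,2\rangle+\langle A\cdot E_{hl}: h,l=1,2\rangle+\mathfrak{m}\cdot\langle \partial A/\partial x_\nu : \nu=1,\ldots,s\rangle$ of $M_{2,2}$, where $E_{pq}$ is the $2\times2$ matrix with $1$ at position $(p,q)$ and $0$ elsewhere, $\partial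 A/\partial x_\nu$ is the entrywise partial derivative, and $\langle\cdot\rangle$ denotes the $R$-submodule generated. *)

theory Defs
  imports Main
begin

text \<open>A power series is represented by its coefficient function on exponent
vectors (nat => nat).  The ring R (for a given number s of variables) is the
carrier set PS s of coefficient functions vanishing outside the exponent
vectors supported in {0..<s}.\<close>

type_synonym 'a ps = "(nat \<Rightarrow> nat) \<Rightarrow> 'a"

definition expvecs :: "nat \<Rightarrow> (nat \<Rightarrow> nat) set" where
  "expvecs s = {\<alpha>. \<forall>i\<ge>s. \<alpha> i = 0}"

definition PS :: "nat \<Rightarrow> 'a::zero ps set" where
  "PS s = {f. \<forall>\<alpha>. \<alpha> \<notin> expvecs s \<longrightarrow> f \<alpha> = 0}"

definition ps_zero :: "'a::zero ps" where
  "ps_zero = (\<lambda>_. 0)"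

definition ps_const :: "'a::zero \<Rightarrow> 'a ps" where
  "ps_const c = (\<lambda>\<alpha>. if \<alpha> = (\<lambda>_. 0) then c else 0)"

definition ps_one :: "'a::{zero,one} ps" where
  "ps_one = ps_const 1"

definition ps_add :: "'a::plus ps \<Rightarrow> 'a ps \<Rightarrow> 'a ps" where
  "ps_add f g = (\<lambda>\<alpha>. f \<alpha> + g \<alpha>)"

definition ps_sub :: "'a::minus ps \<Rightarrow> 'a ps \<Rightarrow> 'a ps" where
  "ps_sub f g = (\<lambda>\<alpha>. f \<alpha> - g \<alpha>)"

definition ps_mult :: "'a::comm_semiring_1 ps \<Rightarrow> 'a ps \<Rightarrow> 'a ps" where
  "ps_mult f g = (\<lambda>\<alpha>. \<Sum>\<beta>\<in>{\<beta>. \<forall>i. \<beta> i \<le> \<alpha> i}. f \<beta> * g (\<lambda>i. \<alpha> i - \<beta> i))"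

definition ps_X :: "nat \<Rightarrow> 'a::{zero,one} ps" where
  "ps_X i = (\<lambda>\<alpha>. if \<alpha> = (\<lambda>j. if j = i then 1 else 0) then 1 else 0)"

definition ps_deriv :: "nat \<Rightarrow> 'a::comm_semiring_1 ps \<Rightarrow> 'a ps" where
  "ps_deriv \<nu> f = (\<lambda>\<alpha>. of_nat (\<alpha> \<nu> + 1) * f (\<alpha>(\<nu> := \<alpha> \<nu> + 1)))"

definition ideal_gen :: "nat \<Rightarrow> 'a::comm_semiring_1 ps set \<Rightarrow> 'a ps set" where
  "ideal_gen s G = {(\<lambda>\<alpha>. \<Sum>x\<in>F. ps_mult (r x) (g x) \<alpha>) | F r g.
      finite (F :: nat set) \<and> (\<forall>x\<in>F. r x \<in> PS s \<and> g x \<in> G)}"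

definition ideal_mult :: "nat \<Rightarrow> 'a::comm_semiring_1 ps set \<Rightarrow> 'a ps set \<Rightarrow> 'a ps set" where
  "ideal_mult s I J = ideal_gen s {ps_mult a b | a b. a \<in> I \<and> b \<in> J}"

fun ideal_pow :: "nat \<Rightarrow> 'a::comm_semiring_1 ps set \<Rightarrow> nat \<Rightarrow> 'a ps set" where
  "ideal_pow s I 0 = PS s"
| "ideal_pow s I (Suc k) = ideal_mult s I (ideal_pow s I k)"

definition mideal :: "nat \<Rightarrow> 'a::comm_semiring_1 ps set" where
  "mideal s = ideal_gen s {ps_X i | i. i < s}"

text \<open>Matrices are functions nat => nat => R, with indices 0,1; entries
outside the 2x2 range are required to be zero.\<close>

type_synonym 'a mat2 = "nat \<Rightarrow> nat \<Rightarrow> 'a ps"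

definition M22 :: "nat \<Rightarrow> 'a::zero mat2 set" where
  "M22 s = {A. (\<forall>i j. i < 2 \<and> j < 2 \<longrightarrow> A i j \<in> PS s)
              \<and> (\<forall>i j. \<not> (i < 2 \<and> j < 2) \<longrightarrow> A i j = ps_zero)}"

definition mat_add :: "'a::plus mat2 \<Rightarrow> 'a mat2 \<Rightarrow> 'a mat2" where
  "mat_add A B = (\<lambda>i j. ps_add (A i j) (B i j))"

definition mat_sub :: "'a::minus mat2 \<Rightarrow> 'a mat2 \<Rightarrow> 'a mat2" where
  "mat_sub A B = (\<lambda>i j. ps_sub (A i j) (B i j))"

definition mat_mult :: "'a::comm_semiring_1 mat2 \<Rightarrow> 'a mat2 \<Rightarrow> 'a mat2" where
  "mat_mult A B = (\<lambda>i j. if i < 2 \<and> j < 2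
      then ps_add (ps_mult (A i 0) (B 0 j)) (ps_mult (A i 1) (B 1 j)) else ps_zero)"

definition mat_scale :: "'a::comm_semiring_1 ps \<Rightarrow> 'a mat2 \<Rightarrow> 'a mat2" where
  "mat_scale r B = (\<lambda>i j. ps_mult r (B i j))"

definition mat_E :: "nat \<Rightarrow> nat \<Rightarrow> 'a::{zero,one} mat2" where
  "mat_E p q = (\<lambda>i j. if i = p \<and> j = q then ps_one else ps_zero)"

definition mat_id :: "'a::{zero,one} mat2" where
  "mat_id = (\<lambda>i j. if i < 2 \<and> j < 2 \<and> i = j then ps_one else ps_zero)"

definition mat_map :: "('a::zero ps \<Rightarrow> 'a ps) \<Rightarrow> 'a mat2 \<Rightarrow> 'a mat2" where
  "mat_map \<phi> A = (\<lambda>i j. if i < 2 \<and> j < 2 then \<phi> (A i j) else ps_zero)"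

definition mat_deriv :: "nat \<Rightarrow> 'a::comm_semiring_1 mat2 \<Rightarrow> 'a mat2" where
  "mat_deriv \<nu> A = (\<lambda>i j. ps_deriv \<nu> (A i j))"

definition ideal_mat :: "'a::zero ps set \<Rightarrow> 'a mat2 set" where
  "ideal_mat I = {A. (\<forall>i j. i < 2 \<and> j < 2 \<longrightarrow> A i j \<in> I)
              \<and> (\<forall>i j. \<not> (i < 2 \<and> j < 2) \<longrightarrow> A i j = ps_zero)}"

text \<open>All finite linear combinations sum r_x B_x with coefficients r_x in I
and B_x in S.  For I = R this is the R-submodule generated by S; for I = m
and S an R-submodule N it is m * N; for I = constants K it is the K-span.\<close>
definition lin_comb :: "'a::comm_semiring_1 ps set \<Rightarrow> 'a mat2 set \<Rightarrow> 'a mat2 set" where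
  "lin_comb I S = {(\<lambda>i j \<alpha>. \<Sum>x\<in>F. mat_scale (r x) (B x) i j \<alpha>) | F r B.
      finite (F :: nat set) \<and> (\<forall>x\<in>F. r x \<in> I \<and> B x \<in> S)}"

definition mod_sum :: "'a::plus mat2 set \<Rightarrow> 'a mat2 set \<Rightarrow> 'a mat2 set" where
  "mod_sum X Y = {mat_add x y | x y. x \<in> X \<and> y \<in> Y}"

definition GL2 :: "nat \<Rightarrow> 'a::comm_semiring_1 mat2 set" where
  "GL2 s = {U \<in> M22 s. \<exists>W\<in>M22 s. mat_mult U W = mat_id \<and> mat_mult W U = mat_id}"

definition Kalg_aut :: "nat \<Rightarrow> ('a::comm_semiring_1 ps \<Rightarrow> 'a ps) \<Rightarrow> bool" where
  "Kalg_aut s \<phi> \<longleftrightarrow> bij_betw \<phi> (PS s) (PS s)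
     \<and> (\<forall>f\<in>PS s. \<forall>g\<in>PS s. \<phi> (ps_add f g) = ps_add (\<phi> f) (\<phi> g)
                            \<and> \<phi> (ps_mult f g) = ps_mult (\<phi> f) (\<phi> g))
     \<and> (\<forall>c. \<phi> (ps_const c) = ps_const c)"

definition G_orbit :: "nat \<Rightarrow> 'a::comm_semiring_1 mat2 \<Rightarrow> 'a mat2 set" where
  "G_orbit s A = {mat_mult (mat_mult U (mat_map \<phi> A)) V | U V \<phi>.
      U \<in> GL2 s \<and> V \<in> GL2 s \<and> Kalg_aut s \<phi>}"

definition G_equiv :: "nat \<Rightarrow> 'a::comm_semiring_1 mat2 \<Rightarrow> 'a mat2 \<Rightarrow> bool" where
  "G_equiv s A B \<longleftrightarrow> B \<in> G_orbit s A"

definition G_k_determined :: "nat \<Rightarrow> nat \<Rightarrow> 'a::comm_ring_1 mat2 \<Rightarrow> bool" where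
  "G_k_determined s k A \<longleftrightarrow>
     (\<forall>B\<in>M22 s. mat_sub B A \<in> ideal_mat (ideal_pow s (mideal s) (k + 1)) \<longrightarrow> G_equiv s A B)"

definition finitely_G_determined :: "nat \<Rightarrow> 'a::comm_ring_1 mat2 \<Rightarrow> bool" where
  "finitely_G_determined s A \<longleftrightarrow> (\<exists>k>0. G_k_determined s k A)"

definition tangent_image :: "nat \<Rightarrow> 'a::comm_semiring_1 mat2 \<Rightarrow> 'a mat2 set" where
  "tangent_image s A =
     mod_sum (mod_sum (lin_comb (PS s) {mat_mult (mat_E p q) A | p q. p < 2 \<and> q < 2})
                      (lin_comb (PS s) {mat_mult A (mat_E h l) | h l. h < 2 \<and> l < 2}))
             (lin_comb (mideal s) (lin_comb (PS s) {mat_deriv \<nu> A | \<nu>. \<nu> < s}))"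

definition finite_codim :: "nat \<Rightarrow> 'a::comm_semiring_1 mat2 set \<Rightarrow> bool" where
  "finite_codim s N \<longleftrightarrow> (\<exists>F::nat set. \<exists>C. finite F \<and> (\<forall>x\<in>F. C x \<in> M22 s) \<and>
      M22 s \<subseteq> mod_sum (lin_comb {ps_const c | c. True} (C ` F)) N)"

end

theory Submission
  imports Defs "HOL-Library.Poly_Mapping" "HOL-Computational_Algebra.Polynomial"
begin

text \<open>Both conditions are compared with the existence of n such that the tangent image contains
  m^n times the matrix space.

  If the tangent image contains m^c times the matrix space, a nearby B is reached from A by successive
  approximation: the current error is the image under the tangent map of a correction of the group element,
  and the new error is quadratic in the group element and the correction.

  Conversely, let A be finitely determined. The orbit of A contains every B that agrees with A to high order,
  and finite codimension is an invariant of the orbit, so one such B of finite codimension is enough.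
  In characteristic p one cannot argue with the tangent space of the orbit; instead take for B a truncation of A
  plus a form x_1^n M_1 + ... + x_s^n M_s of higher degree n prime to the characteristic, where the constant matrices
  M_i are generic points of a twisted cubic. The form alone has finite codimension by explicit linear algebra,
  and as its generators are the top degree parts of the generators for B, the polynomial matrices have finite
  dimension modulo the tangent image of B. A linear dependency among the x_i^j E modulo the tangent image is a
  power of x_i times a unit of the power series ring, and this gives finite codimension at the origin.\<close>

\<comment> \<open>In characteristic p the orbit map can be inseparable. The tangent space of the
  orbit can then exceed the tangent image and does not bound its codimension, hence the detour
  through one explicit B. The approximation in the other direction uses only formal first
  derivatives and never divides by factorials. The degree n must be nonzero in K because x_i d/dx_i
  turns x_i^n M_i into n x_i^n M_i; of two consecutive degrees one always qualifies. This puts every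
  x_i^n M_i into the module separately. Four distinct points of the twisted cubic are linearly
  independent, so products of four x_i^n with different indices annihilate the quotient; products
  with fewer indices follow in turn, down to the fourth power of x_i^n. Since K is infinite, the
  finitely many zeros of each genericity condition can be avoided. The top forms of B control high
  degrees, whereas near the origin the lower terms dominate. So the degree reduction is confined to
  polynomials, and only afterwards are series with nonzero constant term inverted.\<close>
alias lookup = Poly_Mapping.lookup
alias keys = Poly_Mapping.keys
alias single = Poly_Mapping.single

section \<open>Exponent vectors\<close>

definition mdeg :: "(nat \<Rightarrow>\<^sub>0 nat) \<Rightarrow> nat" where
  "mdeg \<alpha> = (\<Sum>i\<in>keys \<alpha>. lookup \<alpha> i)"

lemma mdeg_eq_sum:
  assumes "finite S" "keys \<alpha> \<subseteq> S"
  shows "mdeg \<alpha> = (\<Sum>i\<in>S. lookup \<alpha> i)"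
  unfolding mdeg_def using assms
  by (intro sum.mono_neutral_left) (auto simp: in_keys_iff)

lemma mdeg_add [simp]: "mdeg (\<alpha> + \<beta>) = mdeg \<alpha> + mdeg \<beta>"
proof -
  have "keys (\<alpha> + \<beta>) \<subseteq> keys \<alpha> \<union> keys \<beta>" by (rule keys_add)
  then show ?thesis
    by (simp add: mdeg_eq_sum[of "keys \<alpha> \<union> keys \<beta>"] lookup_add sum.distrib)
qed

lemma mdeg_zero [simp]: "mdeg 0 = 0"
  by (simp add: mdeg_def)

lemma mdeg_single [simp]: "mdeg (single i n) = n"
  by (simp add: mdeg_def)

lemma lookup_le_mdeg: "lookup \<alpha> i \<le> mdeg \<alpha>"
proof (cases "i \<in> keys \<alpha>")
  case True
  then show ?thesis unfolding mdeg_def by (intro member_le_sum) auto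
qed (simp add: in_keys_iff)

lemma mdeg_eq_0_iff [simp]: "mdeg \<alpha> = 0 \<longleftrightarrow> \<alpha> = 0"
  by (auto simp: mdeg_def in_keys_iff intro!: poly_mapping_eqI)

lemma single_add_diff:
  fixes \<alpha> :: "'i \<Rightarrow>\<^sub>0 nat"
  assumes "a \<le> lookup \<alpha> i"
  shows "single i a + (\<alpha> - single i a) = \<alpha>"
  using assms by (intro poly_mapping_eqI) (auto simp: lookup_add lookup_minus lookup_single when_def)

definition evecs :: "nat \<Rightarrow> (nat \<Rightarrow>\<^sub>0 nat) set" where
  "evecs s = {\<alpha>. keys \<alpha> \<subseteq> {..<s}}"

lemma evecs_iff: "\<alpha> \<in> evecs s \<longleftrightarrow> (\<forall>i\<ge>s. lookup \<alpha> i = 0)"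
proof
  assume "\<alpha> \<in> evecs s"
  then show "\<forall>i\<ge>s. lookup \<alpha> i = 0" unfolding evecs_def by (fastforce simp: in_keys_iff)
next
  assume *: "\<forall>i\<ge>s. lookup \<alpha> i = 0"
  have "i < s" if "i \<in> keys \<alpha>" for i
    using that * by (cases "i < s") (auto simp: in_keys_iff)
  then show "\<alpha> \<in> evecs s" by (auto simp: evecs_def)
qed

lemma evecs_zero [simp]: "0 \<in> evecs s"
  by (simp add: evecs_def)

lemma evecs_add_iff [simp]: "\<alpha> + \<beta> \<in> evecs s \<longleftrightarrow> \<alpha> \<in> evecs s \<and> \<beta> \<in> evecs s"
  by (auto simp: evecs_iff lookup_add)

lemma evecs_single [simp]: "i < s \<Longrightarrow> single i a \<in> evecs s"
  by (auto simp: evecs_iff lookup_single when_def)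

lemma mdeg_evecs: "\<alpha> \<in> evecs s \<Longrightarrow> mdeg \<alpha> = (\<Sum>i<s. lookup \<alpha> i)"
  by (rule mdeg_eq_sum) (auto simp: evecs_def)

text \<open>Monomials are built up one variable at a time; this is how multiplicative facts about
  substitutions and derivations reach all monomials.\<close>

lemma evecs_induct [consumes 1, case_names zero add]:
  assumes "\<alpha> \<in> evecs s" "P 0"
    and step: "\<And>i \<beta>. i < s \<Longrightarrow> \<beta> \<in> evecs s \<Longrightarrow> P \<beta> \<Longrightarrow> P (single i 1 + \<beta>)"
  shows "P \<alpha>"
  using assms(1)
proof (induction "mdeg \<alpha>" arbitrary: \<alpha>)
  case 0
  then show ?case using assms(2) by simp
next
  case (Suc n)
  then have "\<alpha> \<noteq> 0" by auto
  then obtain i where i: "i \<in> keys \<alpha>" by fastforce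
  with Suc.prems have "i < s" by (auto simp: evecs_def)
  let ?\<beta> = "\<alpha> - single i 1"
  have eq: "single i 1 + ?\<beta> = \<alpha>"
    using i by (intro single_add_diff) (simp add: in_keys_iff)
  then have "mdeg \<alpha> = 1 + mdeg ?\<beta>" by (metis mdeg_add mdeg_single)
  moreover have "?\<beta> \<in> evecs s" using Suc.prems eq by (metis evecs_add_iff)
  ultimately show ?case using Suc.hyps step[OF \<open>i < s\<close>, of ?\<beta>] eq by force
qed

lemma finite_evecs_bounded: "finite {\<alpha> \<in> evecs s. mdeg \<alpha> \<le> n}"
proof -
  let ?S = "{\<alpha> \<in> evecs s. mdeg \<alpha> \<le> n}"
  have "lookup ` ?S \<subseteq> {f. \<forall>x. (x \<in> {..<s} \<longrightarrow> f x \<in> {..n}) \<and> (x \<notin> {..<s} \<longrightarrow> f x = 0)}"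
  proof (rule image_subsetI)
    fix \<alpha> assume "\<alpha> \<in> ?S"
    then show "lookup \<alpha> \<in> {f. \<forall>x. (x \<in> {..<s} \<longrightarrow> f x \<in> {..n}) \<and> (x \<notin> {..<s} \<longrightarrow> f x = 0)}"
      using order_trans[OF lookup_le_mdeg, of \<alpha> n] by (simp add: evecs_iff)
  qed
  then have "finite (lookup ` ?S)"
    by (rule finite_subset) (rule finite_set_of_finite_funs; simp)
  then show ?thesis
    by (rule finite_imageD) (auto intro!: inj_onI simp: lookup_inject)
qed

lemma ex_evecs: "\<exists>s. \<alpha> \<in> evecs s"
proof -
  have "keys \<alpha> \<subseteq> {..<Suc (Max (keys \<alpha>))}" by (auto simp: less_Suc_eq_le)
  then show ?thesis unfolding evecs_def by blast
qed

section \<open>The ring of formal power series\<close>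

text \<open>Summing convolutions over pairs avoids truncated subtraction and turns commutativity and
  associativity into plain reindexing.\<close>

definition decomps :: "(nat \<Rightarrow>\<^sub>0 nat) \<Rightarrow> ((nat \<Rightarrow>\<^sub>0 nat) \<times> (nat \<Rightarrow>\<^sub>0 nat)) set" where
  "decomps \<gamma> = {(\<alpha>, \<beta>). \<alpha> + \<beta> = \<gamma>}"

lemma decomps_iff [simp]: "(\<alpha>, \<beta>) \<in> decomps \<gamma> \<longleftrightarrow> \<alpha> + \<beta> = \<gamma>"
  by (simp add: decomps_def)

lemma finite_decomps [simp]: "finite (decomps \<gamma>)"
proof -
  obtain s where "\<gamma> \<in> evecs s" using ex_evecs by blast
  then have "decomps \<gamma> \<subseteq> {\<alpha> \<in> evecs s. mdeg \<alpha> \<le> mdeg \<gamma>} \<times> {\<alpha> \<in> evecs s. mdeg \<alpha> \<le> mdeg \<gamma>}"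
    by (auto simp: decomps_def)
  then show ?thesis by (rule finite_subset) (intro finite_cartesian_product finite_evecs_bounded)
qed

text \<open>Finitely supported exponents make every coefficient of a product a finite sum, so all
  series together form a type of class \<open>comm_ring_1\<close>. The number s of variables is a
  term and cannot index a type; it returns as the subring \<open>Pser s\<close>.\<close>

typedef 'a mps = "UNIV :: ((nat \<Rightarrow>\<^sub>0 nat) \<Rightarrow> 'a) set"
  morphisms mps_nth Mps ..

setup_lifting type_definition_mps

lemma mps_eqI: "(\<And>\<alpha>. mps_nth f \<alpha> = mps_nth g \<alpha>) \<Longrightarrow> f = g"
  by (metis mps_nth_inject ext)

lemma mps_nth_Mps [simp]: "mps_nth (Mps f) = f"
  by (simp add: Mps_inverse)

instantiation mps :: (comm_ring_1) comm_ring_1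
begin

lift_definition zero_mps :: "'a mps" is "\<lambda>_. 0" .
lift_definition one_mps :: "'a mps" is "\<lambda>\<alpha>. if \<alpha> = 0 then 1 else 0" .
lift_definition plus_mps :: "'a mps \<Rightarrow> 'a mps \<Rightarrow> 'a mps" is "\<lambda>f g \<alpha>. f \<alpha> + g \<alpha>" .
lift_definition minus_mps :: "'a mps \<Rightarrow> 'a mps \<Rightarrow> 'a mps" is "\<lambda>f g \<alpha>. f \<alpha> - g \<alpha>" .
lift_definition uminus_mps :: "'a mps \<Rightarrow> 'a mps" is "\<lambda>f \<alpha>. - f \<alpha>" .
lift_definition times_mps :: "'a mps \<Rightarrow> 'a mps \<Rightarrow> 'a mps"
  is "\<lambda>f g \<gamma>. \<Sum>(\<alpha>, \<beta>)\<in>decomps \<gamma>. f \<alpha> * g \<beta>" .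

instance
proof
  fix f g h :: "'a mps"
  show "f * g * h = f * (g * h)"
  proof (transfer, rule ext)
    fix f g h :: "(nat \<Rightarrow>\<^sub>0 nat) \<Rightarrow> 'a" and \<gamma>
    have "(\<Sum>(\<alpha>, \<beta>)\<in>decomps \<gamma>. (\<Sum>(\<alpha>, \<beta>)\<in>decomps \<alpha>. f \<alpha> * g \<beta>) * h \<beta>)
      = (\<Sum>p\<in>decomps \<gamma>. \<Sum>q\<in>decomps (fst p). f (fst q) * g (snd q) * h (snd p))"
      by (simp add: sum_distrib_right case_prod_unfold)
    also have "\<dots> = (\<Sum>(p, q)\<in>Sigma (decomps \<gamma>) (\<lambda>p. decomps (fst p)). f (fst q) * g (snd q) * h (snd p))"
      by (rule sum.Sigma) auto
    also have "\<dots> = (\<Sum>(p, q)\<in>Sigma (decomps \<gamma>) (\<lambda>p. decomps (snd p)). f (fst p) * (g (fst q) * h (snd q)))"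
      by (rule sum.reindex_bij_witness[where
            i = "\<lambda>((a, b), (c, d)). ((a + c, d), (a, c))" and j = "\<lambda>((a, b), (c, d)). ((c, d + b), (d, b))"])
         (auto simp: add.assoc mult.assoc)
    also have "\<dots> = (\<Sum>p\<in>decomps \<gamma>. \<Sum>q\<in>decomps (snd p). f (fst p) * (g (fst q) * h (snd q)))"
      by (rule sum.Sigma[symmetric]) auto
    also have "\<dots> = (\<Sum>(\<alpha>, \<beta>)\<in>decomps \<gamma>. f \<alpha> * (\<Sum>(\<alpha>, \<beta>)\<in>decomps \<beta>. g \<alpha> * h \<beta>))"
      by (simp add: sum_distrib_left case_prod_unfold)
    finally show "(\<Sum>(\<alpha>, \<beta>)\<in>decomps \<gamma>. (\<Sum>(\<alpha>, \<beta>)\<in>decomps \<alpha>. f \<alpha> * g \<beta>) * h \<beta>)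
      = (\<Sum>(\<alpha>, \<beta>)\<in>decomps \<gamma>. f \<alpha> * (\<Sum>(\<alpha>, \<beta>)\<in>decomps \<beta>. g \<alpha> * h \<beta>))" .
  qed
  show "f * g = g * f"
    by (transfer, rule ext, rule sum.reindex_bij_witness[where i = prod.swap and j = prod.swap])
       (auto simp: add.commute mult.commute)
  show "1 * f = f"
  proof (transfer, rule ext)
    fix f :: "(nat \<Rightarrow>\<^sub>0 nat) \<Rightarrow> 'a" and \<gamma>
    have "(\<Sum>(\<alpha>, \<beta>)\<in>decomps \<gamma>. (if \<alpha> = 0 then 1 else 0) * f \<beta>) = (\<Sum>(\<alpha>, \<beta>)\<in>{(0 :: nat \<Rightarrow>\<^sub>0 nat, \<gamma>)}. f \<beta>)"
      by (rule sum.mono_neutral_cong_right) (auto split: if_splits)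
    then show "(\<Sum>(\<alpha>, \<beta>)\<in>decomps \<gamma>. (if \<alpha> = 0 then 1 else 0) * f \<beta>) = f \<gamma>" by simp
  qed
  show "(f + g) * h = f * h + g * h"
    by (transfer, rule ext) (simp add: distrib_right sum.distrib case_prod_unfold)
  show "(0 :: 'a mps) \<noteq> 1" by (transfer, auto simp: fun_eq_iff)
qed (transfer, simp add: add_ac fun_eq_iff)+

end

lemma mps_nth_zero [simp]: "mps_nth 0 \<alpha> = 0"
  by (transfer, simp)

lemma mps_nth_one: "mps_nth 1 \<alpha> = (if \<alpha> = 0 then 1 else 0)"
  by (transfer, simp)

lemma mps_nth_add [simp]: "mps_nth (f + g) \<alpha> = mps_nth f \<alpha> + mps_nth g \<alpha>"
  by (transfer, simp)

lemma mps_nth_diff [simp]: "mps_nth (f - g) \<alpha> = mps_nth f \<alpha> - mps_nth g \<alpha>"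
  by (transfer, simp)

lemma mps_nth_uminus [simp]: "mps_nth (- f) \<alpha> = - mps_nth f \<alpha>"
  by (transfer, simp)

lemma mps_nth_mult: "mps_nth (f * g) \<gamma> = (\<Sum>(\<alpha>, \<beta>)\<in>decomps \<gamma>. mps_nth f \<alpha> * mps_nth g \<beta>)"
  by (transfer, simp)

lemma mps_nth_sum [simp]: "mps_nth (\<Sum>i\<in>I. f i) \<alpha> = (\<Sum>i\<in>I. mps_nth (f i) \<alpha>)"
  by (induction I rule: infinite_finite_induct) auto

definition mpmon :: "(nat \<Rightarrow>\<^sub>0 nat) \<Rightarrow> 'a \<Rightarrow> 'a::comm_ring_1 mps" where
  "mpmon \<alpha> c = Mps (\<lambda>\<beta>. if \<beta> = \<alpha> then c else 0)"

lemma mps_nth_mpmon: "mps_nth (mpmon \<alpha> c) \<beta> = (if \<beta> = \<alpha> then c else 0)"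
  by (simp add: mpmon_def)

lemma mpmon_0_1: "mpmon 0 1 = 1"
  by (rule mps_eqI) (simp add: mps_nth_mpmon mps_nth_one)

lemma mpmon_0_right [simp]: "mpmon \<alpha> 0 = 0"
  by (rule mps_eqI) (simp add: mps_nth_mpmon)

lemma mpmon_add: "mpmon \<alpha> (c + d) = mpmon \<alpha> c + mpmon \<alpha> d"
  by (rule mps_eqI) (simp add: mps_nth_mpmon)

lemma mps_nth_mpmon_mult: "mps_nth (mpmon \<alpha> c * f) (\<alpha> + \<beta>) = c * mps_nth f \<beta>"
proof -
  have "mps_nth (mpmon \<alpha> c * f) (\<alpha> + \<beta>) = (\<Sum>(a, b)\<in>{(\<alpha>, \<beta>)}. c * mps_nth f b)"
    unfolding mps_nth_mult
    by (rule sum.mono_neutral_cong_right) (auto simp: mps_nth_mpmon split: if_splits)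
  then show ?thesis by simp
qed

lemma mps_nth_mpmon_mult_eq_0:
  assumes "\<nexists>\<beta>. \<gamma> = \<alpha> + \<beta>"
  shows "mps_nth (mpmon \<alpha> c * f) \<gamma> = 0"
  unfolding mps_nth_mult using assms
  by (intro sum.neutral) (auto simp: mps_nth_mpmon)

lemma mps_nth_const_mult [simp]: "mps_nth (mpmon 0 c * f) \<beta> = c * mps_nth f \<beta>"
  using mps_nth_mpmon_mult[of 0 c f \<beta>] by simp

lemma mpmon_mult: "mpmon \<alpha> c * mpmon \<beta> d = mpmon (\<alpha> + \<beta>) (c * d)"
proof (rule mps_eqI)
  fix \<gamma>
  show "mps_nth (mpmon \<alpha> c * mpmon \<beta> d) \<gamma> = mps_nth (mpmon (\<alpha> + \<beta>) (c * d)) \<gamma>"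
  proof (cases "\<exists>\<delta>. \<gamma> = \<alpha> + \<delta>")
    case True
    then show ?thesis by (auto simp: mps_nth_mpmon_mult) (simp add: mps_nth_mpmon)
  next
    case False
    then show ?thesis by (subst mps_nth_mpmon_mult_eq_0) (auto simp: mps_nth_mpmon)
  qed
qed

lemma mpmon_0_mult: "mpmon 0 (c * d) = mpmon 0 c * mpmon 0 d"
  by (simp add: mpmon_mult)

lemma mpmon_power: "mpmon (single i a) 1 ^ n = mpmon (single i (n * a)) 1"
  by (induction n) (auto simp: mpmon_0_1 mpmon_mult single_add)

abbreviation mconst :: "'a \<Rightarrow> 'a::comm_ring_1 mps" where
  "mconst c \<equiv> mpmon 0 c"

definition mvar :: "nat \<Rightarrow> 'a::comm_ring_1 mps" where
  "mvar i = mpmon (single i 1) 1"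

lemma mvar_power: "mvar i ^ n = mpmon (single i n) 1"
  using mpmon_power[of i 1 n] by (simp add: mvar_def)

lemma mvar_mult_mpmon: "mvar i * mpmon \<alpha> c = mpmon (single i 1 + \<alpha>) c"
  by (simp add: mvar_def mpmon_mult)

subsection \<open>The subring in the first variables\<close>

definition Pser :: "nat \<Rightarrow> 'a::comm_ring_1 mps set" where
  "Pser s = {f. \<forall>\<alpha>. \<alpha> \<notin> evecs s \<longrightarrow> mps_nth f \<alpha> = 0}"

lemma PserD: "f \<in> Pser s \<Longrightarrow> \<alpha> \<notin> evecs s \<Longrightarrow> mps_nth f \<alpha> = 0"
  by (simp add: Pser_def)

lemma Pser_zero [simp]: "0 \<in> Pser s"
  by (simp add: Pser_def)

lemma Pser_mpmon [simp]: "\<alpha> \<in> evecs s \<Longrightarrow> mpmon \<alpha> c \<in> Pser s"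
  by (auto simp: Pser_def mps_nth_mpmon)

lemma Pser_mvar [simp]: "i < s \<Longrightarrow> mvar i \<in> Pser s"
  by (simp add: mvar_def)

lemma Pser_one [simp]: "1 \<in> Pser s"
  by (simp flip: mpmon_0_1)

lemma Pser_add [simp]: "f \<in> Pser s \<Longrightarrow> g \<in> Pser s \<Longrightarrow> f + g \<in> Pser s"
  by (simp add: Pser_def)

lemma Pser_diff [simp]: "f \<in> Pser s \<Longrightarrow> g \<in> Pser s \<Longrightarrow> f - g \<in> Pser s"
  by (simp add: Pser_def)

lemma Pser_uminus [simp]: "f \<in> Pser s \<Longrightarrow> - f \<in> Pser s"
  by (simp add: Pser_def)

lemma Pser_mult [simp]: "f \<in> Pser s \<Longrightarrow> g \<in> Pser s \<Longrightarrow> f * g \<in> Pser s"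
  by (auto simp: Pser_def mps_nth_mult intro!: sum.neutral)

lemma Pser_sum [simp]: "(\<And>i. i \<in> I \<Longrightarrow> f i \<in> Pser s) \<Longrightarrow> (\<Sum>i\<in>I. f i) \<in> Pser s"
  by (induction I rule: infinite_finite_induct) auto

lemma Pser_prod [simp]: "(\<And>i. i \<in> I \<Longrightarrow> f i \<in> Pser s) \<Longrightarrow> (\<Prod>i\<in>I. f i) \<in> Pser s"
  by (induction I rule: infinite_finite_induct) auto

lemma Pser_power [simp]: "f \<in> Pser s \<Longrightarrow> f ^ n \<in> Pser s"
  by (induction n) auto

subsection \<open>The order filtration\<close>

text \<open>Within \<open>Pser s\<close> this is the n-th power of the maximal ideal m, see
  \<open>ideal_pow_iff\<close>. All limits refer to this filtration.\<close>

definition ordge :: "nat \<Rightarrow> 'a::comm_ring_1 mps set" where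
  "ordge n = {f. \<forall>\<alpha>. mdeg \<alpha> < n \<longrightarrow> mps_nth f \<alpha> = 0}"

lemma ordgeI: "(\<And>\<alpha>. mdeg \<alpha> < n \<Longrightarrow> mps_nth f \<alpha> = 0) \<Longrightarrow> f \<in> ordge n"
  by (simp add: ordge_def)

lemma ordgeD: "f \<in> ordge n \<Longrightarrow> mdeg \<alpha> < n \<Longrightarrow> mps_nth f \<alpha> = 0"
  by (simp add: ordge_def)

lemma ordge_0 [simp]: "f \<in> ordge 0"
  by (simp add: ordge_def)

lemma ordge_zero [simp]: "0 \<in> ordge n"
  by (simp add: ordge_def)

lemma ordge_antimono: "f \<in> ordge n \<Longrightarrow> m \<le> n \<Longrightarrow> f \<in> ordge m"
  by (auto simp: ordge_def)

lemma ordge_add [simp]: "f \<in> ordge n \<Longrightarrow> g \<in> ordge n \<Longrightarrow> f + g \<in> ordge n"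
  by (simp add: ordge_def)

lemma ordge_diff [simp]: "f \<in> ordge n \<Longrightarrow> g \<in> ordge n \<Longrightarrow> f - g \<in> ordge n"
  by (simp add: ordge_def)

lemma ordge_uminus [simp]: "f \<in> ordge n \<Longrightarrow> - f \<in> ordge n"
  by (simp add: ordge_def)

lemma ordge_sum [simp]: "(\<And>i. i \<in> I \<Longrightarrow> f i \<in> ordge n) \<Longrightarrow> (\<Sum>i\<in>I. f i) \<in> ordge n"
  by (induction I rule: infinite_finite_induct) auto

lemma ordge_mult: "f \<in> ordge n \<Longrightarrow> g \<in> ordge m \<Longrightarrow> f * g \<in> ordge (n + m)"
proof (rule ordgeI)
  fix \<gamma> assume f: "f \<in> ordge n" and g: "g \<in> ordge m" and "mdeg \<gamma> < n + m"
  then have "mdeg \<alpha> < n \<or> mdeg \<beta> < m" if "\<alpha> + \<beta> = \<gamma>" for \<alpha> \<beta>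
    using that by auto
  then show "mps_nth (f * g) \<gamma> = 0"
    unfolding mps_nth_mult using f g by (intro sum.neutral) (fastforce simp: ordge_def)
qed

lemma ordge_mult_ge: "f \<in> ordge n \<Longrightarrow> g \<in> ordge m \<Longrightarrow> k \<le> n + m \<Longrightarrow> f * g \<in> ordge k"
  by (rule ordge_antimono[OF ordge_mult])

lemma ordge_mult_left [simp]: "g \<in> ordge n \<Longrightarrow> f * g \<in> ordge n"
  using ordge_mult[OF ordge_0, of g n f] by simp

lemma ordge_mult_right [simp]: "f \<in> ordge n \<Longrightarrow> f * g \<in> ordge n"
  by (subst mult.commute) (rule ordge_mult_left)

lemma ordge_mpmon: "n \<le> mdeg \<alpha> \<Longrightarrow> mpmon \<alpha> c \<in> ordge n"
  by (auto simp: ordge_def mps_nth_mpmon)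

lemma ordge_mvar [simp]: "mvar i \<in> ordge (Suc 0)"
  by (simp add: mvar_def ordge_mpmon)

lemma mps_ordge_1_iff: "f \<in> ordge 1 \<longleftrightarrow> mps_nth f 0 = 0"
  by (auto simp: ordge_def)

lemma mps_eq_0I: "(\<And>n. f \<in> ordge n) \<Longrightarrow> f = 0"
  by (rule mps_eqI) (metis lessI mps_nth_zero ordgeD)

lemma mps_nth_0_mult [simp]: "mps_nth (f * g) 0 = mps_nth f 0 * mps_nth g 0"
proof -
  have "decomps 0 = {(0, 0)}"
    by (auto simp: decomps_def) (metis add_is_0 mdeg_add mdeg_eq_0_iff mdeg_zero)+
  then show ?thesis by (simp add: mps_nth_mult)
qed

lemma mps_limit:
  assumes "\<And>n. f (Suc n) - f n \<in> ordge n" "\<And>n. f n \<in> Pser s"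
  obtains g where "g \<in> Pser s" "\<And>n. g - f n \<in> ordge n"
proof
  \<comment> \<open>Coefficients of degree less than n do not change from index n on, so those of
    degree \<open>mdeg \<alpha>\<close> are settled at the next index.\<close>
  let ?g = "Mps (\<lambda>\<alpha>. mps_nth (f (Suc (mdeg \<alpha>))) \<alpha>)"
  show "?g \<in> Pser s" using assms(2) by (auto simp: Pser_def)
  have *: "f (n + k) - f n \<in> ordge n" for n k
  proof (induction k)
    case (Suc k)
    have "f (n + Suc k) - f n = (f (Suc (n + k)) - f (n + k)) + (f (n + k) - f n)" by simp
    also have "\<dots> \<in> ordge n" using Suc assms(1)[of "n + k"] by (intro ordge_add) (auto intro: ordge_antimono)
    finally show ?case .
  qed simp
  show "?g - f n \<in> ordge n" for n
  proof (rule ordgeI)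
    fix \<alpha> assume "mdeg \<alpha> < n"
    then obtain k where n: "n = Suc (mdeg \<alpha>) + k" using less_iff_Suc_add by auto
    show "mps_nth (?g - f n) \<alpha> = 0"
      using ordgeD[OF *[of "Suc (mdeg \<alpha>)" k], of \<alpha>] by (simp add: n)
  qed
qed

text \<open>Banach's fixed point theorem for the order filtration. It supplies inverses of series
  and preimages under substitutions.\<close>

lemma contraction_fixpoint:
  assumes "\<And>f. f \<in> Pser s \<Longrightarrow> F f \<in> Pser s"
    and contr: "\<And>n f g. f \<in> Pser s \<Longrightarrow> g \<in> Pser s \<Longrightarrow> f - g \<in> ordge n \<Longrightarrow> F f - F g \<in> ordge (Suc n)"
  obtains f where "f \<in> Pser s" "F f = f"
proof -
  define a where "a n = (F ^^ n) 0" for n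
  have a: "a n \<in> Pser s" for n by (induction n) (auto simp: a_def assms(1))
  have d: "a (Suc n) - a n \<in> ordge n" for n
  proof (induction n)
    case (Suc n)
    have "F (a (Suc n)) - F (a n) \<in> ordge (Suc n)" by (intro contr a Suc)
    then show ?case by (simp add: a_def)
  qed simp
  obtain f where f: "f \<in> Pser s" "\<And>n. f - a n \<in> ordge n"
    using mps_limit[OF d a] by blast
  have "F f - f \<in> ordge n" for n
  proof -
    have "F f - f = (F f - F (a n)) - (f - a (Suc n))" by (simp add: a_def)
    also have "\<dots> \<in> ordge n"
      using contr[OF f(1) a f(2), of n] f(2)[of "Suc n"]
      by (metis ordge_diff ordge_antimono le_SucI order_refl)
    finally show ?thesis .
  qed
  then have "F f = f" using mps_eq_0I by fastforce
  with f(1) that show ?thesis by blast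
qed

lemma mps_unit:
  fixes f :: "'a::field mps"
  assumes "f \<in> Pser s" "mps_nth f 0 \<noteq> 0"
  obtains g where "g \<in> Pser s" "f * g = 1"
proof -
  define c where "c = mconst (1 / mps_nth f 0)"
  have c: "c \<in> Pser s" by (simp add: c_def)
  have 1: "1 - c * f \<in> ordge 1" unfolding mps_ordge_1_iff using assms(2) by (simp add: mps_nth_one c_def mps_nth_mpmon)
  \<comment> \<open>Multiplication by 1 - c f raises the order, so the map contracts; a fixed point
    satisfies c f g = c, and c is an invertible constant.\<close>
  obtain g where g: "g \<in> Pser s" "c + (1 - c * f) * g = g"
  proof (rule contraction_fixpoint[of s "\<lambda>g. c + (1 - c * f) * g"])
    fix n and g h :: "'a mps" assume "g - h \<in> ordge n"
    then have "(1 - c * f) * (g - h) \<in> ordge (Suc n)" using ordge_mult[OF 1] by fastforce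
    then show "c + (1 - c * f) * g - (c + (1 - c * f) * h) \<in> ordge (Suc n)"
      by (simp add: algebra_simps)
  qed (use assms c in auto)
  have "c * (f * g) = c" using g(2) by (simp add: algebra_simps)
  then have "mconst (mps_nth f 0) * c * (f * g) = mconst (mps_nth f 0) * c" by (simp add: mult.assoc)
  moreover have "mconst (mps_nth f 0) * c = 1"
    using assms(2) by (simp add: c_def mpmon_mult mpmon_0_1)
  ultimately show ?thesis using that g(1) by simp
qed

definition trunc :: "nat \<Rightarrow> nat \<Rightarrow> 'a mps \<Rightarrow> 'a::comm_ring_1 mps" where
  "trunc s n f = (\<Sum>\<alpha> | \<alpha> \<in> evecs s \<and> mdeg \<alpha> \<le> n. mpmon \<alpha> (mps_nth f \<alpha>))"

lemma mps_nth_trunc: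
  "mps_nth (trunc s n f) \<alpha> = (if \<alpha> \<in> evecs s \<and> mdeg \<alpha> \<le> n then mps_nth f \<alpha> else 0)"
  using finite_evecs_bounded[of s n] by (simp add: trunc_def mps_nth_mpmon)

lemma trunc_ordge: "f \<in> Pser s \<Longrightarrow> f - trunc s n f \<in> ordge (Suc n)"
  by (auto simp: ordge_def mps_nth_trunc Pser_def)

lemma trunc_Pser [simp]: "trunc s n f \<in> Pser s"
  by (simp add: Pser_def mps_nth_trunc)

text \<open>The truncation of f is a finite sum of monomials and the rest has high order. Applied to
  the difference \<Theta> of two additive expressions, for all N, this proves them equal without any
  notion of infinite sum.\<close>

lemma ordge_by_monomials:
  assumes add: "\<And>f g. f \<in> Pser s \<Longrightarrow> g \<in> Pser s \<Longrightarrow> \<Theta> (f + g) = \<Theta> f + \<Theta> g"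
    and mon: "\<And>\<alpha>. \<alpha> \<in> evecs s \<Longrightarrow> \<Theta> (mpmon \<alpha> (mps_nth f \<alpha>)) \<in> ordge N"
    and cont: "\<And>f. f \<in> Pser s \<Longrightarrow> f \<in> ordge (Suc N) \<Longrightarrow> \<Theta> f \<in> ordge N"
    and f: "f \<in> Pser s"
  shows "\<Theta> f \<in> ordge N"
proof -
  have zero: "\<Theta> 0 = 0" using add[of 0 0] by simp
  have sum: "\<Theta> (\<Sum>\<alpha>\<in>I. mpmon \<alpha> (mps_nth f \<alpha>)) \<in> ordge N" if "finite I" "I \<subseteq> evecs s" for I
    using that
  proof (induction I rule: finite_induct)
    case (insert \<alpha> I)
    then show ?case by (subst sum.insert) (auto simp: add[OF Pser_mpmon Pser_sum] subset_eq mon)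
  qed (simp add: zero)
  have "\<Theta> f = \<Theta> (trunc s N f) + \<Theta> (f - trunc s N f)"
    using add[of "trunc s N f" "f - trunc s N f"] f by simp
  also have "\<dots> \<in> ordge N"
    using sum[OF finite_evecs_bounded[of s N]] cont[OF Pser_diff[OF f trunc_Pser] trunc_ordge[OF f]]
    by (intro ordge_add) (auto simp: trunc_def)
  finally show ?thesis .
qed

text \<open>Each monomial is charged to the least i with x_i^a dividing it, so none is counted
  twice. The case a = 1 serves the filtration, larger a the pigeonhole argument in
  \<open>ordge_in_submod\<close>.\<close>

lemma decompose_by_variables:
  assumes f: "f \<in> Pser s" and supp: "\<And>\<alpha>. \<alpha> \<in> evecs s \<Longrightarrow> mps_nth f \<alpha> \<noteq> 0 \<Longrightarrow> \<exists>i<s. a \<le> lookup \<alpha> i"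
  obtains g where "\<And>i. g i \<in> Pser s" "f = (\<Sum>i<s. mvar i ^ a * g i)"
    "\<And>i n. f \<in> ordge (n + a) \<Longrightarrow> g i \<in> ordge n"
proof -
  let ?e = "\<lambda>i. single i a"
  define first where "first \<alpha> = (LEAST i. i < s \<and> a \<le> lookup \<alpha> i)" for \<alpha>
  define g where "g i = Mps (\<lambda>\<beta>. if i < s \<and> first (?e i + \<beta>) = i then mps_nth f (?e i + \<beta>) else 0)" for i
  have gP: "g i \<in> Pser s" for i
    using f by (auto simp: g_def Pser_def)
  have "mps_nth f \<alpha> = mps_nth (\<Sum>i<s. mvar i ^ a * g i) \<alpha>" for \<alpha>
  proof -
    have coef: "mps_nth (mvar i ^ a * g i) \<alpha> = (if i = first \<alpha> then mps_nth f \<alpha> else 0)" if "i < s" for i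
    proof (cases "a \<le> lookup \<alpha> i")
      case True
      have "mps_nth (mpmon (?e i) 1 * g i) (?e i + (\<alpha> - ?e i)) = (if i = first \<alpha> then mps_nth f \<alpha> else 0)"
        unfolding mps_nth_mpmon_mult using single_add_diff[OF True] \<open>i < s\<close> by (auto simp: g_def)
      then show ?thesis using single_add_diff[OF True] by (simp add: mvar_power)
    next
      case False
      then have "mps_nth (mpmon (?e i) 1 * g i) \<alpha> = 0"
        by (intro mps_nth_mpmon_mult_eq_0) (auto simp: lookup_add)
      moreover have "mps_nth f \<alpha> = 0" if "i = first \<alpha>"
      proof (rule ccontr)
        assume "mps_nth f \<alpha> \<noteq> 0"
        then have "\<exists>i<s. a \<le> lookup \<alpha> i" using supp f PserD by blast
        then have "a \<le> lookup \<alpha> (first \<alpha>)" unfolding first_def by (rule LeastI2_ex) auto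
        with False that show False by simp
      qed
      ultimately show ?thesis by (simp add: mvar_power)
    qed
    show ?thesis
    proof (cases "mps_nth f \<alpha> = 0")
      case True
      then show ?thesis using coef by simp
    next
      case False
      then have "\<exists>i<s. a \<le> lookup \<alpha> i" using supp f PserD by blast
      then have "first \<alpha> < s" unfolding first_def by (rule LeastI2_ex) auto
      then show ?thesis using coef by simp
    qed
  qed
  then have "f = (\<Sum>i<s. mvar i ^ a * g i)" by (rule mps_eqI)
  moreover have "g i \<in> ordge n" if "f \<in> ordge (n + a)" for i n
    using that by (auto simp: ordge_def g_def)
  ultimately show ?thesis using that gP by blast
qed

text \<open>This is the identity of m^(n+1) with the sum of the x_i m^n. It drives the inductions on
  ideal powers, on preimages under the tangent map and on orders under automorphisms.\<close>

lemma ordge_Suc_decompose: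
  assumes "f \<in> Pser s" "f \<in> ordge (Suc n)"
  obtains g where "\<And>i. g i \<in> Pser s" "\<And>i. g i \<in> ordge n" "f = (\<Sum>i<s. mvar i * g i)"
proof -
  have *: "\<exists>i<s. 1 \<le> lookup \<alpha> i" if "\<alpha> \<in> evecs s" "mps_nth f \<alpha> \<noteq> 0" for \<alpha>
  proof -
    have "mdeg \<alpha> \<noteq> 0" using that(2) ordgeD[OF assms(2), of \<alpha>] by auto
    then have "(\<Sum>i<s. lookup \<alpha> i) \<noteq> 0" using mdeg_evecs[OF that(1)] by simp
    then obtain i where "i < s" "lookup \<alpha> i \<noteq> 0" by (auto elim: sum.not_neutral_contains_not_neutral)
    then show ?thesis by (intro exI[of _ i]) auto
  qed
  show ?thesis
  proof (rule decompose_by_variables[OF assms(1) *])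
    fix g assume "\<And>i. g i \<in> Pser s" "f = (\<Sum>i<s. mvar i ^ 1 * g i)"
      "\<And>i n. f \<in> ordge (n + 1) \<Longrightarrow> g i \<in> ordge n"
    then show thesis using that[of g] assms(2) by simp
  qed
qed

subsection \<open>Partial derivatives\<close>

definition mderiv :: "nat \<Rightarrow> 'a::comm_ring_1 mps \<Rightarrow> 'a mps" where
  "mderiv \<nu> f = Mps (\<lambda>\<alpha>. of_nat (lookup \<alpha> \<nu> + 1) * mps_nth f (\<alpha> + single \<nu> 1))"

lemma mps_nth_mderiv:
  "mps_nth (mderiv \<nu> f) \<alpha> = of_nat (lookup \<alpha> \<nu> + 1) * mps_nth f (\<alpha> + single \<nu> 1)"
  by (simp add: mderiv_def)

lemma mderiv_add [simp]: "mderiv \<nu> (f + g) = mderiv \<nu> f + mderiv \<nu> g"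
  by (rule mps_eqI) (simp add: mps_nth_mderiv algebra_simps)

lemma mderiv_zero [simp]: "mderiv \<nu> 0 = 0"
  by (rule mps_eqI) (simp add: mps_nth_mderiv)

lemma mderiv_sum [simp]: "mderiv \<nu> (\<Sum>i\<in>I. f i) = (\<Sum>i\<in>I. mderiv \<nu> (f i))"
  by (induction I rule: infinite_finite_induct) auto

lemma mderiv_Pser [simp]: "f \<in> Pser s \<Longrightarrow> mderiv \<nu> f \<in> Pser s"
  by (simp add: Pser_def mps_nth_mderiv)

lemma mderiv_ordge: "f \<in> ordge (Suc n) \<Longrightarrow> mderiv \<nu> f \<in> ordge n"
  by (simp add: ordge_def mps_nth_mderiv)

text \<open>Half of the Leibniz rule. In the coefficient of f g at \<gamma> + e_\<nu>, the weight
  \<gamma>_\<nu> + 1 is the sum of the \<nu>-entries of \<alpha> and \<beta>. Here the first part is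
  summed: pairs with entry 0 drop out and the others shift by e_\<nu>.\<close>

lemma sum_decomps_weighted:
  "(\<Sum>(\<alpha>, \<beta>)\<in>decomps (\<gamma> + single \<nu> 1). of_nat (lookup \<alpha> \<nu>) * (mps_nth f \<alpha> * mps_nth g \<beta>))
     = mps_nth (mderiv \<nu> f * g) \<gamma>"
proof -
  let ?e = "single \<nu> (1 :: nat)"
  let ?D = "{(\<alpha>, \<beta>) \<in> decomps (\<gamma> + ?e). lookup \<alpha> \<nu> \<noteq> 0}"
  have "(\<Sum>(\<alpha>, \<beta>)\<in>decomps (\<gamma> + ?e). of_nat (lookup \<alpha> \<nu>) * (mps_nth f \<alpha> * mps_nth g \<beta>))
      = (\<Sum>(\<alpha>, \<beta>)\<in>?D. of_nat (lookup \<alpha> \<nu>) * (mps_nth f \<alpha> * mps_nth g \<beta>))"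
    by (rule sum.mono_neutral_right) (auto intro: gr0I)
  also have "\<dots> = (\<Sum>(\<alpha>, \<beta>)\<in>decomps \<gamma>. mps_nth (mderiv \<nu> f) \<alpha> * mps_nth g \<beta>)"
  proof (rule sum.reindex_bij_witness[where i = "\<lambda>(\<alpha>, \<beta>). (\<alpha> + ?e, \<beta>)" and j = "\<lambda>(\<alpha>, \<beta>). (\<alpha> - ?e, \<beta>)"])
    fix p assume "p \<in> ?D"
    then obtain \<alpha> \<beta> where p: "p = (\<alpha>, \<beta>)" "\<alpha> + \<beta> = \<gamma> + ?e" "lookup \<alpha> \<nu> \<noteq> 0" by auto
    then have a: "?e + (\<alpha> - ?e) = \<alpha>" by (intro single_add_diff) simp
    then have "?e + (\<alpha> - ?e + \<beta>) = ?e + \<gamma>" using p(2) by (metis add.assoc add.commute)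
    then show "(case p of (\<alpha>, \<beta>) \<Rightarrow> (\<alpha> - ?e, \<beta>)) \<in> decomps \<gamma>" by (simp add: p)
    show "(case case p of (\<alpha>, \<beta>) \<Rightarrow> (\<alpha> - ?e, \<beta>) of (\<alpha>, \<beta>) \<Rightarrow> (\<alpha> + ?e, \<beta>)) = p"
      using a by (simp add: p add.commute)
    have "lookup (\<alpha> - ?e) \<nu> + 1 = lookup \<alpha> \<nu>" using p by (simp add: lookup_minus)
    then show "(case case p of (\<alpha>, \<beta>) \<Rightarrow> (\<alpha> - ?e, \<beta>) of (\<alpha>, \<beta>) \<Rightarrow> mps_nth (mderiv \<nu> f) \<alpha> * mps_nth g \<beta>)
      = (case p of (\<alpha>, \<beta>) \<Rightarrow> of_nat (lookup \<alpha> \<nu>) * (mps_nth f \<alpha> * mps_nth g \<beta>))"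
      using a by (simp add: p mps_nth_mderiv add.commute mult.assoc del: of_nat_add of_nat_Suc)
  next
    fix p assume "p \<in> decomps \<gamma>"
    then show "(case case p of (\<alpha>, \<beta>) \<Rightarrow> (\<alpha> + ?e, \<beta>) of (\<alpha>, \<beta>) \<Rightarrow> (\<alpha> - ?e, \<beta>)) = p"
      "(case p of (\<alpha>, \<beta>) \<Rightarrow> (\<alpha> + ?e, \<beta>)) \<in> ?D"
      by (auto simp: lookup_add decomps_def add_ac)
  qed
  finally show ?thesis by (simp add: mps_nth_mult)
qed

lemma mderiv_mult: "mderiv \<nu> (f * g) = mderiv \<nu> f * g + f * mderiv \<nu> g"
proof (rule mps_eqI)
  fix \<gamma>
  let ?e = "single \<nu> (1 :: nat)"
  let ?D = "decomps (\<gamma> + ?e)"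
  have deg: "lookup \<gamma> \<nu> + 1 = lookup \<alpha> \<nu> + lookup \<beta> \<nu>" if "\<alpha> + \<beta> = \<gamma> + ?e" for \<alpha> \<beta>
    using arg_cong[OF that, of "\<lambda>\<delta>. lookup \<delta> \<nu>"] by (simp add: lookup_add)
  have "mps_nth (mderiv \<nu> (f * g)) \<gamma>
      = (\<Sum>(\<alpha>, \<beta>)\<in>?D. of_nat (lookup \<gamma> \<nu> + 1) * (mps_nth f \<alpha> * mps_nth g \<beta>))"
    by (simp add: mps_nth_mderiv mps_nth_mult sum_distrib_left case_prod_unfold)
  also have "\<dots> = (\<Sum>(\<alpha>, \<beta>)\<in>?D. of_nat (lookup \<alpha> \<nu>) * (mps_nth f \<alpha> * mps_nth g \<beta>)
        + of_nat (lookup \<beta> \<nu>) * (mps_nth f \<alpha> * mps_nth g \<beta>))"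
  proof (intro sum.cong refl, clarify)
    fix \<alpha> \<beta> assume "(\<alpha>, \<beta>) \<in> ?D"
    then have "lookup \<gamma> \<nu> + 1 = lookup \<alpha> \<nu> + lookup \<beta> \<nu>" by (intro deg) simp
    then show "of_nat (lookup \<gamma> \<nu> + 1) * (mps_nth f \<alpha> * mps_nth g \<beta>)
      = of_nat (lookup \<alpha> \<nu>) * (mps_nth f \<alpha> * mps_nth g \<beta>) + of_nat (lookup \<beta> \<nu>) * (mps_nth f \<alpha> * mps_nth g \<beta>)"
      by (simp only: of_nat_add distrib_right)
  qed
  also have "\<dots> = (\<Sum>(\<alpha>, \<beta>)\<in>?D. of_nat (lookup \<alpha> \<nu>) * (mps_nth f \<alpha> * mps_nth g \<beta>))
        + (\<Sum>(\<alpha>, \<beta>)\<in>?D. of_nat (lookup \<beta> \<nu>) * (mps_nth f \<alpha> * mps_nth g \<beta>))"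
    by (simp add: sum.distrib case_prod_unfold)
  also have "(\<Sum>(\<alpha>, \<beta>)\<in>?D. of_nat (lookup \<beta> \<nu>) * (mps_nth f \<alpha> * mps_nth g \<beta>))
      = (\<Sum>(\<alpha>, \<beta>)\<in>?D. of_nat (lookup \<alpha> \<nu>) * (mps_nth g \<alpha> * mps_nth f \<beta>))"
    by (rule sum.reindex_bij_witness[where i = prod.swap and j = prod.swap]) (auto simp: add.commute mult.commute)
  finally show "mps_nth (mderiv \<nu> (f * g)) \<gamma> = mps_nth (mderiv \<nu> f * g + f * mderiv \<nu> g) \<gamma>"
    by (simp only: sum_decomps_weighted mps_nth_add mult.commute[of f])
qed

lemma mderiv_const [simp]: "mderiv \<nu> (mconst c) = 0"
  by (rule mps_eqI) (auto simp: mps_nth_mderiv mps_nth_mpmon dest: arg_cong[of _ _ mdeg])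

lemma mderiv_one [simp]: "mderiv \<nu> 1 = 0"
  using mderiv_const[of \<nu> 1] by (simp only: mpmon_0_1)

lemma mderiv_var: "mderiv \<nu> (mvar i) = (if i = \<nu> then 1 else 0)"
proof (rule mps_eqI)
  fix \<alpha>
  have "\<alpha> + single \<nu> 1 = single i (1 :: nat) \<longleftrightarrow> \<alpha> = 0 \<and> i = \<nu>"
  proof
    assume *: "\<alpha> + single \<nu> 1 = single i (1 :: nat)"
    then have "\<alpha> = 0" by (metis add_cancel_left_left mdeg_add mdeg_eq_0_iff mdeg_single)
    with * have "lookup (single \<nu> (1 :: nat)) i = lookup (single i 1) i" by simp
    with \<open>\<alpha> = 0\<close> show "\<alpha> = 0 \<and> i = \<nu>" by (simp add: lookup_single when_def split: if_splits)
  qed simp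
  then show "mps_nth (mderiv \<nu> (mvar i)) \<alpha> = mps_nth (if i = \<nu> then 1 else 0) \<alpha>"
    by (auto simp: mps_nth_mderiv mps_nth_mpmon mps_nth_one mvar_def)
qed

lemma mderiv_power: "mderiv \<nu> (f ^ n) = of_nat n * f ^ (n - 1) * mderiv \<nu> f"
proof (induction n)
  case (Suc n)
  then show ?case by (cases n) (auto simp: mderiv_mult algebra_simps)
qed simp

section \<open>Substitution\<close>

definition mons :: "nat \<Rightarrow> (nat \<Rightarrow> 'a mps) \<Rightarrow> (nat \<Rightarrow>\<^sub>0 nat) \<Rightarrow> 'a::comm_ring_1 mps" where
  "mons s g \<alpha> = (\<Prod>i<s. g i ^ lookup \<alpha> i)"

lemma mons_zero [simp]: "mons s g 0 = 1"
  by (simp add: mons_def)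

lemma mons_add: "mons s g (\<alpha> + \<beta>) = mons s g \<alpha> * mons s g \<beta>"
  by (simp add: mons_def lookup_add power_add prod.distrib)

lemma mons_single: "i < s \<Longrightarrow> mons s g (single i 1) = g i"
proof -
  assume "i < s"
  have "mons s g (single i 1) = (\<Prod>j<s. if j = i then g i else 1)"
    unfolding mons_def by (intro prod.cong) (auto simp: lookup_single when_def)
  then show ?thesis using \<open>i < s\<close> by simp
qed

lemma mons_Pser [simp]: "(\<And>i. i < s \<Longrightarrow> g i \<in> Pser s) \<Longrightarrow> mons s g \<alpha> \<in> Pser s"
  unfolding mons_def by (intro Pser_prod Pser_power) auto

text \<open>The degree cutoff keeps the sum finite for every g. When the g i lie in m it omits only
  zero terms, by \<open>mons_ordge\<close>.\<close>

definition msubst :: "nat \<Rightarrow> (nat \<Rightarrow> 'a mps) \<Rightarrow> 'a mps \<Rightarrow> 'a::comm_ring_1 mps" where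
  "msubst s g f = Mps (\<lambda>\<gamma>. \<Sum>\<alpha> | \<alpha> \<in> evecs s \<and> mdeg \<alpha> \<le> mdeg \<gamma>. mps_nth f \<alpha> * mps_nth (mons s g \<alpha>) \<gamma>)"

lemma mps_nth_msubst:
  "mps_nth (msubst s g f) \<gamma> = (\<Sum>\<alpha> | \<alpha> \<in> evecs s \<and> mdeg \<alpha> \<le> mdeg \<gamma>. mps_nth f \<alpha> * mps_nth (mons s g \<alpha>) \<gamma>)"
  by (simp add: msubst_def)

lemma msubst_add: "msubst s g (f + h) = msubst s g f + msubst s g h"
  by (rule mps_eqI) (simp add: mps_nth_msubst distrib_right sum.distrib)

lemma msubst_diff: "msubst s g (f - h) = msubst s g f - msubst s g h"
  by (rule mps_eqI) (simp add: mps_nth_msubst left_diff_distrib sum_subtractf)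

lemma msubst_ordge: "f \<in> ordge n \<Longrightarrow> msubst s g f \<in> ordge n"
  by (auto simp: ordge_def mps_nth_msubst intro!: sum.neutral)

lemma msubst_Pser [simp]: "(\<And>i. i < s \<Longrightarrow> g i \<in> Pser s) \<Longrightarrow> msubst s g f \<in> Pser s"
  using mons_Pser[of s g] by (auto simp: Pser_def mps_nth_msubst intro!: sum.neutral)

context
  fixes s :: nat and g :: "nat \<Rightarrow> 'a::comm_ring_1 mps"
  assumes g_ord: "\<And>i. i < s \<Longrightarrow> g i \<in> ordge 1"
begin

lemma mons_ordge: "\<alpha> \<in> evecs s \<Longrightarrow> mons s g \<alpha> \<in> ordge (mdeg \<alpha>)"
proof (induction \<alpha> rule: evecs_induct)
  case (add i \<beta>)
  then show ?case using ordge_mult[OF g_ord add(3)] by (simp add: mons_add mons_single del: One_nat_def)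
qed simp

lemma msubst_mpmon:
  assumes "\<alpha> \<in> evecs s"
  shows "msubst s g (mpmon \<alpha> c) = mconst c * mons s g \<alpha>"
proof (rule mps_eqI)
  fix \<gamma>
  have "mps_nth (msubst s g (mpmon \<alpha> c)) \<gamma>
      = (\<Sum>\<beta> | \<beta> \<in> evecs s \<and> mdeg \<beta> \<le> mdeg \<gamma>. if \<beta> = \<alpha> then c * mps_nth (mons s g \<alpha>) \<gamma> else 0)"
    unfolding mps_nth_msubst by (intro sum.cong) (auto simp: mps_nth_mpmon)
  also have "\<dots> = (if mdeg \<alpha> \<le> mdeg \<gamma> then c * mps_nth (mons s g \<alpha>) \<gamma> else 0)"
    using assms finite_evecs_bounded[of s "mdeg \<gamma>"] by simp
  also have "\<dots> = c * mps_nth (mons s g \<alpha>) \<gamma>"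
    using ordgeD[OF mons_ordge[OF assms], of \<gamma>] by auto
  finally show "mps_nth (msubst s g (mpmon \<alpha> c)) \<gamma> = mps_nth (mconst c * mons s g \<alpha>) \<gamma>" by simp
qed

text \<open>Both sides are additive in each factor and respect the filtration, so reducing first f
  and then h to monomials leaves the rule for adding exponents.\<close>

lemma msubst_mult:
  assumes "f \<in> Pser s" "h \<in> Pser s"
  shows "msubst s g (f * h) = msubst s g f * msubst s g h"
proof -
  have "msubst s g (f * h) - msubst s g f * msubst s g h \<in> ordge N" for N
  proof (rule ordge_by_monomials[where f = f and s = s])
    fix \<alpha> assume \<alpha>: "\<alpha> \<in> evecs s"
    let ?x = "mpmon \<alpha> (mps_nth f \<alpha>)"
    show "msubst s g (?x * h) - msubst s g ?x * msubst s g h \<in> ordge N"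
    proof (rule ordge_by_monomials[where f = h and s = s])
      fix \<beta> assume \<beta>: "\<beta> \<in> evecs s"
      have "msubst s g (?x * mpmon \<beta> c) = msubst s g ?x * msubst s g (mpmon \<beta> c)" for c
      proof -
        have "msubst s g (?x * mpmon \<beta> c) = mconst (mps_nth f \<alpha>) * mconst c * (mons s g \<alpha> * mons s g \<beta>)"
          using \<alpha> \<beta> by (simp add: mpmon_mult msubst_mpmon mons_add)
        then show ?thesis using \<alpha> \<beta> by (simp only: msubst_mpmon mult_ac)
      qed
      then show "msubst s g (?x * mpmon \<beta> (mps_nth h \<beta>)) - msubst s g ?x * msubst s g (mpmon \<beta> (mps_nth h \<beta>)) \<in> ordge N"
        by simp
    next
      fix f' :: "'a mps" assume "f' \<in> ordge (Suc N)"
      then show "msubst s g (?x * f') - msubst s g ?x * msubst s g f' \<in> ordge N"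
        by (intro ordge_diff ordge_mult_left msubst_ordge) (auto elim: ordge_antimono)
    qed (use assms in \<open>auto simp: msubst_add distrib_left\<close>)
  next
    fix f' :: "'a mps" assume "f' \<in> ordge (Suc N)"
    then show "msubst s g (f' * h) - msubst s g f' * msubst s g h \<in> ordge N"
      by (intro ordge_diff ordge_mult_right msubst_ordge) (auto elim: ordge_antimono)
  qed (use assms in \<open>auto simp: msubst_add distrib_right\<close>)
  then show ?thesis using mps_eq_0I by fastforce
qed

lemma msubst_const: "msubst s g (mconst c) = mconst c"
  by (simp add: msubst_mpmon)

end

section \<open>First order expansion of substitutions\<close>

text \<open>Here p and q are perturbations of b whose relative orders are e and m, and \<delta> is the linear part of q - p.\<close>

lemma expansion_mult:
  fixes b p q \<delta> b' p' q' \<delta>' :: "'a::comm_ring_1 mps"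
  assumes "e \<le> m"
    and 1: "b \<in> ordge k" "p - b \<in> ordge (k + e)" "q - p \<in> ordge (k + m)" "q - p - \<delta> \<in> ordge (k + e + m)"
    and 2: "b' \<in> ordge k'" "p' - b' \<in> ordge (k' + e)" "q' - p' \<in> ordge (k' + m)" "q' - p' - \<delta>' \<in> ordge (k' + e + m)"
  shows "b * b' \<in> ordge (k + k')" "p * p' - b * b' \<in> ordge (k + k' + e)" "q * q' - p * p' \<in> ordge (k + k' + m)"
    "q * q' - p * p' - (\<delta> * b' + b * \<delta>') \<in> ordge (k + k' + e + m)"
proof -
  have \<delta>: "\<delta> \<in> ordge (k + m)"
    using ordge_diff[OF 1(3) ordge_antimono[OF 1(4), of "k + m"]] by simp
  have \<delta>': "\<delta>' \<in> ordge (k' + m)"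
    using ordge_diff[OF 2(3) ordge_antimono[OF 2(4), of "k' + m"]] by simp
  have p: "p \<in> ordge k" using ordge_add[OF 1(1) ordge_antimono[OF 1(2), of k]] by simp
  have p': "p' \<in> ordge k'" using ordge_add[OF 2(1) ordge_antimono[OF 2(2), of k']] by simp
  have q': "q' \<in> ordge k'" using ordge_add[OF p' ordge_antimono[OF 2(3), of k']] by simp
  have qb': "q' - b' \<in> ordge (k' + e)"
    using ordge_add[OF 2(2) ordge_antimono[OF 2(3), of "k' + e"]] assms(1) by simp
  show "b * b' \<in> ordge (k + k')" by (rule ordge_mult[OF 1(1) 2(1)])
  have "p * p' - b * b' = (p - b) * p' + b * (p' - b')" by (simp add: algebra_simps)
  also have "\<dots> \<in> ordge (k + k' + e)"
    by (intro ordge_add; rule ordge_mult_ge; (rule 1 2 p')?; simp)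
  finally show "p * p' - b * b' \<in> ordge (k + k' + e)" .
  have "q * q' - p * p' = (q - p) * q' + p * (q' - p')" by (simp add: algebra_simps)
  also have "\<dots> \<in> ordge (k + k' + m)"
    by (intro ordge_add; rule ordge_mult_ge; (rule 1 2 q' p)?; simp)
  finally show "q * q' - p * p' \<in> ordge (k + k' + m)" .
  have "q * q' - p * p' - (\<delta> * b' + b * \<delta>')
      = (q - p - \<delta>) * q' + \<delta> * (q' - b') + (p * (q' - p' - \<delta>') + (p - b) * \<delta>')"
    by (simp add: algebra_simps)
  also have "\<dots> \<in> ordge (k + k' + e + m)"
    by (intro ordge_add; rule ordge_mult_ge; (rule 1 2 q' p qb' \<delta> \<delta>')?; simp)
  finally show "q * q' - p * p' - (\<delta> * b' + b * \<delta>') \<in> ordge (k + k' + e + m)" .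
qed

context
  fixes s e m :: nat and d d' :: "nat \<Rightarrow> 'a::comm_ring_1 mps"
  assumes d: "\<And>i. i < s \<Longrightarrow> d i \<in> ordge (Suc e)" and d': "\<And>i. i < s \<Longrightarrow> d' i \<in> ordge (Suc m)"
    and em: "e \<le> m"
begin

text \<open>The variable x_i is a factor of order 1 with linear part d' i, and
  \<open>expansion_mult\<close> attaches it to a smaller monomial. The relative orders e and m do
  not depend on the degree, so the four bounds survive the induction together.\<close>

lemma mons_expansion:
  assumes "\<alpha> \<in> evecs s"
  defines "b \<equiv> mpmon \<alpha> 1" and "p \<equiv> mons s (\<lambda>i. mvar i + d i) \<alpha>" and "q \<equiv> mons s (\<lambda>i. mvar i + d i + d' i) \<alpha>"
  shows "b \<in> ordge (mdeg \<alpha>) \<and> p - b \<in> ordge (mdeg \<alpha> + e) \<and> q - p \<in> ordge (mdeg \<alpha> + m)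
    \<and> q - p - (\<Sum>\<nu><s. d' \<nu> * mderiv \<nu> b) \<in> ordge (mdeg \<alpha> + e + m)"
  unfolding b_def p_def q_def using assms(1)
proof (induction \<alpha> rule: evecs_induct)
  case zero
  then show ?case by (simp add: mpmon_0_1)
next
  case (add i \<beta>)
  let ?\<delta> = "\<lambda>b. \<Sum>\<nu><s. d' \<nu> * mderiv \<nu> b"
  have \<delta>i: "?\<delta> (mvar i) = d' i" using add(1) by (simp add: mderiv_var if_distrib cong: if_cong)
  have \<delta>: "?\<delta> (mpmon (single i 1 + \<beta>) 1) = d' i * mpmon \<beta> 1 + mvar i * ?\<delta> (mpmon \<beta> 1)"
  proof -
    have "?\<delta> (mpmon (single i 1 + \<beta>) 1) = (\<Sum>\<nu><s. d' \<nu> * mderiv \<nu> (mvar i * mpmon \<beta> 1))"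
      by (simp add: mvar_mult_mpmon)
    also have "\<dots> = ?\<delta> (mvar i) * mpmon \<beta> 1 + mvar i * ?\<delta> (mpmon \<beta> 1)"
      by (simp add: mderiv_mult sum.distrib sum_distrib_left sum_distrib_right algebra_simps)
    finally show ?thesis by (simp only: \<delta>i)
  qed
  have i: "mvar i \<in> ordge 1" "mvar i + d i - mvar i \<in> ordge (1 + e)"
    "mvar i + d i + d' i - (mvar i + d i) \<in> ordge (1 + m)"
    "mvar i + d i + d' i - (mvar i + d i) - d' i \<in> ordge (1 + e + m)"
    using d[OF add(1)] d'[OF add(1)] by auto
  note * = expansion_mult[OF em i add(3)[THEN conjunct1] add(3)[THEN conjunct2, THEN conjunct1]
      add(3)[THEN conjunct2, THEN conjunct2, THEN conjunct1] add(3)[THEN conjunct2, THEN conjunct2, THEN conjunct2]]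
  show ?case using * add(1)
    by (simp add: \<delta> mons_add mons_single mvar_mult_mpmon del: One_nat_def)
qed

lemma msubst_perturb:
  assumes f: "f \<in> Pser s" "f \<in> ordge k"
  shows "msubst s (\<lambda>i. mvar i + d i) f - f \<in> ordge (k + e)"
proof (rule ordge_by_monomials[where f = f and s = s])
  fix \<alpha> assume \<alpha>: "\<alpha> \<in> evecs s"
  have g1: "mvar i + d i \<in> ordge 1" if "i < s" for i
    using d[OF that] by (intro ordge_add) (auto elim: ordge_antimono)
  show "msubst s (\<lambda>i. mvar i + d i) (mpmon \<alpha> (mps_nth f \<alpha>)) - mpmon \<alpha> (mps_nth f \<alpha>) \<in> ordge (k + e)"
  proof (cases "mdeg \<alpha> < k")
    \<comment> \<open>Degrees below k occur with coefficient 0; for this reason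
      \<open>ordge_by_monomials\<close> asks only about monomials with the actual coefficients of
      f.\<close>
    case True
    then have "mps_nth f \<alpha> = 0" using f ordgeD by blast
    then show ?thesis using msubst_diff[of s "\<lambda>i. mvar i + d i" 0 0] by simp
  next
    case False
    have "msubst s (\<lambda>i. mvar i + d i) (mpmon \<alpha> (mps_nth f \<alpha>)) = mconst (mps_nth f \<alpha>) * mons s (\<lambda>i. mvar i + d i) \<alpha>"
      by (rule msubst_mpmon[OF g1 \<alpha>])
    then have "msubst s (\<lambda>i. mvar i + d i) (mpmon \<alpha> (mps_nth f \<alpha>)) - mpmon \<alpha> (mps_nth f \<alpha>)
      = mconst (mps_nth f \<alpha>) * (mons s (\<lambda>i. mvar i + d i) \<alpha> - mpmon \<alpha> 1)"
      by (simp add: right_diff_distrib mpmon_mult)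
    also have "\<dots> \<in> ordge (k + e)"
      using mons_expansion[OF \<alpha>] False by (intro ordge_mult_left) (auto elim: ordge_antimono)
    finally show ?thesis .
  qed
next
  fix h :: "'a mps" assume "h \<in> ordge (Suc (k + e))"
  then show "msubst s (\<lambda>i. mvar i + d i) h - h \<in> ordge (k + e)"
    by (intro ordge_diff msubst_ordge) (auto elim: ordge_antimono)
qed (use f in \<open>auto simp: msubst_add\<close>)

text \<open>The derivatives stand at x and not at x + d. The price is an error involving both d and
  d', covered by e + m; terms quadratic in d' are covered as well because e \<le> m.\<close>

lemma msubst_expansion:
  assumes f: "f \<in> Pser s"
  shows "msubst s (\<lambda>i. mvar i + d i + d' i) f - msubst s (\<lambda>i. mvar i + d i) f - (\<Sum>\<nu><s. d' \<nu> * mderiv \<nu> f)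
    \<in> ordge (e + m)"
proof (rule ordge_by_monomials[where f = f and s = s])
  let ?g = "\<lambda>i. mvar i + d i" and ?g' = "\<lambda>i. mvar i + d i + d' i"
  fix \<alpha> assume \<alpha>: "\<alpha> \<in> evecs s"
  have g: "?g i \<in> ordge 1" if "i < s" for i
    using d[OF that] by (intro ordge_add) (auto elim: ordge_antimono)
  have g': "?g' i \<in> ordge 1" if "i < s" for i
    using d[OF that] d'[OF that] by (intro ordge_add) (auto elim: ordge_antimono)
  let ?c = "mconst (mps_nth f \<alpha>)"
  have "mderiv \<nu> (?c * mpmon \<alpha> 1) = ?c * mderiv \<nu> (mpmon \<alpha> 1)" for \<nu>
    by (simp only: mderiv_mult mderiv_const) simp
  then have c: "mderiv \<nu> (mpmon \<alpha> (mps_nth f \<alpha>)) = ?c * mderiv \<nu> (mpmon \<alpha> 1)" for \<nu>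
    by (simp add: mpmon_mult)
  have g1: "msubst s ?g (mpmon \<alpha> (mps_nth f \<alpha>)) = ?c * mons s ?g \<alpha>"
    by (rule msubst_mpmon[OF g \<alpha>])
  have g1': "msubst s ?g' (mpmon \<alpha> (mps_nth f \<alpha>)) = ?c * mons s ?g' \<alpha>"
    by (rule msubst_mpmon[OF g' \<alpha>])
  have "msubst s ?g' (mpmon \<alpha> (mps_nth f \<alpha>)) - msubst s ?g (mpmon \<alpha> (mps_nth f \<alpha>))
      - (\<Sum>\<nu><s. d' \<nu> * mderiv \<nu> (mpmon \<alpha> (mps_nth f \<alpha>)))
    = ?c * (mons s ?g' \<alpha> - mons s ?g \<alpha> - (\<Sum>\<nu><s. d' \<nu> * mderiv \<nu> (mpmon \<alpha> 1)))"
    unfolding g1 g1' c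
    by (simp add: right_diff_distrib sum_distrib_left mult_ac)
  also have "\<dots> \<in> ordge (e + m)"
    using mons_expansion[OF \<alpha>] by (intro ordge_mult_left) (auto elim: ordge_antimono)
  finally show "msubst s ?g' (mpmon \<alpha> (mps_nth f \<alpha>)) - msubst s ?g (mpmon \<alpha> (mps_nth f \<alpha>))
      - (\<Sum>\<nu><s. d' \<nu> * mderiv \<nu> (mpmon \<alpha> (mps_nth f \<alpha>))) \<in> ordge (e + m)" .
next
  fix h :: "'a mps" assume "h \<in> ordge (Suc (e + m))"
  then show "msubst s (\<lambda>i. mvar i + d i + d' i) h - msubst s (\<lambda>i. mvar i + d i) h - (\<Sum>\<nu><s. d' \<nu> * mderiv \<nu> h)
    \<in> ordge (e + m)"
    by (intro ordge_diff msubst_ordge ordge_sum ordge_mult_left mderiv_ordge) (auto elim: ordge_antimono)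
qed (use f in \<open>auto simp: msubst_add distrib_left sum.distrib\<close>)

end

text \<open>Increments in m^2 make \<phi> f - f of higher order than f. So a difference killed by
  \<phi> has arbitrarily high order, and \<phi> f = h is a fixed point equation for a
  contraction.\<close>

lemma msubst_bij:
  fixes d :: "nat \<Rightarrow> 'a::comm_ring_1 mps"
  assumes "\<And>i. i < s \<Longrightarrow> d i \<in> ordge 2" "\<And>i. i < s \<Longrightarrow> d i \<in> Pser s"
  shows "bij_betw (msubst s (\<lambda>i. mvar i + d i)) (Pser s) (Pser s)"
proof -
  let ?\<phi> = "msubst s (\<lambda>i. mvar i + d i)"
  have P: "?\<phi> f \<in> Pser s" for f using assms(2) by simp
  have up: "?\<phi> f - f \<in> ordge (Suc k)" if "f \<in> Pser s" "f \<in> ordge k" for f k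
    using msubst_perturb[of s d 1 "\<lambda>_. 0" 1, OF _ _ _ that] assms(1) by (simp add: numeral_2_eq_2)
  have "f = h" if "f \<in> Pser s" "h \<in> Pser s" "?\<phi> f = ?\<phi> h" for f h
  proof -
    have "f - h \<in> ordge n" for n
    proof (induction n)
      case (Suc n)
      have "?\<phi> (f - h) - (f - h) \<in> ordge (Suc n)" using Suc that by (intro up) auto
      then show ?case using that(3) ordge_uminus by (fastforce simp: msubst_diff)
    qed simp
    then show ?thesis using mps_eq_0I by fastforce
  qed
  moreover have "\<exists>f\<in>Pser s. ?\<phi> f = h" if hP: "h \<in> Pser s" for h
  proof -
    obtain f where f: "f \<in> Pser s" "h - (?\<phi> f - f) = f"
    proof (rule contraction_fixpoint[of s "\<lambda>f. h - (?\<phi> f - f)"])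
      fix n and f f' :: "'a mps" assume *: "f \<in> Pser s" "f' \<in> Pser s" "f - f' \<in> ordge n"
      have "- (?\<phi> (f - f') - (f - f')) \<in> ordge (Suc n)" using * by (intro ordge_uminus up) auto
      then show "h - (?\<phi> f - f) - (h - (?\<phi> f' - f')) \<in> ordge (Suc n)"
        by (simp add: msubst_diff algebra_simps)
    qed (use hP P in auto)
    then have "?\<phi> f = h" by (simp add: algebra_simps)
    then show ?thesis using f by blast
  qed
  ultimately show ?thesis using P unfolding bij_betw_def inj_on_def by blast
qed

section \<open>Two by two matrices\<close>

text \<open>Unlike index functions with zeros outside the range, this type is an instance of
  \<open>ring_1\<close>, so matrix identities can be rearranged by ring simplification.\<close>

datatype 'r m2 = M2 (e00: 'r) (e01: 'r) (e10: 'r) (e11: 'r)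

instantiation m2 :: (comm_ring_1) ring_1
begin

definition "0 = M2 0 0 0 0"
definition "1 = M2 1 0 0 1"
definition "A + B = M2 (e00 A + e00 B) (e01 A + e01 B) (e10 A + e10 B) (e11 A + e11 B)"
definition "A - B = M2 (e00 A - e00 B) (e01 A - e01 B) (e10 A - e10 B) (e11 A - e11 B)"
definition "- A = M2 (- e00 A) (- e01 A) (- e10 A) (- e11 A)"
definition "A * B = M2 (e00 A * e00 B + e01 A * e10 B) (e00 A * e01 B + e01 A * e11 B)
  (e10 A * e00 B + e11 A * e10 B) (e10 A * e01 B + e11 A * e11 B)"

instance
  by standard (auto simp: zero_m2_def one_m2_def plus_m2_def minus_m2_def uminus_m2_def times_m2_def algebra_simps)

end

lemma m2_sel_simps [simp]:
  "e00 0 = 0" "e01 0 = 0" "e10 0 = 0" "e11 0 = 0"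
  "e00 1 = 1" "e01 1 = 0" "e10 1 = 0" "e11 1 = 1"
  "e00 (A + B) = e00 A + e00 B" "e01 (A + B) = e01 A + e01 B"
  "e10 (A + B) = e10 A + e10 B" "e11 (A + B) = e11 A + e11 B"
  "e00 (A - B) = e00 A - e00 B" "e01 (A - B) = e01 A - e01 B"
  "e10 (A - B) = e10 A - e10 B" "e11 (A - B) = e11 A - e11 B"
  "e00 (- A) = - e00 A" "e01 (- A) = - e01 A" "e10 (- A) = - e10 A" "e11 (- A) = - e11 A"
  "e00 (A * B) = e00 A * e00 B + e01 A * e10 B" "e01 (A * B) = e00 A * e01 B + e01 A * e11 B"
  "e10 (A * B) = e10 A * e00 B + e11 A * e10 B" "e11 (A * B) = e10 A * e01 B + e11 A * e11 B"
  by (simp_all add: zero_m2_def one_m2_def plus_m2_def minus_m2_def uminus_m2_def times_m2_def)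

lemma m2_sum_sel [simp]:
  "e00 (\<Sum>i\<in>I. f i) = (\<Sum>i\<in>I. e00 (f i))" "e01 (\<Sum>i\<in>I. f i) = (\<Sum>i\<in>I. e01 (f i))"
  "e10 (\<Sum>i\<in>I. f i) = (\<Sum>i\<in>I. e10 (f i))" "e11 (\<Sum>i\<in>I. f i) = (\<Sum>i\<in>I. e11 (f i))"
  by (induction I rule: infinite_finite_induct) auto

lemma m2_eq_iff: "A = B \<longleftrightarrow> e00 A = e00 B \<and> e01 A = e01 B \<and> e10 A = e10 B \<and> e11 A = e11 B"
  by (cases A; cases B) simp

lemma m2_map_sel [simp]:
  "e00 (map_m2 f A) = f (e00 A)" "e01 (map_m2 f A) = f (e01 A)"
  "e10 (map_m2 f A) = f (e10 A)" "e11 (map_m2 f A) = f (e11 A)"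
  by (cases A; simp)+

definition smul :: "'r::comm_ring_1 \<Rightarrow> 'r m2 \<Rightarrow> 'r m2" where
  "smul r A = M2 (r * e00 A) (r * e01 A) (r * e10 A) (r * e11 A)"

lemma smul_sel [simp]:
  "e00 (smul r A) = r * e00 A" "e01 (smul r A) = r * e01 A"
  "e10 (smul r A) = r * e10 A" "e11 (smul r A) = r * e11 A"
  by (simp_all add: smul_def)

lemma smul_add: "smul r (A + B) = smul r A + smul r B"
  by (simp add: m2_eq_iff algebra_simps)

lemma smul_add_left: "smul (r + t) A = smul r A + smul t A"
  by (simp add: m2_eq_iff algebra_simps)

lemma smul_smul [simp]: "smul r (smul t A) = smul (r * t) A"
  by (simp add: m2_eq_iff mult.assoc)

lemma smul_one [simp]: "smul 1 A = A"
  by (simp add: m2_eq_iff)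

lemma smul_zero [simp]: "smul 0 A = 0" "smul r 0 = 0"
  by (simp_all add: m2_eq_iff)

lemma smul_mult_left [simp]: "smul r A * B = smul r (A * B)"
  by (simp add: m2_eq_iff algebra_simps)

lemma smul_mult_right [simp]: "A * smul r B = smul r (A * B)"
  by (simp add: m2_eq_iff algebra_simps)

lemma smul_minus_one: "smul (- 1) A = - A"
  by (simp add: m2_eq_iff)

lemma smul_sum: "smul r (\<Sum>i\<in>I. f i) = (\<Sum>i\<in>I. smul r (f i))"
  by (induction I rule: infinite_finite_induct) (auto simp: smul_add)

lemma smul_sum_left: "smul (\<Sum>i\<in>I. f i) A = (\<Sum>i\<in>I. smul (f i) A)"
  by (induction I rule: infinite_finite_induct) (auto simp: smul_add_left)

definition mdet :: "'r::comm_ring_1 m2 \<Rightarrow> 'r" where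
  "mdet A = e00 A * e11 A - e01 A * e10 A"

definition madj :: "'r::comm_ring_1 m2 \<Rightarrow> 'r m2" where
  "madj A = M2 (e11 A) (- e01 A) (- e10 A) (e00 A)"

lemma madj_mult: "A * madj A = smul (mdet A) 1" "madj A * A = smul (mdet A) 1"
  by (simp_all add: m2_eq_iff madj_def mdet_def algebra_simps)

definition mats :: "'r set \<Rightarrow> 'r m2 set" where
  "mats S = {A. e00 A \<in> S \<and> e01 A \<in> S \<and> e10 A \<in> S \<and> e11 A \<in> S}"

lemma mats_Pser_closed [simp]:
  "0 \<in> mats (Pser s)" "1 \<in> mats (Pser s)"
  "A \<in> mats (Pser s) \<Longrightarrow> B \<in> mats (Pser s) \<Longrightarrow> A + B \<in> mats (Pser s)"
  "A \<in> mats (Pser s) \<Longrightarrow> B \<in> mats (Pser s) \<Longrightarrow> A - B \<in> mats (Pser s)"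
  "A \<in> mats (Pser s) \<Longrightarrow> - A \<in> mats (Pser s)"
  "A \<in> mats (Pser s) \<Longrightarrow> B \<in> mats (Pser s) \<Longrightarrow> A * B \<in> mats (Pser s)"
  "r \<in> Pser s \<Longrightarrow> A \<in> mats (Pser s) \<Longrightarrow> smul r A \<in> mats (Pser s)"
  "A \<in> mats (Pser s) \<Longrightarrow> map_m2 (mderiv \<nu>) A \<in> mats (Pser s)"
  by (simp_all add: mats_def)

lemma mats_Pser_sum [simp]: "(\<And>i. i \<in> I \<Longrightarrow> f i \<in> mats (Pser s)) \<Longrightarrow> (\<Sum>i\<in>I. f i) \<in> mats (Pser s)"
  by (induction I rule: infinite_finite_induct) auto

lemma mats_ordge_closed [simp]:
  "0 \<in> mats (ordge n)"
  "A \<in> mats (ordge n) \<Longrightarrow> B \<in> mats (ordge n) \<Longrightarrow> A + B \<in> mats (ordge n)"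
  "A \<in> mats (ordge n) \<Longrightarrow> B \<in> mats (ordge n) \<Longrightarrow> A - B \<in> mats (ordge n)"
  "A \<in> mats (ordge n) \<Longrightarrow> - A \<in> mats (ordge n)"
  "A \<in> mats (ordge n) \<Longrightarrow> A * B \<in> mats (ordge n)"
  "B \<in> mats (ordge n) \<Longrightarrow> A * B \<in> mats (ordge n)"
  "r \<in> ordge n \<Longrightarrow> smul r A \<in> mats (ordge n)"
  "A \<in> mats (ordge n) \<Longrightarrow> smul r A \<in> mats (ordge n)"
  "A \<in> mats (ordge 0)"
  by (simp_all add: mats_def)

lemma mats_ordge_sum [simp]: "(\<And>i. i \<in> I \<Longrightarrow> f i \<in> mats (ordge n)) \<Longrightarrow> (\<Sum>i\<in>I. f i) \<in> mats (ordge n)"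
  by (induction I rule: infinite_finite_induct) auto

lemma mats_ordge_mult: "A \<in> mats (ordge n) \<Longrightarrow> B \<in> mats (ordge m) \<Longrightarrow> k \<le> n + m \<Longrightarrow> A * B \<in> mats (ordge k)"
  by (auto simp: mats_def intro!: ordge_add elim: ordge_mult_ge)

lemma mats_ordge_smul: "r \<in> ordge n \<Longrightarrow> B \<in> mats (ordge m) \<Longrightarrow> k \<le> n + m \<Longrightarrow> smul r B \<in> mats (ordge k)"
  by (auto simp: mats_def elim: ordge_mult_ge)

lemma mats_ordge_antimono: "A \<in> mats (ordge n) \<Longrightarrow> m \<le> n \<Longrightarrow> A \<in> mats (ordge m)"
  by (auto simp: mats_def elim: ordge_antimono)

lemma mats_eq_0I: "(\<And>n. A \<in> mats (ordge n)) \<Longrightarrow> A = 0"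
  by (simp add: mats_def m2_eq_iff mps_eq_0I)

lemma mats_limit:
  assumes "\<And>n. f (Suc n) - f n \<in> mats (ordge n)" "\<And>n. f n \<in> mats (Pser s)"
  obtains A where "A \<in> mats (Pser s)" "\<And>n. A - f n \<in> mats (ordge n)"
proof -
  have "\<And>n. e00 (f (Suc n)) - e00 (f n) \<in> ordge n" "\<And>n. e00 (f n) \<in> Pser s"
    "\<And>n. e01 (f (Suc n)) - e01 (f n) \<in> ordge n" "\<And>n. e01 (f n) \<in> Pser s"
    "\<And>n. e10 (f (Suc n)) - e10 (f n) \<in> ordge n" "\<And>n. e10 (f n) \<in> Pser s"
    "\<And>n. e11 (f (Suc n)) - e11 (f n) \<in> ordge n" "\<And>n. e11 (f n) \<in> Pser s"
    using assms by (auto simp: mats_def)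
  then obtain a b c d where "a \<in> Pser s" "\<And>n. a - e00 (f n) \<in> ordge n" "b \<in> Pser s" "\<And>n. b - e01 (f n) \<in> ordge n"
    "c \<in> Pser s" "\<And>n. c - e10 (f n) \<in> ordge n" "d \<in> Pser s" "\<And>n. d - e11 (f n) \<in> ordge n"
    using mps_limit[of "\<lambda>n. e00 (f n)" s] mps_limit[of "\<lambda>n. e01 (f n)" s]
      mps_limit[of "\<lambda>n. e10 (f n)" s] mps_limit[of "\<lambda>n. e11 (f n)" s] by metis
  then show ?thesis using that[of "M2 a b c d"] by (simp add: mats_def)
qed

lemma mats_ordge_Suc_decompose:
  assumes "A \<in> mats (Pser s)" "A \<in> mats (ordge (Suc n))"
  obtains B where "\<And>i. B i \<in> mats (Pser s)" "\<And>i. B i \<in> mats (ordge n)" "A = (\<Sum>i<s. smul (mvar i) (B i))"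
proof -
  have 1: "\<exists>g. (\<forall>i. g i \<in> Pser s) \<and> (\<forall>i. g i \<in> ordge n) \<and> f = (\<Sum>i<s. mvar i * g i)"
    if "f \<in> Pser s" "f \<in> ordge (Suc n)" for f :: "'a mps"
    using ordge_Suc_decompose[OF that] by metis
  obtain a where "\<forall>i. a i \<in> Pser s" "\<forall>i. a i \<in> ordge n" "e00 A = (\<Sum>i<s. mvar i * a i)"
    using 1[of "e00 A"] assms by (auto simp: mats_def)
  moreover obtain b where "\<forall>i. b i \<in> Pser s" "\<forall>i. b i \<in> ordge n" "e01 A = (\<Sum>i<s. mvar i * b i)"
    using 1[of "e01 A"] assms by (auto simp: mats_def)
  moreover obtain c where "\<forall>i. c i \<in> Pser s" "\<forall>i. c i \<in> ordge n" "e10 A = (\<Sum>i<s. mvar i * c i)"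
    using 1[of "e10 A"] assms by (auto simp: mats_def)
  moreover obtain d where "\<forall>i. d i \<in> Pser s" "\<forall>i. d i \<in> ordge n" "e11 A = (\<Sum>i<s. mvar i * d i)"
    using 1[of "e11 A"] assms by (auto simp: mats_def)
  ultimately show ?thesis
    using that[of "\<lambda>i. M2 (a i) (b i) (c i) (d i)"] by (simp add: mats_def m2_eq_iff)
qed

definition m2_units :: "'r::comm_ring_1 m2 set" where
  "m2_units = {M2 1 0 0 0, M2 0 1 0 0, M2 0 0 1 0, M2 0 0 0 1}"

lemma m2_units_expand:
  "A = smul (e00 A) (M2 1 0 0 0) + smul (e01 A) (M2 0 1 0 0) + smul (e10 A) (M2 0 0 1 0) + smul (e11 A) (M2 0 0 0 1)"
  by (simp add: m2_eq_iff)

lemma mats_invertible: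
  fixes A :: "'a::field mps m2"
  assumes "A \<in> mats (Pser s)" "mps_nth (mdet A) 0 \<noteq> 0"
  obtains B where "B \<in> mats (Pser s)" "A * B = 1" "B * A = 1"
proof -
  have "mdet A \<in> Pser s" using assms(1) by (simp add: mdet_def mats_def)
  then obtain g where g: "g \<in> Pser s" "mdet A * g = 1" using mps_unit assms(2) by blast
  have "smul g (madj A) \<in> mats (Pser s)" using g assms by (simp add: mats_def madj_def)
  moreover have "A * smul g (madj A) = 1" "smul g (madj A) * A = 1"
    using g(2) by (simp_all add: madj_mult mult.commute)
  ultimately show ?thesis using that by blast
qed

section \<open>Submodules of finite codimension\<close>

definition submod :: "nat \<Rightarrow> 'a::comm_ring_1 mps m2 set \<Rightarrow> bool" where
  "submod s N \<longleftrightarrow> 0 \<in> N \<and> (\<forall>A\<in>N. \<forall>B\<in>N. A + B \<in> N) \<and> (\<forall>r\<in>Pser s. \<forall>A\<in>N. smul r A \<in> N)"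

lemma submod_zero: "submod s N \<Longrightarrow> 0 \<in> N"
  by (simp add: submod_def)

lemma submod_add: "submod s N \<Longrightarrow> A \<in> N \<Longrightarrow> B \<in> N \<Longrightarrow> A + B \<in> N"
  by (simp add: submod_def)

lemma submod_smul: "submod s N \<Longrightarrow> r \<in> Pser s \<Longrightarrow> A \<in> N \<Longrightarrow> smul r A \<in> N"
  by (simp add: submod_def)

lemma submod_diff: "submod s N \<Longrightarrow> A \<in> N \<Longrightarrow> B \<in> N \<Longrightarrow> A - B \<in> N"
  using submod_add[of s N A "smul (- 1) B"] submod_smul[of s N "- 1" B] by (simp add: smul_minus_one)

lemma submod_sum: "submod s N \<Longrightarrow> (\<And>i. i \<in> I \<Longrightarrow> f i \<in> N) \<Longrightarrow> (\<Sum>i\<in>I. f i) \<in> N"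
  by (induction I rule: infinite_finite_induct) (auto simp: submod_zero submod_add)

lemma submod_cancel_const:
  fixes c :: "'a::field"
  assumes "submod s N" "c \<noteq> 0" "smul (mconst c) A \<in> N"
  shows "A \<in> N"
proof -
  have "smul (mconst (1 / c)) (smul (mconst c) A) \<in> N"
    by (rule submod_smul[OF assms(1) _ assms(3)]) simp
  moreover have "mconst (1 / c) * mconst c = 1"
    using assms(2) by (simp add: mpmon_mult mpmon_0_1)
  ultimately show ?thesis by simp
qed

lemma submod_units:
  assumes N: "submod s N" and r: "r \<in> Pser s" "\<And>E. E \<in> m2_units \<Longrightarrow> smul r E \<in> N" and A: "A \<in> mats (Pser s)"
  shows "smul r A \<in> N"
proof -
  have "smul a (smul r E) \<in> N" if "a \<in> Pser s" "E \<in> m2_units" for a E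
    using that r N submod_smul by blast
  then have *: "smul (a * r) E \<in> N" if "a \<in> Pser s" "E \<in> m2_units" for a E
    using that by simp
  have "smul r A = smul (e00 A * r) (M2 1 0 0 0) + smul (e01 A * r) (M2 0 1 0 0)
      + smul (e10 A * r) (M2 0 0 1 0) + smul (e11 A * r) (M2 0 0 0 1)"
    by (simp add: m2_eq_iff mult.commute)
  also have "\<dots> \<in> N" using A by (intro submod_add[OF N] *) (auto simp: mats_def m2_units_def)
  finally show ?thesis .
qed

section \<open>Linear dependency and pigeonhole: from finite dimension to a power of m\<close>

lemma homogeneous_solution:
  fixes a :: "'j \<Rightarrow> 'g \<Rightarrow> 'a::field"
  assumes "finite G" "finite J" "card G < card J"
  shows "\<exists>c. (\<exists>j\<in>J. c j \<noteq> 0) \<and> (\<forall>g\<in>G. (\<Sum>j\<in>J. c j * a j g) = 0)"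
  using assms
proof (induction G arbitrary: J a rule: finite_induct)
  case empty
  then have "J \<noteq> {}" by auto
  then show ?case by (intro exI[of _ "\<lambda>_. 1"]) auto
next
  case (insert g G)
  show ?case
  proof (cases "\<forall>j\<in>J. a j g = 0")
    case True
    obtain c where "\<exists>j\<in>J. c j \<noteq> 0" "\<forall>h\<in>G. (\<Sum>j\<in>J. c j * a j h) = 0"
      using insert.IH[of J a] insert.prems insert.hyps by auto
    then show ?thesis using True by (intro exI[of _ c]) auto
  next
    case False
    then obtain i where i: "i \<in> J" "a i g \<noteq> 0" by auto
    let ?J = "J - {i}"
    obtain c where c: "\<exists>j\<in>?J. c j \<noteq> 0" "\<forall>h\<in>G. (\<Sum>j\<in>?J. c j * (a j h - a j g / a i g * a i h)) = 0"
      using insert.IH[of ?J "\<lambda>j h. a j h - a j g / a i g * a i h"] insert.prems insert.hyps i by fastforce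
    \<comment> \<open>Equation g determines the unknown i as -t; the induction hypothesis was
      applied to the other equations after this elimination.\<close>
    define t where "t = (\<Sum>j\<in>?J. c j * a j g) / a i g"
    have split: "(\<Sum>j\<in>J. (c(i := - t)) j * a j h) = (\<Sum>j\<in>?J. c j * a j h) - t * a i h" for h
      by (subst sum.remove[OF insert.prems(1) i(1)]) (auto intro!: sum.cong)
    have "(\<Sum>j\<in>J. (c(i := - t)) j * a j h) = 0" if "h \<in> insert g G" for h
    proof (cases "h = g")
      case True
      then show ?thesis unfolding split using i by (simp add: t_def)
    next
      case False
      then have "(\<Sum>j\<in>?J. c j * (a j h - a j g / a i g * a i h)) = 0" using c that by auto
      then have "(\<Sum>j\<in>?J. c j * a j h) - (\<Sum>j\<in>?J. c j * (a j g / a i g * a i h)) = 0"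
        by (simp only: right_diff_distrib sum_subtractf)
      moreover have "(\<Sum>j\<in>?J. c j * (a j g / a i g * a i h)) = t * a i h"
        unfolding t_def sum_divide_distrib sum_distrib_right by (intro sum.cong) auto
      ultimately show ?thesis unfolding split by simp
    qed
    moreover have "\<exists>j\<in>J. (c(i := - t)) j \<noteq> 0" using c(1) by auto
    ultimately show ?thesis by blast
  qed
qed

text \<open>Finitely many of the x_i^j E are linearly dependent modulo N; the dependency is
  a power of x_i times a unit of the power series ring.\<close>

lemma variable_power_in_submod:
  fixes N :: "'a::field mps m2 set"
  assumes N: "submod s N" and "i < s" and G: "finite G"
    and rep: "\<And>j. \<exists>c. smul (mvar i ^ j) E - (\<Sum>g\<in>G. smul (mconst (c g)) g) \<in> N"
  shows "\<exists>a. smul (mvar i ^ a) E \<in> N"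
proof -
  obtain c where c: "\<And>j. smul (mvar i ^ j) E - (\<Sum>g\<in>G. smul (mconst (c j g)) g) \<in> N"
    using rep by metis
  \<comment> \<open>One exponent more than there are spanning elements, so a nontrivial dependency
    exists.\<close>
  let ?J = "{..card G}"
  obtain b where b: "\<exists>j\<in>?J. b j \<noteq> 0" "\<forall>g\<in>G. (\<Sum>j\<in>?J. b j * c j g) = 0"
    using homogeneous_solution[OF G, of ?J c] by auto
  \<comment> \<open>The lowest exponent that occurs: after its power is factored out, the constant
    term b a remains.\<close>
  define a where "a = (LEAST j. j \<in> ?J \<and> b j \<noteq> 0)"
  have "a \<in> ?J \<and> b a \<noteq> 0" using b(1) LeastI_ex[of "\<lambda>j. j \<in> ?J \<and> b j \<noteq> 0"] unfolding a_def by blast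
  then have a: "a \<in> ?J" "b a \<noteq> 0" by auto
  have least: "b j = 0" if "j < a" for j
    using not_less_Least[of j "\<lambda>j. j \<in> ?J \<and> b j \<noteq> 0"] that a(1) unfolding a_def[symmetric] by auto
  define u where "u = (\<Sum>j\<in>{a..card G}. mconst (b j) * mvar i ^ (j - a))"
  have "mps_nth u 0 = (\<Sum>j\<in>{a..card G}. if j = a then b j else 0)"
    unfolding u_def mps_nth_sum
  proof (intro sum.cong refl)
    fix j
    assume "j \<in> {a..card G}"
    then show "mps_nth (mconst (b j) * mvar i ^ (j - a)) 0 = (if j = a then b j else 0)"
      by (auto simp: mvar_power mps_nth_mpmon mps_nth_one mpmon_0_1 dest: arg_cong[of _ _ mdeg])
  qed
  then have "mps_nth u 0 \<noteq> 0" using a by simp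
  moreover have "u \<in> Pser s" using \<open>i < s\<close> by (auto simp: u_def)
  ultimately obtain v where v: "v \<in> Pser s" "u * v = 1" using mps_unit by blast
  have "(\<Sum>j\<in>?J. mconst (b j) * mvar i ^ j) = (\<Sum>j\<in>{a..card G}. mconst (b j) * mvar i ^ j)"
    using least by (intro sum.mono_neutral_right) (auto simp: not_le)
  also have "\<dots> = (\<Sum>j\<in>{a..card G}. mvar i ^ a * (mconst (b j) * mvar i ^ (j - a)))"
  proof (intro sum.cong refl)
    fix j assume "j \<in> {a..card G}"
    then have "mvar i ^ j = (mvar i ^ a * mvar i ^ (j - a) :: 'a mps)" by (simp flip: power_add)
    then show "mconst (b j) * mvar i ^ j = mvar i ^ a * (mconst (b j) * mvar i ^ (j - a))"
      by (simp only: mult.left_commute)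
  qed
  finally have eq: "(\<Sum>j\<in>?J. mconst (b j) * mvar i ^ j) = mvar i ^ a * u"
    by (simp add: u_def sum_distrib_left)
  have "(\<Sum>j\<in>?J. smul (mconst (b j)) (smul (mvar i ^ j) E - (\<Sum>g\<in>G. smul (mconst (c j g)) g))) \<in> N"
    by (intro submod_sum[OF N] submod_smul[OF N] c) simp
  also have "(\<Sum>j\<in>?J. smul (mconst (b j)) (smul (mvar i ^ j) E - (\<Sum>g\<in>G. smul (mconst (c j g)) g)))
    = (\<Sum>j\<in>?J. smul (mconst (b j) * mvar i ^ j) E) - (\<Sum>j\<in>?J. \<Sum>g\<in>G. smul (mconst (b j * c j g)) g)"
    unfolding sum_subtractf[symmetric]
    by (intro sum.cong refl) (simp add: m2_eq_iff right_diff_distrib sum_distrib_left mpmon_0_mult mult.assoc)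
  also have "(\<Sum>j\<in>?J. \<Sum>g\<in>G. smul (mconst (b j * c j g)) g) = (\<Sum>g\<in>G. smul (mconst (\<Sum>j\<in>?J. b j * c j g)) g)"
  proof -
    have "mconst (\<Sum>j\<in>J. f j) = (\<Sum>j\<in>J. mconst (f j))" for J :: "nat set" and f :: "nat \<Rightarrow> 'a"
      by (induction J rule: infinite_finite_induct) (auto simp: mpmon_add)
    then show ?thesis by (subst sum.swap) (simp add: smul_sum_left)
  qed
  also have "\<dots> = 0" using b(2) by simp
  finally have "smul (mvar i ^ a * u) E \<in> N" by (simp add: eq flip: smul_sum_left)
  then have "smul v (smul (mvar i ^ a * u) E) \<in> N" by (rule submod_smul[OF N v(1)])
  moreover have "v * (mvar i ^ a * u) = mvar i ^ a" using v(2) by (metis mult.commute mult.left_commute mult_1_right)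
  ultimately show ?thesis by auto
qed

text \<open>Pigeonhole: a monomial of degree greater than s b has some exponent at least b, so it is
  a multiple of some x_i^b.\<close>

lemma ordge_in_submod:
  assumes N: "submod s N" and pow: "\<And>i E. i < s \<Longrightarrow> E \<in> m2_units \<Longrightarrow> \<exists>a. smul (mvar i ^ a) E \<in> N"
  shows "\<exists>n. mats (Pser s) \<inter> mats (ordge n) \<subseteq> N"
proof -
  obtain a where a: "\<And>i E. i < s \<Longrightarrow> E \<in> m2_units \<Longrightarrow> smul (mvar i ^ a i E) E \<in> N"
    using pow by metis
  have fin: "finite ({..<s} \<times> (m2_units :: 'a mps m2 set))" by (simp add: m2_units_def)
  \<comment> \<open>A sum instead of a maximum bounds all exponents and makes sense also for s =
    0.\<close>
  define b where "b = (\<Sum>p\<in>{..<s} \<times> m2_units. a (fst p) (snd p))"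
  have ab: "a i E \<le> b" if "i < s" "E \<in> m2_units" for i E
    unfolding b_def using member_le_sum[OF _ _ fin, of "(i, E)" "\<lambda>p. a (fst p) (snd p)"] that by auto
  have b: "smul (mvar i ^ b) E \<in> N" if "i < s" "E \<in> m2_units" for i E
  proof -
    have "smul (mvar i ^ (b - a i E)) (smul (mvar i ^ a i E) E) \<in> N"
      using that by (intro submod_smul[OF N] a) auto
    then show ?thesis using ab[OF that] by (simp flip: power_add)
  qed
  have single: "smul f E \<in> N" if f: "f \<in> Pser s" "f \<in> ordge (Suc (s * b))" and E: "E \<in> m2_units" for f E
  proof -
    have *: "\<exists>i<s. b \<le> lookup \<alpha> i" if "\<alpha> \<in> evecs s" "mps_nth f \<alpha> \<noteq> 0" for \<alpha>
    proof (rule ccontr)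
      assume "\<not> (\<exists>i<s. b \<le> lookup \<alpha> i)"
      then have "(\<Sum>i<s. lookup \<alpha> i) \<le> (\<Sum>i<s. b)" by (intro sum_mono) (auto simp: not_le)
      then have "mdeg \<alpha> \<le> s * b" using mdeg_evecs[OF that(1)] by simp
      then show False using ordgeD[OF f(2), of \<alpha>] that(2) by simp
    qed
    show ?thesis
    proof (rule decompose_by_variables[OF f(1) *])
      fix g assume g: "\<And>i. g i \<in> Pser s" "f = (\<Sum>i<s. mvar i ^ b * g i)"
      have "(\<Sum>i<s. smul (g i) (smul (mvar i ^ b) E)) \<in> N"
        by (rule submod_sum[OF N]; rule submod_smul[OF N g(1)]; rule b; simp add: E)
      then show "smul f E \<in> N" by (simp add: g(2) smul_sum_left mult.commute)
    qed
  qed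
  have "A \<in> N" if "A \<in> mats (Pser s)" "A \<in> mats (ordge (Suc (s * b)))" for A
    using that
    by (subst m2_units_expand) (intro submod_add[OF N] single; simp add: mats_def m2_units_def)
  then show ?thesis by blast
qed

section \<open>The tangent module\<close>

text \<open>The differential of (U, V, \<phi>) to U \<phi>(A) V at the identity, in the direction of
  the matrices u, v and the vector field with components d.\<close>

definition tmap :: "nat \<Rightarrow> 'a::comm_ring_1 mps m2 \<Rightarrow> 'a mps m2 \<Rightarrow> 'a mps m2 \<Rightarrow> (nat \<Rightarrow> 'a mps) \<Rightarrow> 'a mps m2" where
  "tmap s A u v d = u * A + A * v + (\<Sum>\<nu><s. smul (d \<nu>) (map_m2 (mderiv \<nu>) A))"

text \<open>The vector fields vanish at the origin because automorphisms of R preserve m. The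
  connection with the tangent image is \<open>tangent_image_iff\<close>.\<close>

definition tmod :: "nat \<Rightarrow> 'a::comm_ring_1 mps m2 \<Rightarrow> 'a mps m2 set" where
  "tmod s A = {tmap s A u v d | u v d.
     u \<in> mats (Pser s) \<and> v \<in> mats (Pser s) \<and> (\<forall>\<nu>. d \<nu> \<in> Pser s \<and> d \<nu> \<in> ordge 1)}"

lemma tmodI:
  "u \<in> mats (Pser s) \<Longrightarrow> v \<in> mats (Pser s) \<Longrightarrow> (\<And>\<nu>. d \<nu> \<in> Pser s) \<Longrightarrow> (\<And>\<nu>. d \<nu> \<in> ordge 1) \<Longrightarrow> tmap s A u v d \<in> tmod s A"
  unfolding tmod_def by blast

lemma tmap_zero [simp]: "tmap s A 0 0 (\<lambda>_. 0) = 0"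
  by (simp add: tmap_def)

lemma tmap_add: "tmap s A (u + u') (v + v') (\<lambda>\<nu>. d \<nu> + d' \<nu>) = tmap s A u v d + tmap s A u' v' d'"
  by (simp add: tmap_def distrib_left distrib_right smul_add_left sum.distrib)

lemma tmap_smul: "tmap s A (smul r u) (smul r v) (\<lambda>\<nu>. r * d \<nu>) = smul r (tmap s A u v d)"
  by (simp add: tmap_def smul_add smul_sum)

lemma tmap_sum: "tmap s A (\<Sum>i\<in>I. u i) (\<Sum>i\<in>I. v i) (\<lambda>\<nu>. \<Sum>i\<in>I. d i \<nu>) = (\<Sum>i\<in>I. tmap s A (u i) (v i) (d i))"
  by (induction I rule: infinite_finite_induct) (auto simp: tmap_add)

lemma tmap_Pser: "A \<in> mats (Pser s) \<Longrightarrow> u \<in> mats (Pser s) \<Longrightarrow> v \<in> mats (Pser s) \<Longrightarrow> (\<And>\<nu>. \<nu> < s \<Longrightarrow> d \<nu> \<in> Pser s)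
    \<Longrightarrow> tmap s A u v d \<in> mats (Pser s)"
  unfolding tmap_def by (intro mats_Pser_closed mats_Pser_sum) auto

lemma submod_tmod: "submod s (tmod s A)"
  unfolding submod_def
proof (intro conjI ballI)
  show "0 \<in> tmod s A" using tmodI[of 0 s 0 "\<lambda>_. 0" A] by simp
next
  fix B C assume "B \<in> tmod s A" "C \<in> tmod s A"
  then obtain u v d u' v' d' where
    "B = tmap s A u v d" "u \<in> mats (Pser s)" "v \<in> mats (Pser s)" "\<forall>\<nu>. d \<nu> \<in> Pser s \<and> d \<nu> \<in> ordge 1"
    "C = tmap s A u' v' d'" "u' \<in> mats (Pser s)" "v' \<in> mats (Pser s)" "\<forall>\<nu>. d' \<nu> \<in> Pser s \<and> d' \<nu> \<in> ordge 1"
    unfolding tmod_def by blast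
  then show "B + C \<in> tmod s A" by (auto simp: tmap_add[symmetric] intro!: tmodI)
next
  fix r :: "'a mps" and B assume "r \<in> Pser s" "B \<in> tmod s A"
  moreover from this obtain u v d where
    "B = tmap s A u v d" "u \<in> mats (Pser s)" "v \<in> mats (Pser s)" "\<forall>\<nu>. d \<nu> \<in> Pser s \<and> d \<nu> \<in> ordge 1"
    unfolding tmod_def by blast
  ultimately show "smul r B \<in> tmod s A" by (auto simp: tmap_smul[symmetric] intro!: tmodI)
qed

lemma tmod_contains:
  assumes "X \<in> mats (Pser s)"
  shows "X * A \<in> tmod s A" "A * X \<in> tmod s A"
  using tmodI[of X s 0 "\<lambda>_. 0" A] tmodI[of 0 s X "\<lambda>_. 0" A] assms by (simp_all add: tmap_def)

lemma tmod_contains_deriv: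
  assumes "\<nu> < s" "f \<in> Pser s" "f \<in> ordge 1"
  shows "smul f (map_m2 (mderiv \<nu>) A) \<in> tmod s A"
proof -
  have "tmap s A 0 0 (\<lambda>\<mu>. if \<mu> = \<nu> then f else 0) = (\<Sum>\<mu><s. if \<mu> = \<nu> then smul f (map_m2 (mderiv \<nu>) A) else 0)"
    unfolding tmap_def by (simp add: if_distrib[of "\<lambda>r. smul r _"] cong: if_cong)
  also have "\<dots> = smul f (map_m2 (mderiv \<nu>) A)" using assms by simp
  finally show ?thesis using tmodI[of 0 s 0 "\<lambda>\<mu>. if \<mu> = \<nu> then f else 0" A] assms by simp
qed

lemma tmap_ordge:
  assumes "u \<in> mats (ordge n)" "v \<in> mats (ordge n)" "\<And>\<nu>. \<nu> < s \<Longrightarrow> d \<nu> \<in> ordge n"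
  shows "tmap s A u v d \<in> mats (ordge n)"
  unfolding tmap_def using assms
  by (intro mats_ordge_closed(2) mats_ordge_sum mats_ordge_closed(7)) auto

text \<open>The tangent map is R-linear, so peeling variables off C multiplies the preimages by
  them. Each factor raises the order of u, v and d by one, starting from the order 1 of d.\<close>

lemma tmap_lift:
  assumes c: "mats (Pser s) \<inter> mats (ordge c) \<subseteq> tmod s A"
    and C: "C \<in> mats (Pser s)" "C \<in> mats (ordge (c + n))"
  shows "\<exists>u v d. u \<in> mats (Pser s) \<and> u \<in> mats (ordge n) \<and> v \<in> mats (Pser s) \<and> v \<in> mats (ordge n)
    \<and> (\<forall>\<nu>. d \<nu> \<in> Pser s \<and> d \<nu> \<in> ordge (Suc n)) \<and> C = tmap s A u v d"
  using C
proof (induction n arbitrary: C)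
  case 0
  then have "C \<in> tmod s A" using c by auto
  then show ?case by (force simp: tmod_def)
next
  case (Suc n)
  obtain D where D: "\<And>i. D i \<in> mats (Pser s)" "\<And>i. D i \<in> mats (ordge (c + n))" "C = (\<Sum>i<s. smul (mvar i) (D i))"
    using mats_ordge_Suc_decompose[of C s "c + n"] Suc.prems by auto
  obtain u v d where uvd: "\<And>i. u i \<in> mats (Pser s)" "\<And>i. u i \<in> mats (ordge n)" "\<And>i. v i \<in> mats (Pser s)"
    "\<And>i. v i \<in> mats (ordge n)" "\<And>i \<nu>. d i \<nu> \<in> Pser s" "\<And>i \<nu>. d i \<nu> \<in> ordge (Suc n)"
    "\<And>i. D i = tmap s A (u i) (v i) (d i)"
    using Suc.IH[OF D(1,2)] by metis
  have "C = tmap s A (\<Sum>i<s. smul (mvar i) (u i)) (\<Sum>i<s. smul (mvar i) (v i)) (\<lambda>\<nu>. \<Sum>i<s. mvar i * d i \<nu>)"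
    unfolding tmap_sum D(3) by (simp add: tmap_smul uvd(7))
  moreover have "(\<Sum>i<s. smul (mvar i) (u i)) \<in> mats (Pser s)" "(\<Sum>i<s. smul (mvar i) (v i)) \<in> mats (Pser s)"
    "\<And>\<nu>. (\<Sum>i<s. mvar i * d i \<nu>) \<in> Pser s"
    by (intro mats_Pser_sum mats_Pser_closed Pser_sum Pser_mult uvd; simp)+
  moreover have "(\<Sum>i<s. smul (mvar i) (u i)) \<in> mats (ordge (Suc n))" "(\<Sum>i<s. smul (mvar i) (v i)) \<in> mats (ordge (Suc n))"
    by (intro mats_ordge_sum mats_ordge_smul[OF ordge_mvar uvd(2)] mats_ordge_smul[OF ordge_mvar uvd(4)]; simp)+
  moreover have "(\<Sum>i<s. mvar i * d i \<nu>) \<in> ordge (Suc (Suc n))" for \<nu>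
    by (intro ordge_sum ordge_mult_ge[OF ordge_mvar uvd(6)]) simp
  ultimately show ?case
    by (intro exI[of _ "\<Sum>i<s. smul (mvar i) (u i)"] exI[of _ "\<Sum>i<s. smul (mvar i) (v i)"]
        exI[of _ "\<lambda>\<nu>. \<Sum>i<s. mvar i * d i \<nu>"]) auto
qed

section \<open>Finite codimension implies finite determinacy\<close>

text \<open>Group elements near the identity get coordinates (u, v, d). Corrections are then added
  and limits taken coordinatewise, with no composition of substitutions.\<close>

definition gact :: "nat \<Rightarrow> 'a::comm_ring_1 mps m2 \<Rightarrow> 'a mps m2 \<Rightarrow> 'a mps m2 \<Rightarrow> (nat \<Rightarrow> 'a mps) \<Rightarrow> 'a mps m2" where
  "gact s A u v d = (1 + u) * map_m2 (msubst s (\<lambda>i. mvar i + d i)) A * (1 + v)"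

lemma msubst_id: "f \<in> Pser s \<Longrightarrow> msubst s (\<lambda>i. mvar i + 0) f = f"
proof -
  assume f: "f \<in> Pser s"
  have "msubst s (\<lambda>i. mvar i + 0) f - f \<in> ordge n" for n
    using msubst_perturb[of s "\<lambda>_. 0" n "\<lambda>_. 0" n f 0] f by simp
  then show ?thesis using mps_eq_0I by fastforce
qed

lemma gact_zero: "A \<in> mats (Pser s) \<Longrightarrow> gact s A 0 0 (\<lambda>_. 0) = A"
  using msubst_id[of "e00 A" s] msubst_id[of "e01 A" s] msubst_id[of "e10 A" s] msubst_id[of "e11 A" s]
  by (simp add: gact_def m2_eq_iff mats_def)

lemma gact_expand:
  assumes A: "A \<in> mats (Pser s)" and em: "e \<le> m"
    and uv: "u \<in> mats (ordge e)" "v \<in> mats (ordge e)" "u' \<in> mats (ordge m)" "v' \<in> mats (ordge m)"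
    and d: "\<And>i. d i \<in> ordge (Suc e)" "\<And>i. d' i \<in> ordge (Suc m)"
  shows "gact s A (u + u') (v + v') (\<lambda>i. d i + d' i) - gact s A u v d - tmap s A u' v' d' \<in> mats (ordge (e + m))"
proof -
  define P where "P = map_m2 (msubst s (\<lambda>i. mvar i + d i)) A"
  define Q where "Q = map_m2 (msubst s (\<lambda>i. mvar i + (d i + d' i))) A"
  define D where "D = (\<Sum>\<nu><s. smul (d' \<nu>) (map_m2 (mderiv \<nu>) A))"
  have "msubst s (\<lambda>i. mvar i + d i) f - f \<in> ordge e" if "f \<in> Pser s" for f
    using msubst_perturb[of s d e d' m f 0] d em that by simp
  then have PA: "P - A \<in> mats (ordge e)" using A by (simp add: P_def mats_def)
  have "msubst s (\<lambda>i. mvar i + (d i + d' i)) f - msubst s (\<lambda>i. mvar i + d i) f - (\<Sum>\<nu><s. d' \<nu> * mderiv \<nu> f)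
      \<in> ordge (e + m)" if "f \<in> Pser s" for f
    using msubst_expansion[of s d e d' m f] d em that by (simp add: add.assoc)
  then have QPD: "Q - P - D \<in> mats (ordge (e + m))" using A by (simp add: P_def Q_def D_def mats_def)
  have D: "D \<in> mats (ordge m)"
    unfolding D_def using ordge_antimono[OF d(2), of m] by simp
  have QP: "Q - P \<in> mats (ordge m)"
    using mats_ordge_closed(2)[OF mats_ordge_antimono[OF QPD, of m] D] by simp
  have QA: "Q - A \<in> mats (ordge e)"
    using mats_ordge_closed(2)[OF mats_ordge_antimono[OF QP em] PA] by simp
  have vv: "v + v' \<in> mats (ordge e)" using uv mats_ordge_antimono[OF uv(4) em] by simp
  have "gact s A (u + u') (v + v') (\<lambda>i. d i + d' i) - gact s A u v d - tmap s A u' v' d'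
    = (1 + (u + u')) * Q * (1 + (v + v')) - (1 + u) * P * (1 + v) - (u' * A + A * v' + D)"
    by (simp add: gact_def tmap_def P_def Q_def D_def)
  \<comment> \<open>Apart from the first summand, each term contains a factor of order e, coming
    from the old element, and one of order m, coming from the correction.\<close>
  also have "\<dots> = (Q - P - D) + u * ((Q - P) * (1 + v)) + (Q - P) * v + u' * (Q - A) + (u' * Q) * (v + v')
      + (Q - A) * v' + u * (Q * v')"
    by (simp add: algebra_simps)
  also have "\<dots> \<in> mats (ordge (e + m))"
  proof (intro mats_ordge_closed(2))
    show "u * ((Q - P) * (1 + v)) \<in> mats (ordge (e + m))"
      by (rule mats_ordge_mult[OF uv(1) mats_ordge_closed(5)[OF QP]]) simp
    show "(Q - P) * v \<in> mats (ordge (e + m))" by (rule mats_ordge_mult[OF QP uv(2)]) simp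
    show "u' * (Q - A) \<in> mats (ordge (e + m))" by (rule mats_ordge_mult[OF uv(3) QA]) simp
    show "(u' * Q) * (v + v') \<in> mats (ordge (e + m))"
      by (rule mats_ordge_mult[OF mats_ordge_closed(5)[OF uv(3)] vv]) simp
    show "(Q - A) * v' \<in> mats (ordge (e + m))" by (rule mats_ordge_mult[OF QA uv(4)]) simp
    show "u * (Q * v') \<in> mats (ordge (e + m))"
      by (rule mats_ordge_mult[OF uv(1) mats_ordge_closed(6)[OF uv(4)]]) simp
  qed (rule QPD)
  finally show ?thesis .
qed

lemma gact_Pser:
  assumes "A \<in> mats (Pser s)" "u \<in> mats (Pser s)" "v \<in> mats (Pser s)" "\<And>i. d i \<in> Pser s"
  shows "gact s A u v d \<in> mats (Pser s)"
proof -
  have "msubst s (\<lambda>i. mvar i + d i) f \<in> Pser s" for f using assms by simp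
  then have "map_m2 (msubst s (\<lambda>i. mvar i + d i)) A \<in> mats (Pser s)" by (simp add: mats_def)
  then show ?thesis unfolding gact_def using assms by simp
qed

text \<open>Successive approximation: the residual B - gact z gains one order when z is corrected by a
  preimage of the residual under the tangent map, because the error is quadratic in z and the correction.\<close>

lemma gact_transitive:
  assumes A: "A \<in> mats (Pser s)" and c: "mats (Pser s) \<inter> mats (ordge c) \<subseteq> tmod s A"
    and B: "B \<in> mats (Pser s)" "B - A \<in> mats (ordge (2 * c + 1))"
  shows "\<exists>u v d. u \<in> mats (Pser s) \<and> u \<in> mats (ordge 1) \<and> v \<in> mats (Pser s) \<and> v \<in> mats (ordge 1)
    \<and> (\<forall>i. d i \<in> Pser s \<and> d i \<in> ordge 2) \<and> gact s A u v d = B"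
proof -
  \<comment> \<open>The smallest e for which the new error order e + (e + n) reaches c + (e + (n +
    1)). The starting order c + e is then 2 c + 1.\<close>
  define e where "e = Suc c"
  define P where "P n z = (case z of (u, v, d) \<Rightarrow>
      u \<in> mats (Pser s) \<and> u \<in> mats (ordge e) \<and> v \<in> mats (Pser s) \<and> v \<in> mats (ordge e)
      \<and> (\<forall>i. d i \<in> Pser s \<and> d i \<in> ordge (Suc e)) \<and> B - gact s A u v d \<in> mats (ordge (c + (e + n))))"
    for n z
  define Q where "Q n z z' = (case (z, z') of ((u, v, d), (u', v', d')) \<Rightarrow>
      u' - u \<in> mats (ordge n) \<and> v' - v \<in> mats (ordge n) \<and> (\<forall>i. d' i - d i \<in> ordge n))"
    for n and z z' :: "'a mps m2 \<times> 'a mps m2 \<times> (nat \<Rightarrow> 'a mps)"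
  have "\<exists>z. \<forall>n. P n (z n) \<and> Q n (z n) (z (Suc n))"
  proof (rule dependent_nat_choice)
    have "P 0 (0, 0, \<lambda>_. 0)" using B by (simp add: P_def gact_zero[OF A] e_def mult_2)
    then show "\<exists>z. P 0 z" by blast
  next
    fix z n assume "P n z"
    moreover obtain u v d where z: "z = (u, v, d)" by (cases z)
    ultimately have uvd: "u \<in> mats (Pser s)" "u \<in> mats (ordge e)" "v \<in> mats (Pser s)" "v \<in> mats (ordge e)"
      "\<And>i. d i \<in> Pser s" "\<And>i. d i \<in> ordge (Suc e)" and r: "B - gact s A u v d \<in> mats (ordge (c + (e + n)))"
      by (auto simp: P_def)
    have "B - gact s A u v d \<in> mats (Pser s)" using B gact_Pser[OF A uvd(1,3,5)] by simp
    then obtain u' v' d' where uvd': "u' \<in> mats (Pser s)" "u' \<in> mats (ordge (e + n))" "v' \<in> mats (Pser s)"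
      "v' \<in> mats (ordge (e + n))" "\<And>i. d' i \<in> Pser s" "\<And>i. d' i \<in> ordge (Suc (e + n))"
      and w: "B - gact s A u v d = tmap s A u' v' d'"
      using tmap_lift[OF c _ r] by metis
    let ?z = "(u + u', v + v', \<lambda>i. d i + d' i)"
    have "B - gact s A (u + u') (v + v') (\<lambda>i. d i + d' i)
      = - (gact s A (u + u') (v + v') (\<lambda>i. d i + d' i) - gact s A u v d - tmap s A u' v' d')"
      unfolding w[symmetric] by simp
    also have "\<dots> \<in> mats (ordge (e + (e + n)))"
      by (intro mats_ordge_closed(4) gact_expand[OF A _ uvd(2,4) uvd'(2,4) uvd(6) uvd'(6)]) simp
    finally have "B - gact s A (u + u') (v + v') (\<lambda>i. d i + d' i) \<in> mats (ordge (c + (e + Suc n)))"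
      by (simp add: e_def)
    moreover have "u' \<in> mats (ordge e)" "v' \<in> mats (ordge e)" "\<And>i. d' i \<in> ordge (Suc e)"
      using mats_ordge_antimono[OF uvd'(2)] mats_ordge_antimono[OF uvd'(4)] ordge_antimono[OF uvd'(6)] by auto
    ultimately have "P (Suc n) ?z" using uvd uvd' by (simp add: P_def)
    moreover have "Q n z ?z"
      using mats_ordge_antimono[OF uvd'(2)] mats_ordge_antimono[OF uvd'(4)] ordge_antimono[OF uvd'(6)]
      by (simp add: Q_def z)
    ultimately show "\<exists>z'. P (Suc n) z' \<and> Q n z z'" by blast
  qed
  then obtain z where z: "\<And>n. P n (z n)" "\<And>n. Q n (z n) (z (Suc n))" by blast
  define u v d where "u n = fst (z n)" and "v n = fst (snd (z n))" and "d n = snd (snd (z n))" for n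
  have zn: "z n = (u n, v n, d n)" for n by (simp add: u_def v_def d_def)
  have uvd: "\<And>n. u n \<in> mats (Pser s)" "\<And>n. u n \<in> mats (ordge e)" "\<And>n. v n \<in> mats (Pser s)" "\<And>n. v n \<in> mats (ordge e)"
      "\<And>n i. d n i \<in> Pser s" "\<And>n i. d n i \<in> ordge (Suc e)"
      and r: "\<And>n. B - gact s A (u n) (v n) (d n) \<in> mats (ordge (c + (e + n)))"
    using z(1) unfolding zn P_def by auto
  have diff: "\<And>n. u (Suc n) - u n \<in> mats (ordge n)" "\<And>n. v (Suc n) - v n \<in> mats (ordge n)"
    "\<And>n i. d (Suc n) i - d n i \<in> ordge n"
    using z(2) unfolding zn Q_def by auto
  obtain u' where u': "u' \<in> mats (Pser s)" "\<And>n. u' - u n \<in> mats (ordge n)"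
    using mats_limit[OF diff(1) uvd(1)] by blast
  obtain v' where v': "v' \<in> mats (Pser s)" "\<And>n. v' - v n \<in> mats (ordge n)"
    using mats_limit[OF diff(2) uvd(3)] by blast
  have "\<exists>g. g \<in> Pser s \<and> (\<forall>n. g - d n i \<in> ordge n)" for i
    using mps_limit[of "\<lambda>n. d n i" s] diff(3) uvd(5) by metis
  then obtain d' where d': "\<And>i. d' i \<in> Pser s" "\<And>i n. d' i - d n i \<in> ordge n" by metis
  have ue: "u' \<in> mats (ordge e)" using mats_ordge_closed(2)[OF u'(2)[of e] uvd(2)[of e]] by simp
  have ve: "v' \<in> mats (ordge e)" using mats_ordge_closed(2)[OF v'(2)[of e] uvd(4)[of e]] by simp
  have de: "d' i \<in> ordge (Suc e)" for i using ordge_add[OF d'(2)[of i "Suc e"] uvd(6)[of "Suc e" i]] by simp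
  have "B - gact s A u' v' d' \<in> mats (ordge n)" for n
  proof -
    \<comment> \<open>\<open>gact_expand\<close> also compares the limit with an approximation, the
      remaining difference playing the part of the correction. The summand e ensures e \<le> m, and
      index m + 1 gives the vector field its extra order.\<close>
    define m where "m = n + e"
    let ?u = "u (Suc m)" and ?v = "v (Suc m)" and ?d = "d (Suc m)"
    have w: "u' - ?u \<in> mats (ordge m)" "v' - ?v \<in> mats (ordge m)" "\<And>i. d' i - ?d i \<in> ordge (Suc m)"
      using mats_ordge_antimono[OF u'(2)[of "Suc m"]] mats_ordge_antimono[OF v'(2)[of "Suc m"]] d'(2) by auto
    have "gact s A (?u + (u' - ?u)) (?v + (v' - ?v)) (\<lambda>i. ?d i + (d' i - ?d i)) - gact s A ?u ?v ?d
        - tmap s A (u' - ?u) (v' - ?v) (\<lambda>i. d' i - ?d i) \<in> mats (ordge (e + m))"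
      by (rule gact_expand[OF A _ uvd(2) uvd(4) w(1,2) uvd(6) w(3)]) (simp add: m_def)
    then have 1: "gact s A u' v' d' - gact s A ?u ?v ?d - tmap s A (u' - ?u) (v' - ?v) (\<lambda>i. d' i - ?d i)
        \<in> mats (ordge m)"
      by (auto elim: mats_ordge_antimono)
    have 2: "tmap s A (u' - ?u) (v' - ?v) (\<lambda>i. d' i - ?d i) \<in> mats (ordge m)"
      using w ordge_antimono[OF w(3), of m] by (intro tmap_ordge) auto
    have 3: "B - gact s A ?u ?v ?d \<in> mats (ordge m)"
      using mats_ordge_antimono[OF r[of "Suc m"], of m] by simp
    have "B - gact s A u' v' d' \<in> mats (ordge m)"
      using mats_ordge_closed(3)[OF 3 mats_ordge_closed(2)[OF 1 2]] by simp
    then show ?thesis by (rule mats_ordge_antimono) (simp add: m_def)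
  qed
  then have "gact s A u' v' d' = B" using mats_eq_0I by fastforce
  moreover have "u' \<in> mats (ordge 1)" "v' \<in> mats (ordge 1)" "\<And>i. d' i \<in> ordge 2"
    using mats_ordge_antimono[OF ue, of 1] mats_ordge_antimono[OF ve, of 1] ordge_antimono[OF de, of 2]
    by (simp_all add: e_def)
  ultimately show ?thesis using u'(1) v'(1) d'(1)
    by (intro exI[of _ u'] exI[of _ v'] exI[of _ d']) simp
qed

section \<open>Invariance of finite codimension under the group\<close>

locale power_series_automorphism =
  fixes s :: nat and \<phi> :: "'a::field mps \<Rightarrow> 'a mps"
  assumes bij: "bij_betw \<phi> (Pser s) (Pser s)"
    and add: "f \<in> Pser s \<Longrightarrow> g \<in> Pser s \<Longrightarrow> \<phi> (f + g) = \<phi> f + \<phi> g"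
    and mult: "f \<in> Pser s \<Longrightarrow> g \<in> Pser s \<Longrightarrow> \<phi> (f * g) = \<phi> f * \<phi> g"
    and const: "\<phi> (mconst c) = mconst c"
begin

lemma Pser [simp]: "f \<in> Pser s \<Longrightarrow> \<phi> f \<in> Pser s"
  using bij by (auto simp: bij_betw_def)

lemma surj: "g \<in> Pser s \<Longrightarrow> \<exists>f\<in>Pser s. \<phi> f = g"
  using bij unfolding bij_betw_def by (metis image_iff)

lemma inj: "f \<in> Pser s \<Longrightarrow> g \<in> Pser s \<Longrightarrow> \<phi> f = \<phi> g \<Longrightarrow> f = g"
  using bij by (auto simp: bij_betw_def inj_on_def)

lemma one [simp]: "\<phi> 1 = 1"
  using const[of 1] by (simp add: mpmon_0_1)

lemma zero [simp]: "\<phi> 0 = 0"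
  using const[of 0] by simp

lemma sum: "(\<And>i. i \<in> I \<Longrightarrow> f i \<in> Pser s) \<Longrightarrow> \<phi> (\<Sum>i\<in>I. f i) = (\<Sum>i\<in>I. \<phi> (f i))"
  by (induction I rule: infinite_finite_induct) (auto simp: add)

lemma unit_iff:
  assumes "f \<in> Pser s"
  shows "mps_nth f 0 \<noteq> 0 \<longleftrightarrow> (\<exists>g\<in>Pser s. f * g = (1 :: 'a mps))"
proof
  assume "mps_nth f 0 \<noteq> 0"
  then show "\<exists>g\<in>Pser s. f * g = 1" by (rule mps_unit[OF assms]) blast
next
  assume "\<exists>g\<in>Pser s. f * g = 1"
  then obtain g where "f * g = 1" by blast
  then have "mps_nth (f * g) 0 = 1" by (simp add: mps_nth_one del: mps_nth_0_mult)
  then show "mps_nth f 0 \<noteq> 0" by auto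
qed

text \<open>Being a unit is preserved by any ring automorphism, and m consists of the
  nonunits.\<close>

lemma ordge_1_iff:
  assumes f: "f \<in> Pser s"
  shows "\<phi> f \<in> ordge 1 \<longleftrightarrow> f \<in> ordge 1"
proof -
  have "(\<exists>g\<in>Pser s. \<phi> f * g = 1) \<longleftrightarrow> (\<exists>g\<in>Pser s. f * g = 1)"
  proof
    assume "\<exists>g\<in>Pser s. \<phi> f * g = 1"
    then obtain g where g: "g \<in> Pser s" "\<phi> f * \<phi> g = 1" using surj by metis
    then have "\<phi> (f * g) = \<phi> 1" using f by (simp add: mult)
    then have "f * g = 1" using f g inj[of "f * g" 1] by simp
    then show "\<exists>g\<in>Pser s. f * g = 1" using g by blast
  next
    assume "\<exists>g\<in>Pser s. f * g = 1"
    then obtain g where g: "g \<in> Pser s" "f * g = 1" by blast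
    then have "\<phi> f * \<phi> g = 1" using f mult[of f g] by simp
    then show "\<exists>g\<in>Pser s. \<phi> f * g = 1" using g by auto
  qed
  then show ?thesis using unit_iff[OF f] unit_iff[OF Pser[OF f]] unfolding mps_ordge_1_iff by blast
qed

text \<open>Continuity, which the axioms of an automorphism do not contain, follows from
  preservation of m and multiplicativity.\<close>

lemma ordge:
  assumes "f \<in> Pser s" "f \<in> ordge n"
  shows "\<phi> f \<in> ordge n"
  using assms
proof (induction n arbitrary: f)
  case (Suc n)
  obtain g where g: "\<And>i. g i \<in> Pser s" "\<And>i. g i \<in> ordge n" "f = (\<Sum>i<s. mvar i * g i)"
    using ordge_Suc_decompose[OF Suc.prems] by metis
  have "\<phi> f = (\<Sum>i<s. \<phi> (mvar i) * \<phi> (g i))"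
    unfolding g(3) using g(1) by (subst sum) (auto simp: mult)
  also have "\<dots> \<in> ordge (Suc n)"
  proof (rule ordge_sum)
    fix i assume "i \<in> {..<s}"
    then have "\<phi> (mvar i) \<in> ordge 1" using ordge_1_iff[of "mvar i"] by simp
    then show "\<phi> (mvar i) * \<phi> (g i) \<in> ordge (Suc n)"
      by (rule ordge_mult_ge[OF _ Suc.IH[OF g(1,2)]]) simp
  qed
  finally show ?case .
qed simp

text \<open>Both sides are derivations along \<phi> that vanish on constants and agree on the
  variables, hence on monomials. The continuity in \<open>ordge\<close> extends this to all
  series.\<close>

lemma chain_rule:
  assumes f: "f \<in> Pser s"
  shows "mderiv \<nu> (\<phi> f) = (\<Sum>\<mu><s. \<phi> (mderiv \<mu> f) * mderiv \<nu> (\<phi> (mvar \<mu>)))"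
proof -
  define E where "E f = (\<Sum>\<mu><s. \<phi> (mderiv \<mu> f) * mderiv \<nu> (\<phi> (mvar \<mu>)))" for f
  have E_add: "E (f + g) = E f + E g" if "f \<in> Pser s" "g \<in> Pser s" for f g
    using that by (simp add: E_def add distrib_right sum.distrib)
  have E_mult: "E (f * g) = E f * \<phi> g + \<phi> f * E g" if "f \<in> Pser s" "g \<in> Pser s" for f g
    using that by (simp add: E_def add mult mderiv_mult sum_distrib_left sum_distrib_right algebra_simps flip: sum.distrib)
  have E_var: "E (mvar i) = mderiv \<nu> (\<phi> (mvar i))" if "i < s" for i
  proof -
    have "E (mvar i) = (\<Sum>\<mu><s. if i = \<mu> then mderiv \<nu> (\<phi> (mvar i)) else 0)"
      unfolding E_def by (intro sum.cong) (auto simp: mderiv_var)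
    then show ?thesis using that by simp
  qed
  have mon: "mderiv \<nu> (\<phi> (mpmon \<alpha> c)) = E (mpmon \<alpha> c)" if "\<alpha> \<in> evecs s" for \<alpha> c
    using that
  proof (induction \<alpha> rule: evecs_induct)
    case zero
    then show ?case by (simp add: const E_def)
  next
    case (add i \<beta>)
    then have "mderiv \<nu> (\<phi> (mvar i * mpmon \<beta> c)) = E (mvar i * mpmon \<beta> c)"
      by (simp add: mult E_mult mderiv_mult E_var)
    then show ?case by (simp add: mvar_mult_mpmon)
  qed
  have "mderiv \<nu> (\<phi> f) - E f \<in> ordge N" for N
  proof (rule ordge_by_monomials[OF _ _ _ f])
    fix h :: "'a mps" assume h: "h \<in> Pser s" "h \<in> ordge (Suc N)"
    then have "E h \<in> ordge N"
      unfolding E_def by (intro ordge_sum ordge_mult_right ordge mderiv_ordge) auto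
    moreover have "mderiv \<nu> (\<phi> h) \<in> ordge N" using h by (intro mderiv_ordge ordge)
    ultimately show "mderiv \<nu> (\<phi> h) - E h \<in> ordge N" by simp
  qed (auto simp: add E_add mon)
  then show ?thesis using mps_eq_0I unfolding E_def by fastforce
qed

abbreviation mmap :: "'a mps m2 \<Rightarrow> 'a mps m2" where "mmap \<equiv> map_m2 \<phi>"

lemma mmap_add: "A \<in> mats (Pser s) \<Longrightarrow> B \<in> mats (Pser s) \<Longrightarrow> mmap (A + B) = mmap A + mmap B"
  by (simp add: m2_eq_iff mats_def add)

lemma mmap_mult: "A \<in> mats (Pser s) \<Longrightarrow> B \<in> mats (Pser s) \<Longrightarrow> mmap (A * B) = mmap A * mmap B"
  by (simp add: m2_eq_iff mats_def add mult)

lemma mmap_smul: "r \<in> Pser s \<Longrightarrow> A \<in> mats (Pser s) \<Longrightarrow> mmap (smul r A) = smul (\<phi> r) (mmap A)"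
  by (simp add: m2_eq_iff mats_def mult)

lemma mmap_sum: "(\<And>i. i \<in> I \<Longrightarrow> f i \<in> mats (Pser s)) \<Longrightarrow> mmap (\<Sum>i\<in>I. f i) = (\<Sum>i\<in>I. mmap (f i))"
  by (induction I rule: infinite_finite_induct) (auto simp: mmap_add m2_eq_iff)

lemma mmap_surj:
  assumes "A \<in> mats (Pser s)"
  shows "\<exists>B\<in>mats (Pser s). mmap B = A"
proof -
  have "e00 A \<in> Pser s" "e01 A \<in> Pser s" "e10 A \<in> Pser s" "e11 A \<in> Pser s"
    using assms by (auto simp: mats_def)
  then obtain a b c d where "a \<in> Pser s" "b \<in> Pser s" "c \<in> Pser s" "d \<in> Pser s"
    "\<phi> a = e00 A" "\<phi> b = e01 A" "\<phi> c = e10 A" "\<phi> d = e11 A"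
    using surj by metis
  then have "M2 a b c d \<in> mats (Pser s)" "mmap (M2 a b c d) = A"
    by (simp_all add: mats_def m2_eq_iff)
  then show ?thesis by blast
qed

lemma mmap_inj: "A \<in> mats (Pser s) \<Longrightarrow> B \<in> mats (Pser s) \<Longrightarrow> mmap A = mmap B \<Longrightarrow> A = B"
  by (simp add: m2_eq_iff mats_def inj)

lemma mmap_Pser [simp]: "A \<in> mats (Pser s) \<Longrightarrow> mmap A \<in> mats (Pser s)"
  by (simp add: mats_def)

lemma mderiv_mmap:
  "A \<in> mats (Pser s) \<Longrightarrow>
    map_m2 (mderiv \<nu>) (mmap A) = (\<Sum>\<mu><s. smul (mderiv \<nu> (\<phi> (mvar \<mu>))) (mmap (map_m2 (mderiv \<mu>) A)))"
  by (simp add: m2_eq_iff mats_def chain_rule mult.commute)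

lemma mderiv_m2_mult: "map_m2 (mderiv \<nu>) (A * B) = map_m2 (mderiv \<nu>) A * B + A * map_m2 (mderiv \<nu>) B"
  by (simp add: m2_eq_iff mderiv_mult)

text \<open>Group translation carries the tangent module at A to the one at U \<phi>(A) V.
  Multiplying by the inverses removes U and V; their own derivatives are absorbed into the matrix
  directions, and the chain rule moves the vector field through \<phi>.\<close>

lemma tmod_pullback:
  assumes A: "A \<in> mats (Pser s)"
    and U: "U \<in> mats (Pser s)" "U' \<in> mats (Pser s)" "U' * U = 1"
    and V: "V \<in> mats (Pser s)" "V' \<in> mats (Pser s)" "V * V' = 1"
    and C: "C \<in> mats (Pser s)" "U * mmap C * V \<in> tmod s (U * mmap A * V)"
  shows "C \<in> tmod s A"
proof -
  let ?B = "U * mmap A * V"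
  have inv: "U' * (U * X) = X" "X * V * V' = X" for X
    using U(3) V(3) by (metis mult.assoc mult_1_left, metis mult.assoc mult_1_right)
  obtain u v d where uvd: "u \<in> mats (Pser s)" "v \<in> mats (Pser s)" "\<And>\<nu>. d \<nu> \<in> Pser s" "\<And>\<nu>. d \<nu> \<in> ordge 1"
    and t: "U * mmap C * V = tmap s ?B u v d"
    using C(2) unfolding tmod_def by auto
  \<comment> \<open>The first term is the conjugated direction, the second the logarithmic
    derivative of U along d; \<open>v1\<close> is the counterpart for V.\<close>
  define u1 where "u1 = U' * u * U + (\<Sum>\<nu><s. smul (d \<nu>) (U' * map_m2 (mderiv \<nu>) U))"
  define v1 where "v1 = V * v * V' + (\<Sum>\<nu><s. smul (d \<nu>) (map_m2 (mderiv \<nu>) V * V'))"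
  define d1 where "d1 \<mu> = (if \<mu> < s then \<Sum>\<nu><s. d \<nu> * mderiv \<nu> (\<phi> (mvar \<mu>)) else 0)" for \<mu>
  have deriv: "U' * map_m2 (mderiv \<nu>) ?B * V'
    = U' * map_m2 (mderiv \<nu>) U * mmap A + mmap A * (map_m2 (mderiv \<nu>) V * V') + map_m2 (mderiv \<nu>) (mmap A)" for \<nu>
    by (simp add: mderiv_m2_mult distrib_left distrib_right mult.assoc inv V(3))
  have "mmap C = U' * (U * mmap C * V) * V'" by (simp add: inv mult.assoc V(3))
  also have "\<dots> = U' * (u * ?B) * V' + U' * (?B * v) * V' + (\<Sum>\<nu><s. smul (d \<nu>) (U' * map_m2 (mderiv \<nu>) ?B * V'))"
    unfolding t tmap_def by (simp add: distrib_left distrib_right sum_distrib_left sum_distrib_right)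
  also have "U' * (u * ?B) * V' = U' * u * U * mmap A" by (simp add: mult.assoc V(3))
  also have "U' * (?B * v) * V' = mmap A * (V * v * V')" by (simp add: mult.assoc inv)
  also have "(\<Sum>\<nu><s. smul (d \<nu>) (U' * map_m2 (mderiv \<nu>) ?B * V'))
    = (\<Sum>\<nu><s. smul (d \<nu>) (U' * map_m2 (mderiv \<nu>) U)) * mmap A
      + mmap A * (\<Sum>\<nu><s. smul (d \<nu>) (map_m2 (mderiv \<nu>) V * V'))
      + (\<Sum>\<nu><s. smul (d \<nu>) (map_m2 (mderiv \<nu>) (mmap A)))"
    unfolding deriv by (simp add: smul_add sum.distrib sum_distrib_left sum_distrib_right)
  also have "(\<Sum>\<nu><s. smul (d \<nu>) (map_m2 (mderiv \<nu>) (mmap A)))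
    = (\<Sum>\<mu><s. smul (d1 \<mu>) (mmap (map_m2 (mderiv \<mu>) A)))"
    unfolding mderiv_mmap[OF A] smul_sum
    by (subst sum.swap) (simp add: d1_def smul_sum_left)
  finally have eq: "mmap C = u1 * mmap A + mmap A * v1 + (\<Sum>\<mu><s. smul (d1 \<mu>) (mmap (map_m2 (mderiv \<mu>) A)))"
    by (simp add: u1_def v1_def distrib_left distrib_right add_ac)
  have "u1 \<in> mats (Pser s)" "v1 \<in> mats (Pser s)"
    unfolding u1_def v1_def by (intro mats_Pser_closed mats_Pser_sum U V uvd)+
  then obtain u2 v2 where uv2: "u2 \<in> mats (Pser s)" "mmap u2 = u1" "v2 \<in> mats (Pser s)" "mmap v2 = v1"
    using mmap_surj by metis
  have d1: "d1 \<mu> \<in> Pser s" "d1 \<mu> \<in> ordge 1" for \<mu>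
    unfolding d1_def by (simp_all add: Pser_sum[OF Pser_mult] ordge_sum[OF ordge_mult_right] uvd del: One_nat_def)
  have "\<forall>\<mu>. \<exists>f. f \<in> Pser s \<and> \<phi> f = d1 \<mu>" using surj[OF d1(1)] by blast
  then obtain d2 where d2: "\<And>\<mu>. d2 \<mu> \<in> Pser s" "\<And>\<mu>. \<phi> (d2 \<mu>) = d1 \<mu>" by metis
  have d2o: "d2 \<mu> \<in> ordge 1" for \<mu> using ordge_1_iff[OF d2(1), of \<mu>] d1(2)[of \<mu>] d2(2) by simp
  have "mmap (tmap s A u2 v2 d2) = mmap C"
    unfolding tmap_def eq using A uv2 d2
    by (simp add: mmap_add mmap_mult mmap_sum mmap_smul)
  then have "C = tmap s A u2 v2 d2" using C(1) A uv2 d2 tmap_Pser mmap_inj by metis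
  then show ?thesis using tmodI[OF uv2(1,3) d2(1) d2o] by simp
qed

text \<open>\<phi> does not lower orders and neither does multiplication by U and V, so the
  translate of C keeps order n and the same n serves for A.\<close>

lemma tmod_codim_invariant:
  assumes A: "A \<in> mats (Pser s)"
    and U: "U \<in> mats (Pser s)" "U' \<in> mats (Pser s)" "U' * U = 1"
    and V: "V \<in> mats (Pser s)" "V' \<in> mats (Pser s)" "V * V' = 1"
    and sub: "mats (Pser s) \<inter> mats (ordge n) \<subseteq> tmod s (U * mmap A * V)"
  shows "mats (Pser s) \<inter> mats (ordge n) \<subseteq> tmod s A"
proof
  fix C :: "'a mps m2" assume C: "C \<in> mats (Pser s) \<inter> mats (ordge n)"
  then have "mmap C \<in> mats (ordge n)" using ordge by (auto simp: mats_def)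
  then have "U * mmap C * V \<in> mats (Pser s) \<inter> mats (ordge n)" using C U V by auto
  then show "C \<in> tmod s A" using tmod_pullback[OF A U V] C sub by blast
qed

end

section \<open>Spans over the base field\<close>

definition kspan :: "'a::comm_ring_1 mps m2 set \<Rightarrow> 'a mps m2 set" where
  "kspan G = {\<Sum>g\<in>G. smul (mconst (c g)) g | c. True}"

lemma kspan_zero: "0 \<in> kspan G"
  unfolding kspan_def by (auto intro!: exI[of _ "\<lambda>_. 0"])

lemma kspan_add:
  assumes "A \<in> kspan G" "B \<in> kspan G"
  shows "A + B \<in> kspan G"
proof -
  obtain c d where "A = (\<Sum>g\<in>G. smul (mconst (c g)) g)" "B = (\<Sum>g\<in>G. smul (mconst (d g)) g)"
    using assms unfolding kspan_def by blast
  then have "A + B = (\<Sum>g\<in>G. smul (mconst (c g + d g)) g)"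
    by (simp add: mpmon_add smul_add_left sum.distrib)
  then show ?thesis unfolding kspan_def by (intro CollectI exI[of _ "\<lambda>g. c g + d g"]) simp
qed

lemma kspan_sum: "(\<And>i. i \<in> I \<Longrightarrow> f i \<in> kspan G) \<Longrightarrow> (\<Sum>i\<in>I. f i) \<in> kspan G"
  by (induction I rule: infinite_finite_induct) (auto simp: kspan_zero kspan_add)

lemma kspan_base:
  assumes "finite G" "g \<in> G"
  shows "smul (mconst c) g \<in> kspan G"
proof -
  have "(\<Sum>h\<in>G. smul (mconst (if h = g then c else 0)) h) = (\<Sum>h\<in>G. if h = g then smul (mconst c) g else 0)"
    by (intro sum.cong) auto
  also have "\<dots> = smul (mconst c) g" using assms by simp
  finally show ?thesis unfolding kspan_def by (intro CollectI exI[of _ "\<lambda>h. if h = g then c else 0"]) simp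
qed

text \<open>Only the x_i^j E have to be represented. Thus finite dimension known for polynomial
  matrices alone is already enough.\<close>

lemma ordge_in_submod_of_kspan:
  fixes N :: "'a::field mps m2 set"
  assumes N: "submod s N" and G: "finite G"
    and rep: "\<And>i j E. i < s \<Longrightarrow> E \<in> m2_units \<Longrightarrow> \<exists>r\<in>kspan G. smul (mvar i ^ j) E - r \<in> N"
  shows "\<exists>n. mats (Pser s) \<inter> mats (ordge n) \<subseteq> N"
proof (rule ordge_in_submod[OF N])
  fix i and E :: "'a mps m2" assume "i < s" "E \<in> m2_units"
  then have "\<exists>c. smul (mvar i ^ j) E - (\<Sum>g\<in>G. smul (mconst (c g)) g) \<in> N" for j
    using rep[of i E j] unfolding kspan_def by blast
  then show "\<exists>a. smul (mvar i ^ a) E \<in> N" by (rule variable_power_in_submod[OF N \<open>i < s\<close> G])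
qed

definition monomial_mats :: "nat \<Rightarrow> nat \<Rightarrow> 'a::comm_ring_1 mps m2 set" where
  "monomial_mats s n = (\<lambda>(\<alpha>, E). smul (mpmon \<alpha> 1) E) ` ({\<alpha> \<in> evecs s. mdeg \<alpha> \<le> n} \<times> m2_units)"

lemma finite_monomial_mats: "finite (monomial_mats s n)"
  unfolding monomial_mats_def
  by (intro finite_imageI finite_cartesian_product finite_evecs_bounded) (simp add: m2_units_def)

lemma trunc_kspan: "map_m2 (trunc s n) A \<in> kspan (monomial_mats s n)"
proof -
  have 1: "smul (trunc s n f) E \<in> kspan (monomial_mats s n)" if "E \<in> m2_units" for f and E :: "'a mps m2"
  proof -
    have "smul (trunc s n f) E = (\<Sum>\<alpha> | \<alpha> \<in> evecs s \<and> mdeg \<alpha> \<le> n. smul (mconst (mps_nth f \<alpha>)) (smul (mpmon \<alpha> 1) E))"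
      unfolding trunc_def smul_sum_left by (simp add: mpmon_mult)
    also have "\<dots> \<in> kspan (monomial_mats s n)"
      by (intro kspan_sum kspan_base[OF finite_monomial_mats]) (use that in \<open>auto simp: monomial_mats_def\<close>)
    finally show ?thesis .
  qed
  show ?thesis
    by (subst m2_units_expand) (simp, intro kspan_add 1; simp add: m2_units_def)
qed

section \<open>Top degree forms\<close>

definition hpart :: "nat \<Rightarrow> 'a::comm_ring_1 mps \<Rightarrow> 'a mps" where
  "hpart d f = Mps (\<lambda>\<alpha>. if mdeg \<alpha> = d then mps_nth f \<alpha> else 0)"

definition homog :: "nat \<Rightarrow> 'a::comm_ring_1 mps set" where
  "homog d = {f. \<forall>\<alpha>. mdeg \<alpha> \<noteq> d \<longrightarrow> mps_nth f \<alpha> = 0}"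

text \<open>Within \<open>Pser s\<close> these are the polynomials of degree less than d.\<close>

definition degless :: "nat \<Rightarrow> 'a::comm_ring_1 mps set" where
  "degless d = {f. \<forall>\<alpha>. d \<le> mdeg \<alpha> \<longrightarrow> mps_nth f \<alpha> = 0}"

lemma mps_nth_hpart: "mps_nth (hpart d f) \<alpha> = (if mdeg \<alpha> = d then mps_nth f \<alpha> else 0)"
  by (simp add: hpart_def)

lemma hpart_homog [simp]: "hpart d f \<in> homog d"
  by (simp add: homog_def mps_nth_hpart)

lemma hpart_Pser [simp]: "f \<in> Pser s \<Longrightarrow> hpart d f \<in> Pser s"
  by (simp add: Pser_def mps_nth_hpart)

lemma hpart_add: "hpart d (f + g) = hpart d f + hpart d g"
  by (rule mps_eqI) (simp add: mps_nth_hpart)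

lemma hpart_zero: "hpart d 0 = 0"
  by (rule mps_eqI) (simp add: mps_nth_hpart)

lemma hpart_sum: "hpart d (\<Sum>i\<in>I. f i) = (\<Sum>i\<in>I. hpart d (f i))"
  by (induction I rule: infinite_finite_induct) (auto simp: hpart_add hpart_zero)

lemma hpart_ident: "f \<in> homog d \<Longrightarrow> hpart d f = f"
  by (rule mps_eqI) (auto simp: mps_nth_hpart homog_def)

lemma homog_ordge: "f \<in> homog d \<Longrightarrow> e \<le> d \<Longrightarrow> f \<in> ordge e"
  by (auto simp: homog_def ordge_def)

lemma hpart_mult:
  assumes "g \<in> homog n" "n \<le> d"
  shows "hpart d (f * g) = hpart (d - n) f * g"
proof (rule mps_eqI)
  fix \<gamma>
  have "(if mdeg \<gamma> = d then mps_nth f \<alpha> * mps_nth g \<beta> else 0) = mps_nth (hpart (d - n) f) \<alpha> * mps_nth g \<beta>"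
    if "\<alpha> + \<beta> = \<gamma>" for \<alpha> \<beta>
  proof (cases "mdeg \<beta> = n")
    case True
    then show ?thesis using that assms(2) by (auto simp: mps_nth_hpart)
  next
    case False
    then have "mps_nth g \<beta> = 0" using assms(1) by (simp add: homog_def)
    then show ?thesis by simp
  qed
  then have "(\<Sum>(\<alpha>, \<beta>)\<in>decomps \<gamma>. if mdeg \<gamma> = d then mps_nth f \<alpha> * mps_nth g \<beta> else 0)
      = (\<Sum>(\<alpha>, \<beta>)\<in>decomps \<gamma>. mps_nth (hpart (d - n) f) \<alpha> * mps_nth g \<beta>)"
    by (intro sum.cong) auto
  then show "mps_nth (hpart d (f * g)) \<gamma> = mps_nth (hpart (d - n) f * g) \<gamma>"
    by (auto simp: mps_nth_hpart mps_nth_mult)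
qed

lemma degless_closed [simp]:
  "0 \<in> degless d" "f \<in> degless d \<Longrightarrow> g \<in> degless d \<Longrightarrow> f + g \<in> degless d"
  "f \<in> degless d \<Longrightarrow> g \<in> degless d \<Longrightarrow> f - g \<in> degless d" "f \<in> degless d \<Longrightarrow> - f \<in> degless d"
  by (auto simp: degless_def)

lemma degless_sum [simp]: "(\<And>i. i \<in> I \<Longrightarrow> f i \<in> degless d) \<Longrightarrow> (\<Sum>i\<in>I. f i) \<in> degless d"
  by (induction I rule: infinite_finite_induct) auto

lemma degless_mono: "f \<in> degless d \<Longrightarrow> d \<le> e \<Longrightarrow> f \<in> degless e"
  by (auto simp: degless_def)

lemma degless_mult:
  assumes "f \<in> homog n" "g \<in> degless m"
  shows "f * g \<in> degless (n + m)"
proof -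
  have "mps_nth (f * g) \<gamma> = 0" if "n + m \<le> mdeg \<gamma>" for \<gamma>
    unfolding mps_nth_mult
  proof (intro sum.neutral ballI, clarify)
    fix \<alpha> \<beta> assume "(\<alpha>, \<beta>) \<in> decomps \<gamma>"
    then have "mdeg \<alpha> \<noteq> n \<or> m \<le> mdeg \<beta>" using that by auto
    then show "mps_nth f \<alpha> * mps_nth g \<beta> = 0" using assms by (auto simp: homog_def degless_def)
  qed
  then show ?thesis by (simp add: degless_def)
qed

lemma mderiv_homog: "f \<in> homog n \<Longrightarrow> mderiv \<nu> f \<in> homog (n - 1)"
  by (auto simp: homog_def mps_nth_mderiv)

lemma mderiv_degless: "f \<in> degless n \<Longrightarrow> mderiv \<nu> f \<in> degless (n - 1)"
  by (auto simp: degless_def mps_nth_mderiv)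

text \<open>For homogeneous B the tangent map is graded: B shifts degrees by n and its derivatives
  by n - 1. So homogeneous parts of a preimage form a preimage of the homogeneous part.\<close>

lemma tmap_hpart:
  assumes B: "B \<in> mats (homog n)" and n: "0 < n" "n \<le> d"
  shows "map_m2 (hpart d) (tmap s B u v \<delta>)
    = tmap s B (map_m2 (hpart (d - n)) u) (map_m2 (hpart (d - n)) v) (\<lambda>\<nu>. hpart (d - n + 1) (\<delta> \<nu>))"
proof -
  have 1: "hpart d (f * g) = hpart (d - n) f * g" if "g \<in> homog n" for f g :: "'a mps"
    by (rule hpart_mult[OF that n(2)])
  have 2: "hpart d (g * f) = g * hpart (d - n) f" if "g \<in> homog n" for f g :: "'a mps"
    using 1[OF that, of f] by (simp add: mult.commute)
  \<comment> \<open>Positivity of n makes d - (n - 1) equal to d - n + 1 in the naturals.\<close>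
  have 3: "hpart d (f * mderiv \<nu> g) = hpart (d - n + 1) f * mderiv \<nu> g" if "g \<in> homog n" for f g :: "'a mps" and \<nu>
    using hpart_mult[OF mderiv_homog[OF that], of d f \<nu>] n by (simp add: Suc_diff_le)
  show ?thesis using B by (simp add: tmap_def m2_eq_iff mats_def hpart_add hpart_sum 1 2 3)
qed

lemma tmap_degless:
  assumes A: "A \<in> mats (degless n)" and n: "0 < n" "n \<le> d"
    and uv: "u \<in> mats (homog (d - n))" "v \<in> mats (homog (d - n))" "\<And>\<nu>. \<delta> \<nu> \<in> homog (d - n + 1)"
  shows "tmap s A u v \<delta> \<in> mats (degless d)"
proof -
  have 1: "f * g \<in> degless d" "g * f \<in> degless d" if "f \<in> homog (d - n)" "g \<in> degless n" for f g :: "'a mps"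
    using degless_mult[OF that] n by (simp_all add: mult.commute)
  have 3: "f * mderiv \<nu> g \<in> degless d" if "f \<in> homog (d - n + 1)" "g \<in> degless n" for f g :: "'a mps" and \<nu>
    using degless_mult[OF that(1) mderiv_degless[OF that(2)], of \<nu>] n by simp
  have 4: "(\<Sum>\<nu><s. \<delta> \<nu> * mderiv \<nu> g) \<in> degless d" if "g \<in> degless n" for g
    using that uv(3) 3 by (intro degless_sum) blast
  show ?thesis using A uv(1,2) by (simp add: tmap_def mats_def 1 4)
qed

lemma tmap_add_base: "tmap s (A + B) u v d = tmap s A u v d + tmap s B u v d"
proof -
  have "map_m2 (mderiv \<nu>) (A + B) = map_m2 (mderiv \<nu>) A + map_m2 (mderiv \<nu>) B" for \<nu>
    by (simp add: m2_eq_iff)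
  then show ?thesis
    by (simp add: tmap_def distrib_left distrib_right smul_add sum.distrib add_ac)
qed

text \<open>A form of high degree is a tangent vector at B; the same homogeneous coefficients at A +
  B alter it only in lower degree. This rewriting ends for polynomials because the degree drops, and
  ends nowhere for a general series. Hence \<open>ordge_in_submod_of_kspan\<close> is fed only with
  powers of variables.\<close>

lemma finite_codim_of_top_forms:
  fixes A B :: "'a::field mps m2"
  assumes A: "A \<in> mats (Pser s)" "A \<in> mats (degless n)"
    and B: "B \<in> mats (Pser s)" "B \<in> mats (homog n)" and n: "0 < n"
    and D: "mats (Pser s) \<inter> mats (ordge D) \<subseteq> tmod s B"
  shows "\<exists>m. mats (Pser s) \<inter> mats (ordge m) \<subseteq> tmod s (A + B)"
proof -
  \<comment> \<open>From this degree on, forms lie in the module of B and d - n is a genuine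
    difference.\<close>
  define D0 where "D0 = D + n"
  have top: "\<exists>r. r \<in> mats (Pser s) \<and> r \<in> mats (degless d) \<and> h - r \<in> tmod s (A + B)"
    if h: "h \<in> mats (Pser s)" "h \<in> mats (homog d)" and d: "D0 \<le> d" for h d
  proof -
    have "h \<in> mats (ordge D)" using h d homog_ordge[of _ d D] by (auto simp: mats_def D0_def)
    then have "h \<in> tmod s B" using h D by blast
    then obtain u v \<delta> where uv: "u \<in> mats (Pser s)" "v \<in> mats (Pser s)" "h = tmap s B u v \<delta>"
      "\<forall>\<nu>. \<delta> \<nu> \<in> Pser s \<and> \<delta> \<nu> \<in> ordge 1"
      unfolding tmod_def by blast
    define u' v' \<delta>' where "u' = map_m2 (hpart (d - n)) u" and "v' = map_m2 (hpart (d - n)) v"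
      and "\<delta>' = (\<lambda>\<nu>. hpart (d - n + 1) (\<delta> \<nu>))"
    have nd: "n \<le> d" using d by (simp add: D0_def)
    have "h = map_m2 (hpart d) h" using h by (simp add: m2_eq_iff mats_def hpart_ident)
    also have "\<dots> = tmap s B u' v' \<delta>'"
      using tmap_hpart[OF B(2) n nd, of s u v \<delta>] by (simp add: uv(3) u'_def v'_def \<delta>'_def)
    finally have hB: "h = tmap s B u' v' \<delta>'" .
    have P: "u' \<in> mats (Pser s)" "v' \<in> mats (Pser s)" "\<And>\<nu>. \<delta>' \<nu> \<in> Pser s"
      using uv by (auto simp: u'_def v'_def \<delta>'_def mats_def)
    \<comment> \<open>The degree d - n + 1 is at least 1, so the homogeneous field still vanishes at
      the origin.\<close>
    have o: "\<delta>' \<nu> \<in> ordge 1" for \<nu> by (auto simp: \<delta>'_def intro!: homog_ordge[OF hpart_homog])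
    have "tmap s A u' v' \<delta>' \<in> mats (degless d)"
      by (rule tmap_degless[OF A(2) n nd]) (auto simp: u'_def v'_def \<delta>'_def mats_def simp del: One_nat_def)
    then have "- tmap s A u' v' \<delta>' \<in> mats (degless d)" by (simp add: mats_def)
    moreover have "- tmap s A u' v' \<delta>' \<in> mats (Pser s)" by (intro mats_Pser_closed(5) tmap_Pser A P)
    moreover have "h - (- tmap s A u' v' \<delta>') \<in> tmod s (A + B)"
    proof -
      have "tmap s (A + B) u' v' \<delta>' \<in> tmod s (A + B)" by (rule tmodI[OF P o])
      then show ?thesis unfolding tmap_add_base hB[symmetric] by (simp add: add.commute)
    qed
    ultimately show ?thesis by blast
  qed
  have poly: "\<exists>r. r \<in> mats (Pser s) \<and> r \<in> mats (degless D0) \<and> C - r \<in> tmod s (A + B)"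
    if C: "C \<in> mats (Pser s)" "C \<in> mats (degless e)" for C e
    using C
  proof (induction e arbitrary: C)
    case 0
    then have "C \<in> mats (degless D0)" by (auto simp: mats_def elim: degless_mono)
    then show ?case using 0 submod_zero[OF submod_tmod] by (intro exI[of _ C]) simp
  next
    case (Suc e)
    show ?case
    proof (cases "D0 \<le> e")
      case True
      let ?h = "map_m2 (hpart e) C"
      have h: "?h \<in> mats (Pser s)" "?h \<in> mats (homog e)" using Suc.prems by (auto simp: mats_def)
      obtain r where r: "r \<in> mats (Pser s)" "r \<in> mats (degless e)" "?h - r \<in> tmod s (A + B)"
        using top[OF h True] by blast
      have "f - hpart e f \<in> degless e" if "f \<in> degless (Suc e)" for f :: "'a mps"
        using that by (auto simp: degless_def mps_nth_hpart)
      then have "C - ?h + r \<in> mats (degless e)" using Suc.prems r by (auto simp: mats_def)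
      moreover have "C - ?h + r \<in> mats (Pser s)" using Suc.prems r h by simp
      ultimately obtain r' where r': "r' \<in> mats (Pser s)" "r' \<in> mats (degless D0)" "C - ?h + r - r' \<in> tmod s (A + B)"
        using Suc.IH by blast
      have "(C - ?h + r - r') + (?h - r) \<in> tmod s (A + B)" by (rule submod_add[OF submod_tmod r'(3) r(3)])
      then show ?thesis using r' by (intro exI[of _ r']) (simp add: algebra_simps)
    next
      case False
      then have "C \<in> mats (degless D0)" using Suc.prems degless_mono[of _ "Suc e" D0] by (auto simp: mats_def)
      then show ?thesis using Suc.prems submod_zero[OF submod_tmod] by (intro exI[of _ C]) simp
    qed
  qed
  let ?G = "monomial_mats s D0 :: 'a mps m2 set"
  have sp: "r \<in> kspan ?G" if "r \<in> mats (Pser s)" "r \<in> mats (degless D0)" for r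
  proof -
    have "trunc s D0 f = f" if "f \<in> Pser s" "f \<in> degless D0" for f :: "'a mps"
      by (rule mps_eqI) (use that in \<open>auto simp: mps_nth_trunc Pser_def degless_def\<close>)
    then have "map_m2 (trunc s D0) r = r" using that by (simp add: mats_def m2_eq_iff)
    then show ?thesis using trunc_kspan[of s D0 r] by simp
  qed
  show ?thesis
  proof (rule ordge_in_submod_of_kspan[OF submod_tmod finite_monomial_mats])
    fix i j and E :: "'a mps m2" assume "i < s" and E: "E \<in> m2_units"
    have "mvar i ^ j \<in> degless (Suc j)"
      by (auto simp: mvar_power degless_def mps_nth_mpmon)
    then have "smul (mvar i ^ j) E \<in> mats (degless (Suc j))" using E by (auto simp: m2_units_def mats_def)
    moreover have "smul (mvar i ^ j) E \<in> mats (Pser s)"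
      using E \<open>i < s\<close> by (auto simp: m2_units_def mats_def)
    ultimately show "\<exists>r\<in>kspan ?G. smul (mvar i ^ j) E - r \<in> tmod s (A + B)"
      using poly sp by blast
  qed
qed

section \<open>A homogeneous matrix with finite codimension\<close>

text \<open>For the points M_a = [[1, a], [a^3, a^2]] of the twisted cubic, the discriminant of the binary form
  det (x M_a + y M_b), and up to sign the determinant of the matrix orthogonal to M_a, M_b and M_c.
  They vanish for a degenerate tangency with the cone of singular matrices.\<close>

definition pencil_disc :: "'a::comm_ring_1 \<Rightarrow> 'a \<Rightarrow> 'a" where
  "pencil_disc a b = (a\<^sup>2 + b\<^sup>2 - a * b ^ 3 - a ^ 3 * b)\<^sup>2 - 4 * (a\<^sup>2 - a ^ 4) * (b\<^sup>2 - b ^ 4)"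

definition net_disc :: "'a::comm_ring_1 \<Rightarrow> 'a \<Rightarrow> 'a \<Rightarrow> 'a" where
  "net_disc a b c = (a + b + c) * (a * b * c) - (a * b + a * c + b * c)"

text \<open>The conditions on single points make det M_a = a^2 - a^4 nonzero; distinctness gives
  nonzero Vandermonde factors. \<open>kills_two\<close> divides by the discriminant of pairs,
  \<open>kills_three\<close> by that of triples.\<close>

definition generic_points :: "nat \<Rightarrow> (nat \<Rightarrow> 'a::field) \<Rightarrow> bool" where
  "generic_points s t \<longleftrightarrow> (\<forall>i<s. t i \<noteq> 0 \<and> (t i)\<^sup>2 \<noteq> 1)
    \<and> (\<forall>i<s. \<forall>j<s. i \<noteq> j \<longrightarrow> t i \<noteq> t j \<and> pencil_disc (t i) (t j) \<noteq> 0)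
    \<and> (\<forall>i<s. \<forall>j<s. \<forall>k<s. i \<noteq> j \<and> i \<noteq> k \<and> j \<noteq> k \<longrightarrow> net_disc (t i) (t j) (t k) \<noteq> 0)"

lemma finite_pencil_disc:
  fixes a :: "'a::field"
  assumes "a \<noteq> 0"
  shows "finite {x. pencil_disc a x = 0}"
proof -
  let ?p = "[:a\<^sup>2, - (a ^ 3), 1, - a:]\<^sup>2 - smult (4 * (a\<^sup>2 - a ^ 4)) [:0, 0, 1, 0, - 1:]"
  have eq: "poly ?p x = pencil_disc a x" for x
    by (simp add: pencil_disc_def algebra_simps power2_eq_square power3_eq_cube power4_eq_xxxx)
  \<comment> \<open>The constant term is a^4, which is nonzero in every characteristic, 2
    included.\<close>
  have "poly ?p 0 \<noteq> 0" unfolding eq using assms by (simp add: pencil_disc_def)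
  then have "?p \<noteq> 0" by (metis poly_0)
  then show ?thesis using poly_roots_finite[of ?p] unfolding eq by simp
qed

lemma finite_net_disc:
  fixes a b :: "'a::field"
  assumes "a \<noteq> 0" "b \<noteq> 0"
  shows "finite {x. net_disc a b x = 0}"
proof -
  let ?p = "[:- (a * b), (a + b) * (a * b) - (a + b), a * b:]"
  have eq: "poly ?p x = net_disc a b x" for x
    by (simp add: net_disc_def algebra_simps)
  have "?p \<noteq> 0" using assms by simp
  then show ?thesis using poly_roots_finite[of ?p] unfolding eq by simp
qed

lemma finite_square_eq_1: "finite {x :: 'a::field. x\<^sup>2 = 1}"
proof -
  have "{x :: 'a. x\<^sup>2 = 1} \<subseteq> {1, - 1}" by (auto simp: power2_eq_1_iff)
  then show ?thesis by (rule finite_subset) simp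
qed

lemma pencil_disc_commute: "pencil_disc a b = pencil_disc b a"
  by (simp add: pencil_disc_def algebra_simps)

lemma net_disc_rotate: "net_disc a b c = net_disc b c a" "net_disc a b c = net_disc a c b"
  by (simp_all add: net_disc_def algebra_simps)

text \<open>The points are chosen one by one, each avoiding the finitely many zeros of the
  conditions against the earlier points.\<close>

lemma ex_generic_points:
  assumes "infinite (UNIV :: 'a::field set)"
  shows "\<exists>t :: nat \<Rightarrow> 'a. generic_points s t"
proof (induction s)
  case 0
  then show ?case by (simp add: generic_points_def)
next
  case (Suc s)
  then obtain t :: "nat \<Rightarrow> 'a" where t: "generic_points s t" by blast
  define F where "F = {0} \<union> {x :: 'a. x\<^sup>2 = 1} \<union> t ` {..<s} \<union> (\<Union>i<s. {x. pencil_disc (t i) x = 0})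
    \<union> (\<Union>i<s. \<Union>j<s. {x. net_disc (t i) (t j) x = 0})"
  have nz: "t i \<noteq> 0" if "i < s" for i using t that by (simp add: generic_points_def)
  have "finite F"
    unfolding F_def
    by (intro finite_UnI finite_UN_I finite_square_eq_1 finite_pencil_disc finite_net_disc nz) auto
  then obtain x where x: "x \<notin> F" using assms ex_new_if_finite by blast
  have x': "x \<noteq> 0" "x\<^sup>2 \<noteq> 1" "\<And>i. i < s \<Longrightarrow> t i \<noteq> x" "\<And>i. i < s \<Longrightarrow> pencil_disc (t i) x \<noteq> 0"
    "\<And>i. i < s \<Longrightarrow> pencil_disc x (t i) \<noteq> 0" "\<And>i j. i < s \<Longrightarrow> j < s \<Longrightarrow> net_disc (t i) (t j) x \<noteq> 0"
    "\<And>i j. i < s \<Longrightarrow> j < s \<Longrightarrow> net_disc (t i) x (t j) \<noteq> 0" "\<And>i j. i < s \<Longrightarrow> j < s \<Longrightarrow> net_disc x (t i) (t j) \<noteq> 0"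
    using x pencil_disc_commute[of x] net_disc_rotate(1)[of x] net_disc_rotate(2)[of _ x] by (auto simp: F_def)
  have "generic_points (Suc s) (t(s := x))"
    using t x' unfolding generic_points_def by (auto simp: less_Suc_eq)
  then show ?case by blast
qed

lemma mconst_hom:
  "mconst (a - b) = mconst a - mconst b" "mconst (a + b) = mconst a + mconst b"
  "mconst (a * b) = mconst a * mconst b" "mconst (a ^ n) = mconst a ^ n" "mconst 1 = 1"
  "mconst (numeral k) = numeral k"
proof -
  show add: "mconst (a + b) = mconst a + mconst b" for a b by (rule mpmon_add)
  show "mconst (a - b) = mconst a - mconst b" using add[of "a - b" b] by simp
  show mult: "mconst (a * b) = mconst a * mconst b" for a b by (rule mpmon_0_mult)
  show one: "mconst 1 = 1" by (rule mpmon_0_1)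
  show "mconst (a ^ n) = mconst a ^ n" by (induction n) (auto simp: one mult)
  show "mconst (numeral k) = numeral k"
    by (induction k) (simp_all only: one numeral.simps add)
qed

lemma mconst_of_nat: "mconst (of_nat n) = of_nat n"
  by (induction n) (auto simp: mconst_hom)

text \<open>The powers 1, a, a^2, a^3 with a^3 placed opposite to a. The order a^2, a^3 in the
  second row would make every such matrix singular.\<close>

definition curve_mat :: "'r::comm_ring_1 \<Rightarrow> 'r m2" where
  "curve_mat a = M2 1 a (a ^ 3) (a\<^sup>2)"

lemma mdet_curve_mat: "mdet (curve_mat a) = a\<^sup>2 - a ^ 4"
  by (simp add: mdet_def curve_mat_def power_numeral_reduce algebra_simps)

text \<open>Hence a submodule containing S, 1 and all commutators with S is everything once the discriminant
  of S is invertible.\<close>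

lemma double_commutator:
  fixes Z S :: "'r::comm_ring_1 m2"
  defines "tr \<equiv> \<lambda>X :: 'r m2. e00 X + e11 X"
  shows "smul ((tr S)\<^sup>2 - 4 * mdet S) Z
    = (Z * S - S * Z) * S - S * (Z * S - S * Z)
      - smul (tr S * tr Z - 2 * tr (Z * S)) S - smul (tr S * (tr (Z * S) - tr Z * tr S) + 2 * mdet S * tr Z) 1"
  by (simp add: m2_eq_iff tr_def mdet_def power2_eq_square algebra_simps)

text \<open>Here y_i stands for x_i^n. The axioms record what the tangent module at B = sum of y_i
  M_i offers: the single summands, which come from derivatives, and the multiples of B from both
  sides. The target y_i^4 is reached through monomials of degree four in the y_i with four, three,
  two and one distinct indices; each case discards terms of B by the case before.\<close>

locale fermat_pencil =
  fixes s :: nat and y :: "nat \<Rightarrow> 'a::field mps" and t :: "nat \<Rightarrow> 'a" and N :: "'a mps m2 set"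
  assumes N: "submod s N" and y: "\<And>i. i < s \<Longrightarrow> y i \<in> Pser s" and gen: "generic_points s t"
    and yM: "\<And>i. i < s \<Longrightarrow> smul (y i) (curve_mat (mconst (t i))) \<in> N"
    and left: "\<And>X. X \<in> mats (Pser s) \<Longrightarrow> X * (\<Sum>i<s. smul (y i) (curve_mat (mconst (t i)))) \<in> N"
    and right: "\<And>X. X \<in> mats (Pser s) \<Longrightarrow> (\<Sum>i<s. smul (y i) (curve_mat (mconst (t i)))) * X \<in> N"
begin

abbreviation "\<tau> i \<equiv> mconst (t i)"
abbreviation "M i \<equiv> curve_mat (\<tau> i)"
abbreviation "B \<equiv> \<Sum>i<s. smul (y i) (M i)"

text \<open>Membership in the annihilator of the quotient by N.\<close>

definition kills :: "'a mps \<Rightarrow> bool" where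
  "kills r \<longleftrightarrow> (\<forall>X\<in>mats (Pser s). smul r X \<in> N)"

lemma M_Pser [simp]: "M i \<in> mats (Pser s)"
  by (simp add: curve_mat_def mats_def)

lemma madj_M_Pser [simp]: "madj (M i) \<in> mats (Pser s)"
  by (simp add: curve_mat_def mats_def madj_def)

lemma scale_sub: "r \<in> Pser s \<Longrightarrow> A \<in> N \<Longrightarrow> smul r A \<in> N"
  by (rule submod_smul[OF N])

lemma scaled_M: "i < s \<Longrightarrow> r \<in> Pser s \<Longrightarrow> smul (r * y i) (M i) \<in> N"
  using scale_sub[OF _ yM, of r i] by simp

lemma cancel: "smul (mconst c) A \<in> N \<Longrightarrow> c \<noteq> 0 \<Longrightarrow> A \<in> N"
  by (rule submod_cancel_const[OF N])

lemma cancel_det: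
  assumes "i < s" "smul (mdet (M i)) A \<in> N"
  shows "A \<in> N"
proof -
  have "(t i)\<^sup>2 - (t i) ^ 4 = (t i)\<^sup>2 * (1 - (t i)\<^sup>2)" by (simp add: power_numeral_reduce algebra_simps)
  then have "(t i)\<^sup>2 - (t i) ^ 4 \<noteq> 0" using gen assms(1) by (simp add: generic_points_def)
  moreover have "mdet (M i) = mconst ((t i)\<^sup>2 - (t i) ^ 4)" by (simp add: mdet_curve_mat mconst_hom)
  ultimately show ?thesis using assms(2) cancel by simp
qed

lemma diff_neq: "i < s \<Longrightarrow> j < s \<Longrightarrow> i \<noteq> j \<Longrightarrow> t i - t j \<noteq> 0"
  using gen by (simp add: generic_points_def)

text \<open>Divided differences along the twisted cubic; the coefficients are the elementary symmetric functions.\<close>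

lemma three_relations:
  assumes ijk: "i < s" "j < s" "k < s" "i \<noteq> j" "i \<noteq> k" "j \<noteq> k"
    and w: "smul w (M i) \<in> N" "smul w (M j) \<in> N" "smul w (M k) \<in> N"
  shows "smul w (M2 0 0 (\<tau> i + \<tau> j + \<tau> k) 1) \<in> N"
    and "smul w (M2 0 1 (- (\<tau> i * \<tau> j + \<tau> i * \<tau> k + \<tau> j * \<tau> k)) 0) \<in> N"
    and "smul w (M2 1 0 (\<tau> i * \<tau> j * \<tau> k) 0) \<in> N"
proof -
  have d: "smul w (M2 0 1 ((\<tau> i)\<^sup>2 + \<tau> i * \<tau> l + (\<tau> l)\<^sup>2) (\<tau> i + \<tau> l)) \<in> N"
    if "l < s" "i \<noteq> l" "smul w (M l) \<in> N" for l
  proof (rule cancel)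
    have "smul (mconst (t i - t l)) (smul w (M2 0 1 ((\<tau> i)\<^sup>2 + \<tau> i * \<tau> l + (\<tau> l)\<^sup>2) (\<tau> i + \<tau> l)))
      = smul w (M i) - smul w (M l)"
      by (simp add: m2_eq_iff mconst_hom curve_mat_def power2_eq_square power3_eq_cube algebra_simps)
    then show "smul (mconst (t i - t l)) (smul w (M2 0 1 ((\<tau> i)\<^sup>2 + \<tau> i * \<tau> l + (\<tau> l)\<^sup>2) (\<tau> i + \<tau> l))) \<in> N"
      using submod_diff[OF N w(1) that(3)] by simp
  qed (use diff_neq ijk(1) that in auto)
  note dj = d[OF ijk(2,4) w(2)] and dk = d[OF ijk(3,5) w(3)]
  show 1: "smul w (M2 0 0 (\<tau> i + \<tau> j + \<tau> k) 1) \<in> N"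
  proof (rule cancel)
    have "smul (mconst (t j - t k)) (smul w (M2 0 0 (\<tau> i + \<tau> j + \<tau> k) 1))
      = smul w (M2 0 1 ((\<tau> i)\<^sup>2 + \<tau> i * \<tau> j + (\<tau> j)\<^sup>2) (\<tau> i + \<tau> j)) - smul w (M2 0 1 ((\<tau> i)\<^sup>2 + \<tau> i * \<tau> k + (\<tau> k)\<^sup>2) (\<tau> i + \<tau> k))"
      by (simp add: m2_eq_iff mconst_hom power2_eq_square algebra_simps)
    then show "smul (mconst (t j - t k)) (smul w (M2 0 0 (\<tau> i + \<tau> j + \<tau> k) 1)) \<in> N"
      using submod_diff[OF N dj dk] by simp
  qed (use diff_neq ijk in auto)
  have "smul w (M2 0 1 (- (\<tau> i * \<tau> j + \<tau> i * \<tau> k + \<tau> j * \<tau> k)) 0)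
    = smul w (M2 0 1 ((\<tau> i)\<^sup>2 + \<tau> i * \<tau> j + (\<tau> j)\<^sup>2) (\<tau> i + \<tau> j)) - smul (\<tau> i + \<tau> j) (smul w (M2 0 0 (\<tau> i + \<tau> j + \<tau> k) 1))"
    by (simp add: m2_eq_iff power2_eq_square algebra_simps)
  also have "\<dots> \<in> N" by (intro submod_diff[OF N] dj scale_sub[OF _ 1]) simp
  finally show 2: "smul w (M2 0 1 (- (\<tau> i * \<tau> j + \<tau> i * \<tau> k + \<tau> j * \<tau> k)) 0) \<in> N" .
  have "smul w (M2 1 0 (\<tau> i * \<tau> j * \<tau> k) 0)
    = smul w (M i) - smul (\<tau> i) (smul w (M2 0 1 (- (\<tau> i * \<tau> j + \<tau> i * \<tau> k + \<tau> j * \<tau> k)) 0))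
      - smul ((\<tau> i)\<^sup>2) (smul w (M2 0 0 (\<tau> i + \<tau> j + \<tau> k) 1))"
    by (simp add: m2_eq_iff curve_mat_def power2_eq_square power3_eq_cube algebra_simps)
  also have "\<dots> \<in> N" by (intro submod_diff[OF N] w(1) scale_sub[OF _ 1] scale_sub[OF _ 2]) simp_all
  finally show "smul w (M2 1 0 (\<tau> i * \<tau> j * \<tau> k) 0) \<in> N" .
qed

text \<open>The three relations are in echelon form: up to the factor w they express the other
  matrix units by the corner unit, which therefore generates everything.\<close>

lemma kills_of_corner:
  assumes ijk: "i < s" "j < s" "k < s" "i \<noteq> j" "i \<noteq> k" "j \<noteq> k"
    and w: "smul w (M i) \<in> N" "smul w (M j) \<in> N" "smul w (M k) \<in> N"
    and r: "w \<in> Pser s" and c: "smul w (M2 0 0 1 0) \<in> N"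
  shows "kills w"
  unfolding kills_def
proof (rule ballI, rule submod_units[OF N r])
  fix E :: "'a mps m2" assume "E \<in> m2_units"
  note rel = three_relations[OF ijk w]
  have c': "smul a (smul w (M2 0 0 1 0)) \<in> N" if "a \<in> Pser s" for a
    using that c by (rule scale_sub)
  have "smul w (M2 0 0 0 1) = smul w (M2 0 0 (\<tau> i + \<tau> j + \<tau> k) 1) - smul (\<tau> i + \<tau> j + \<tau> k) (smul w (M2 0 0 1 0))"
    "smul w (M2 0 1 0 0) = smul w (M2 0 1 (- (\<tau> i * \<tau> j + \<tau> i * \<tau> k + \<tau> j * \<tau> k)) 0)
        - smul (- (\<tau> i * \<tau> j + \<tau> i * \<tau> k + \<tau> j * \<tau> k)) (smul w (M2 0 0 1 0))"
    "smul w (M2 1 0 0 0) = smul w (M2 1 0 (\<tau> i * \<tau> j * \<tau> k) 0) - smul (\<tau> i * \<tau> j * \<tau> k) (smul w (M2 0 0 1 0))"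
    by (simp_all add: m2_eq_iff algebra_simps)
  moreover have "smul w (M2 0 0 (\<tau> i + \<tau> j + \<tau> k) 1) - smul (\<tau> i + \<tau> j + \<tau> k) (smul w (M2 0 0 1 0)) \<in> N"
    "smul w (M2 0 1 (- (\<tau> i * \<tau> j + \<tau> i * \<tau> k + \<tau> j * \<tau> k)) 0)
        - smul (- (\<tau> i * \<tau> j + \<tau> i * \<tau> k + \<tau> j * \<tau> k)) (smul w (M2 0 0 1 0)) \<in> N"
    "smul w (M2 1 0 (\<tau> i * \<tau> j * \<tau> k) 0) - smul (\<tau> i * \<tau> j * \<tau> k) (smul w (M2 0 0 1 0)) \<in> N"
    by (intro submod_diff[OF N] rel c'; simp)+
  ultimately show "smul w E \<in> N" using \<open>E \<in> m2_units\<close> c by (auto simp: m2_units_def)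
qed

text \<open>Eliminating the entries 1, t_l, t_l^2 of M_l by the three relations leaves in the corner
  the value at t_l of the cubic with roots t_i, t_j, t_k, a nonzero constant.\<close>

lemma kills_four:
  assumes ijk: "i < s" "j < s" "k < s" "i \<noteq> j" "i \<noteq> k" "j \<noteq> k" and l: "l < s" "l \<noteq> i" "l \<noteq> j" "l \<noteq> k"
  shows "kills (y i * y j * y k * y l)"
proof -
  let ?w = "y i * y j * y k * y l"
  note ys = y[OF ijk(1)] y[OF ijk(2)] y[OF ijk(3)] y[OF l(1)]
  have w: "smul ?w (M i) \<in> N" "smul ?w (M j) \<in> N" "smul ?w (M k) \<in> N" "smul ?w (M l) \<in> N"
    using scaled_M[OF ijk(1), of "y j * y k * y l"] scaled_M[OF ijk(2), of "y i * y k * y l"]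
      scaled_M[OF ijk(3), of "y i * y j * y l"] scaled_M[OF l(1), of "y i * y j * y k"] ys
    by (simp_all add: mult_ac)
  note rel = three_relations[OF ijk w(1-3)]
  have "smul (mconst ((t l - t i) * (t l - t j) * (t l - t k))) (smul ?w (M2 0 0 1 0))
    = smul ?w (M l) - smul ?w (M2 1 0 (\<tau> i * \<tau> j * \<tau> k) 0)
      - smul (\<tau> l) (smul ?w (M2 0 1 (- (\<tau> i * \<tau> j + \<tau> i * \<tau> k + \<tau> j * \<tau> k)) 0))
      - smul ((\<tau> l)\<^sup>2) (smul ?w (M2 0 0 (\<tau> i + \<tau> j + \<tau> k) 1))"
    by (simp add: m2_eq_iff mconst_hom curve_mat_def power2_eq_square power3_eq_cube algebra_simps)
  also have "\<dots> \<in> N"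
    by (intro submod_diff[OF N] w(4) rel(3) scale_sub[OF _ rel(1)] scale_sub[OF _ rel(2)]) simp_all
  finally have "smul ?w (M2 0 0 1 0) \<in> N"
    by (rule cancel) (use diff_neq ijk l in auto)
  then show ?thesis by (intro kills_of_corner[OF ijk w(1-3)]) (use ys in auto)
qed

lemma restrict_sum:
  assumes I: "I \<subseteq> {..<s}" and out: "\<And>l. l < s \<Longrightarrow> l \<notin> I \<Longrightarrow> smul (w * y l) E \<in> N"
    and c: "\<And>l. c l \<in> Pser s" and all: "smul (w * (\<Sum>l<s. c l * y l)) E \<in> N"
  shows "smul (w * (\<Sum>l\<in>I. c l * y l)) E \<in> N"
proof -
  have "(\<Sum>l<s. c l * y l) = (\<Sum>l\<in>I. c l * y l) + (\<Sum>l\<in>{..<s} - I. c l * y l)"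
    using sum.subset_diff[OF I, of "\<lambda>l. c l * y l"] by (simp add: add.commute)
  then have "smul (w * (\<Sum>l\<in>I. c l * y l)) E = smul (w * (\<Sum>l<s. c l * y l)) E - (\<Sum>l\<in>{..<s} - I. smul (c l) (smul (w * y l) E))"
    by (simp add: m2_eq_iff distrib_left distrib_right sum_distrib_left sum_distrib_right mult_ac)
  also have "\<dots> \<in> N"
    by (intro submod_diff[OF N] all submod_sum[OF N] scale_sub[OF c] out) auto
  finally show ?thesis .
qed

text \<open>Three matrices M leave a quotient generated by the corner unit. Right multiples of B
  show that its entries annihilate that generator up to w, and interpolation between the three
  points extracts y_i from them.\<close>

lemma kills_three:
  assumes ijk: "i < s" "j < s" "k < s" "i \<noteq> j" "i \<noteq> k" "j \<noteq> k"
  shows "kills (y i * y j * y k * y i)"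
proof -
  let ?w = "y i * y j * y k" and ?E = "M2 0 0 1 0 :: 'a mps m2"
  note ys = y[OF ijk(1)] y[OF ijk(2)] y[OF ijk(3)]
  have wP: "?w \<in> Pser s" using ys by simp
  have w: "smul ?w (M i) \<in> N" "smul ?w (M j) \<in> N" "smul ?w (M k) \<in> N"
    using scaled_M[OF ijk(1), of "y j * y k"] scaled_M[OF ijk(2), of "y i * y k"]
      scaled_M[OF ijk(3), of "y i * y j"] ys
    by (simp_all add: mult_ac)
  note rel = three_relations[OF ijk w]
  have wX: "smul ?w (B * X) \<in> N" if "X \<in> mats (Pser s)" for X
    using right[OF that] wP by (intro scale_sub)
  have BP: "B \<in> mats (Pser s)" using y by (intro mats_Pser_sum mats_Pser_closed) auto
  \<comment> \<open>With e1, e2, e3 the elementary symmetric functions, the two matrices reduce to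
    (q - e3 p) E and (e2 p - e1 q) E. As linear forms in p and q these have determinant e1 e3 - e2,
    which is \<open>net_disc\<close>.\<close>
  have col: "smul (?w * p) ?E \<in> N" "smul (?w * q) ?E \<in> N"
    if pq: "p \<in> Pser s" "q \<in> Pser s" "smul ?w (M2 p 0 q 0) \<in> N" "smul ?w (M2 0 p 0 q) \<in> N" for p q
  proof -
    let ?e1 = "\<tau> i + \<tau> j + \<tau> k" and ?e2 = "\<tau> i * \<tau> j + \<tau> i * \<tau> k + \<tau> j * \<tau> k" and ?e3 = "\<tau> i * \<tau> j * \<tau> k"
    have "smul (?w * (q - ?e3 * p)) ?E = smul ?w (M2 p 0 q 0) - smul p (smul ?w (M2 1 0 ?e3 0))"
      by (simp add: m2_eq_iff algebra_simps)
    also have "\<dots> \<in> N" by (intro submod_diff[OF N] pq(3) scale_sub[OF pq(1) rel(3)])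
    finally have 1: "smul (?w * (q - ?e3 * p)) ?E \<in> N" .
    have "smul (?w * (?e2 * p - ?e1 * q)) ?E
      = smul ?w (M2 0 p 0 q) - smul p (smul ?w (M2 0 1 (- ?e2) 0)) - smul q (smul ?w (M2 0 0 ?e1 1))"
      by (simp add: m2_eq_iff algebra_simps)
    also have "\<dots> \<in> N" by (intro submod_diff[OF N] pq(4) scale_sub[OF pq(1) rel(2)] scale_sub[OF pq(2) rel(1)])
    finally have 2: "smul (?w * (?e2 * p - ?e1 * q)) ?E \<in> N" .
    have "smul (mconst (net_disc (t i) (t j) (t k))) (smul (?w * p) ?E)
      = smul (- 1) (smul ?e1 (smul (?w * (q - ?e3 * p)) ?E) + smul (?w * (?e2 * p - ?e1 * q)) ?E)"
      by (simp add: m2_eq_iff net_disc_def mconst_hom algebra_simps)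
    also have "\<dots> \<in> N" by (intro scale_sub submod_add[OF N] 1 2) simp_all
    finally show p: "smul (?w * p) ?E \<in> N"
      by (rule cancel) (use gen ijk in \<open>simp add: generic_points_def\<close>)
    have "smul (?w * q) ?E = smul (?w * (q - ?e3 * p)) ?E + smul ?e3 (smul (?w * p) ?E)"
      by (simp add: m2_eq_iff algebra_simps)
    also have "\<dots> \<in> N" by (intro submod_add[OF N] 1 scale_sub[OF _ p]) simp
    finally show "smul (?w * q) ?E \<in> N" .
  qed
  \<comment> \<open>Right multiplication by a matrix unit puts a chosen column of B into a chosen
    column, the two shapes that \<open>col\<close> requires.\<close>
  have BX: "B * M2 1 0 0 0 = M2 (e00 B) 0 (e10 B) 0" "B * M2 0 1 0 0 = M2 0 (e00 B) 0 (e10 B)"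
    "B * M2 0 0 1 0 = M2 (e01 B) 0 (e11 B) 0" "B * M2 0 0 0 1 = M2 0 (e01 B) 0 (e11 B)"
    by (simp_all add: m2_eq_iff del: m2_sum_sel)
  have unit_Pser: "(M2 1 0 0 0 :: 'a mps m2) \<in> mats (Pser s)" "(M2 0 1 0 0 :: 'a mps m2) \<in> mats (Pser s)"
     "?E \<in> mats (Pser s)" "(M2 0 0 0 1 :: 'a mps m2) \<in> mats (Pser s)"
    by (simp_all add: mats_def)
  note wB = wX[OF unit_Pser(1)] wX[OF unit_Pser(2)] wX[OF unit_Pser(3)] wX[OF unit_Pser(4)]
  have entries: "smul (?w * e00 B) ?E \<in> N" "smul (?w * e01 B) ?E \<in> N" "smul (?w * e11 B) ?E \<in> N"
    using col[of "e00 B" "e10 B"] col[of "e01 B" "e11 B"] wB BP unfolding BX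
    by (simp_all add: mats_def del: m2_sum_sel)
  have four: "smul (?w * y l) ?E \<in> N" if "l < s" "l \<notin> {i, j, k}" for l
    using kills_four[OF ijk that(1)] that(2) unit_Pser by (simp add: kills_def)
  \<comment> \<open>The entries 1, a, a^2 of the curve make three entries of B the power sums for n
    = 0, 1, 2; \<open>kills_four\<close> removes the indices outside {i, j, k}.\<close>
  have moments: "smul (?w * (\<Sum>l\<in>{i, j, k}. (\<tau> l) ^ n * y l)) ?E \<in> N" if "n < 3" for n
  proof (rule restrict_sum)
    have "e00 B = (\<Sum>l<s. (\<tau> l) ^ 0 * y l)" "e01 B = (\<Sum>l<s. (\<tau> l) ^ 1 * y l)" "e11 B = (\<Sum>l<s. (\<tau> l) ^ 2 * y l)"
      by (simp_all add: curve_mat_def mult.commute)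
    moreover have "n = 0 \<or> n = 1 \<or> n = 2" using that by auto
    ultimately show "smul (?w * (\<Sum>l<s. (\<tau> l) ^ n * y l)) ?E \<in> N"
      using entries by (elim disjE) (simp_all only:)
  qed (use ijk four in auto)
  have m: "smul (?w * (y i + y j + y k)) ?E \<in> N" "smul (?w * (\<tau> i * y i + \<tau> j * y j + \<tau> k * y k)) ?E \<in> N"
    "smul (?w * ((\<tau> i)\<^sup>2 * y i + (\<tau> j)\<^sup>2 * y j + (\<tau> k)\<^sup>2 * y k)) ?E \<in> N"
    using moments[of 0] moments[of 1] moments[of 2] ijk by (simp_all add: add.assoc)
  \<comment> \<open>The coefficients are those of (T - t_j) (T - t_k), which vanishes at t_j and t_k
    and thus isolates y_i.\<close>
  have "smul (mconst ((t i - t j) * (t i - t k))) (smul (?w * y i) ?E)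
    = smul (\<tau> j * \<tau> k) (smul (?w * (y i + y j + y k)) ?E)
      - smul (\<tau> j + \<tau> k) (smul (?w * (\<tau> i * y i + \<tau> j * y j + \<tau> k * y k)) ?E)
      + smul (?w * ((\<tau> i)\<^sup>2 * y i + (\<tau> j)\<^sup>2 * y j + (\<tau> k)\<^sup>2 * y k)) ?E"
    by (simp add: m2_eq_iff mconst_hom power2_eq_square algebra_simps)
  also have "\<dots> \<in> N"
    by (intro submod_add[OF N] submod_diff[OF N] m(3) scale_sub[OF _ m(1)] scale_sub[OF _ m(2)]) simp_all
  finally have c: "smul (?w * y i) ?E \<in> N"
    by (rule cancel) (use diff_neq ijk in auto)
  have w': "smul (?w * y i) (M l) \<in> N" if "smul ?w (M l) \<in> N" for l
    using scale_sub[OF ys(1) that] by (simp add: mult_ac)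
  show ?thesis
    by (rule kills_of_corner[OF ijk w'[OF w(1)] w'[OF w(2)] w'[OF w(3)] _ c]) (use ys in simp)
qed

text \<open>Once w annihilates the unwanted summands, multiples of the whole of B can be replaced by
  multiples of a pencil or of a single summand.\<close>

lemma restrict_B:
  assumes I: "I \<subseteq> {..<s}" and w: "w \<in> Pser s" and out: "\<And>l. l < s \<Longrightarrow> l \<notin> I \<Longrightarrow> kills (w * y l)"
    and X: "X \<in> mats (Pser s)"
  shows "smul w ((\<Sum>l\<in>I. smul (y l) (M l)) * X) \<in> N" "smul w (X * (\<Sum>l\<in>I. smul (y l) (M l))) \<in> N"
proof -
  have split: "B = (\<Sum>l\<in>I. smul (y l) (M l)) + (\<Sum>l\<in>{..<s} - I. smul (y l) (M l))"
    using sum.subset_diff[OF I, of "\<lambda>l. smul (y l) (M l)"] by (simp add: add.commute)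
  have "smul w ((\<Sum>l\<in>I. smul (y l) (M l)) * X) = smul w (B * X) - (\<Sum>l\<in>{..<s} - I. smul (w * y l) (M l * X))"
    unfolding split by (simp add: distrib_right sum_distrib_right smul_add smul_sum)
  also have "\<dots> \<in> N"
    by (intro submod_diff[OF N] submod_sum[OF N] scale_sub[OF w] right X)
       (use out X in \<open>auto simp: kills_def\<close>)
  finally show "smul w ((\<Sum>l\<in>I. smul (y l) (M l)) * X) \<in> N" .
  have "smul w (X * (\<Sum>l\<in>I. smul (y l) (M l))) = smul w (X * B) - (\<Sum>l\<in>{..<s} - I. smul (w * y l) (X * M l))"
    unfolding split by (simp add: distrib_left sum_distrib_left smul_add smul_sum)
  also have "\<dots> \<in> N"
    by (intro submod_diff[OF N] submod_sum[OF N] scale_sub[OF w] left X)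
       (use out X in \<open>auto simp: kills_def\<close>)
  finally show "smul w (X * (\<Sum>l\<in>I. smul (y l) (M l))) \<in> N" .
qed

text \<open>Up to w = y_i^2 y_j only the pencil y_i M_i + y_j M_j is left of B. The adjugate of M_i
  turns it into \<delta> y_i + y_j S, so left and right multiples differ by commutators with S. This
  gives y_i^2 y_j^2 first, and then y_i^3 y_j.\<close>

lemma kills_two:
  assumes ij: "i < s" "j < s" "i \<noteq> j"
  shows "kills (y i ^ 3 * y j)"
proof -
  let ?w = "y i * y i * y j"
  note ys = y[OF ij(1)] y[OF ij(2)]
  have wP: "?w \<in> Pser s" using ys by simp
  have "kills (?w * y l)" if "l < s" "l \<notin> {i, j}" for l
    using kills_three[of i j l] ij that by (simp add: mult_ac)
  then have LR: "smul ?w ((smul (y i) (M i) + smul (y j) (M j)) * X) \<in> N"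
    "smul ?w (X * (smul (y i) (M i) + smul (y j) (M j))) \<in> N" if "X \<in> mats (Pser s)" for X
    using restrict_B[of "{i, j}" ?w X] ij wP that by auto
  \<comment> \<open>S is M_i^-1 M_j up to the constant \<delta>. Its trace and determinant give
    exactly the discriminant of det (x M_i + y M_j).\<close>
  define S where "S = madj (M i) * M j"
  let ?\<delta> = "mdet (M i)"
  have S: "S \<in> mats (Pser s)" unfolding S_def by (intro mats_Pser_closed) simp_all
  have MS: "M i * S = smul ?\<delta> (M j)"
    by (simp add: S_def madj_mult flip: mult.assoc)
  \<comment> \<open>Multiplying from the left by M_i Z adj(M_i) and from the right by \<delta> Z
    produces the same y_i term; subtraction leaves the commutator with y_j.\<close>
  have comm: "smul (?w * y j) (M i * (Z * S - S * Z)) \<in> N" if Z: "Z \<in> mats (Pser s)" for Z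
  proof -
    have 1: "smul ?w ((M i * Z * madj (M i)) * (smul (y i) (M i) + smul (y j) (M j))) \<in> N"
      using Z by (intro LR(2)) simp
    have 2: "smul ?\<delta> (smul ?w ((smul (y i) (M i) + smul (y j) (M j)) * Z)) \<in> N"
      using Z by (intro scale_sub LR(1)) (simp_all add: mdet_curve_mat)
    have e1: "smul ?w ((M i * Z * madj (M i)) * (smul (y i) (M i) + smul (y j) (M j)))
      = smul (?w * y i * ?\<delta>) (M i * Z) + smul (?w * y j) (M i * Z * S)"
      by (simp add: distrib_left smul_add mult.assoc madj_mult S_def)
    have e2: "smul ?\<delta> (smul ?w ((smul (y i) (M i) + smul (y j) (M j)) * Z))
      = smul (?w * y i * ?\<delta>) (M i * Z) + smul (?w * y j) (M i * S * Z)"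
      by (simp add: distrib_right smul_add MS mult_ac)
    have "smul (?w * y j) (M i * (Z * S - S * Z)) =
      smul ?w ((M i * Z * madj (M i)) * (smul (y i) (M i) + smul (y j) (M j)))
      - smul ?\<delta> (smul ?w ((smul (y i) (M i) + smul (y j) (M j)) * Z))"
      unfolding e1 e2 by (simp add: m2_eq_iff algebra_simps)
    then show ?thesis using submod_diff[OF N 1 2] by simp
  qed
  have scalars: "smul (?w * y j) (M i) \<in> N" "smul (?w * y j) (M i * S) \<in> N"
    using scaled_M[OF ij(1), of "y i * y j * y j"] scaled_M[OF ij(2), of "?w * ?\<delta>"] ys
    by (simp_all add: mult_ac MS mdet_curve_mat)
  let ?disc = "(e00 S + e11 S)\<^sup>2 - 4 * mdet S"
  have disc: "?disc = mconst (pencil_disc (t i) (t j))"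
    by (simp add: S_def mdet_def madj_def curve_mat_def pencil_disc_def mconst_hom power_numeral_reduce algebra_simps)
  have killj: "kills (?w * y j)"
    unfolding kills_def
  proof
    fix X :: "'a mps m2" assume X: "X \<in> mats (Pser s)"
    \<comment> \<open>With this Z the product M_i Z is \<delta> X, so
      \<open>double_commutator\<close> for Z reaches an arbitrary X after the constants are
      cancelled.\<close>
    define Z where "Z = madj (M i) * X"
    have Z: "Z \<in> mats (Pser s)" using X by (simp add: Z_def)
    obtain a b where ab: "smul ?disc Z = (Z * S - S * Z) * S - S * (Z * S - S * Z) - smul a S - smul b 1"
      "a \<in> Pser s" "b \<in> Pser s"
    proof
      show "smul ?disc Z = (Z * S - S * Z) * S - S * (Z * S - S * Z)
          - smul ((e00 S + e11 S) * (e00 Z + e11 Z) - 2 * (e00 (Z * S) + e11 (Z * S))) S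
          - smul ((e00 S + e11 S) * ((e00 (Z * S) + e11 (Z * S)) - (e00 Z + e11 Z) * (e00 S + e11 S)) + 2 * mdet S * (e00 Z + e11 Z)) 1"
        by (rule double_commutator)
      have num: "(2 :: 'a mps) \<in> Pser s" using Pser_mpmon[OF evecs_zero, of 2 s] by (simp only: mconst_hom)
      show "(e00 S + e11 S) * (e00 Z + e11 Z) - 2 * (e00 (Z * S) + e11 (Z * S)) \<in> Pser s"
        "(e00 S + e11 S) * ((e00 (Z * S) + e11 (Z * S)) - (e00 Z + e11 Z) * (e00 S + e11 S)) + 2 * mdet S * (e00 Z + e11 Z) \<in> Pser s"
        using S Z num by (simp_all add: mats_def mdet_def)
    qed
    have "smul ?disc (smul ?\<delta> (smul (?w * y j) X)) = smul (?w * y j) (M i * smul ?disc Z)"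
      by (simp add: Z_def madj_mult mult_ac flip: mult.assoc[of _ "madj _"])
    also have "\<dots> = smul (?w * y j) (M i * ((Z * S - S * Z) * S - S * (Z * S - S * Z)))
        - smul a (smul (?w * y j) (M i * S)) - smul b (smul (?w * y j) (M i))"
      unfolding ab(1) by (simp add: m2_eq_iff algebra_simps)
    also have "\<dots> \<in> N"
      by (intro submod_diff[OF N] comm scale_sub[OF ab(2) scalars(2)] scale_sub[OF ab(3) scalars(1)])
         (use S Z in simp)
    finally have "smul ?\<delta> (smul (?w * y j) X) \<in> N"
      unfolding disc by (rule cancel) (use gen ij in \<open>simp add: generic_points_def\<close>)
    then show "smul (?w * y j) X \<in> N" by (rule cancel_det[OF ij(1)])
  qed
  show ?thesis
    unfolding kills_def
  proof
    fix X :: "'a mps m2" assume X: "X \<in> mats (Pser s)"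
    \<comment> \<open>The left multiple by X adj(M_i) has the two terms \<delta> y_i X and y_j X S;
      the second is already annihilated by \<open>killj\<close>.\<close>
    have "smul ?\<delta> (smul (y i ^ 3 * y j) X)
      = smul ?w ((X * madj (M i)) * (smul (y i) (M i) + smul (y j) (M j))) - smul (?w * y j) (X * S)"
      by (simp add: distrib_left smul_add mult.assoc madj_mult S_def power3_eq_cube mult_ac)
    also have "\<dots> \<in> N"
      by (intro submod_diff[OF N] LR(2)) (use killj X S in \<open>simp_all add: kills_def\<close>)
    finally show "smul (y i ^ 3 * y j) X \<in> N" by (rule cancel_det[OF ij(1)])
  qed
qed

text \<open>By \<open>kills_two\<close> the factor y_i^3 leaves only y_i M_i of B, and the adjugate
  reduces M_i to a nonzero constant.\<close>

lemma kills_one: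
  assumes i: "i < s"
  shows "kills (y i ^ 4)"
  unfolding kills_def
proof
  fix X :: "'a mps m2" assume X: "X \<in> mats (Pser s)"
  have "smul (y i ^ 3) ((\<Sum>l\<in>{i}. smul (y l) (M l)) * (madj (M i) * X)) \<in> N"
    by (rule restrict_B) (use i X y kills_two in auto)
  also have "smul (y i ^ 3) ((\<Sum>l\<in>{i}. smul (y l) (M l)) * (madj (M i) * X)) = smul (mdet (M i)) (smul (y i ^ 4) X)"
    by (simp add: madj_mult power_numeral_reduce mult_ac flip: mult.assoc[of _ "madj _"])
  finally show "smul (y i ^ 4) X \<in> N" by (rule cancel_det[OF i])
qed

end

section \<open>The form with summands x_i^n M_i as a high order perturbation\<close>

definition fermat_mat :: "nat \<Rightarrow> nat \<Rightarrow> (nat \<Rightarrow> 'a) \<Rightarrow> 'a::comm_ring_1 mps m2" where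
  "fermat_mat s n t = (\<Sum>i<s. smul (mvar i ^ n) (curve_mat (mconst (t i))))"

lemma fermat_mat_Pser: "fermat_mat s n t \<in> mats (Pser s)"
  unfolding fermat_mat_def
  by (intro mats_Pser_sum mats_Pser_closed) (auto simp: curve_mat_def mats_def)

lemma fermat_mat_homog: "fermat_mat s n t \<in> mats (homog n)"
proof -
  have 1: "mvar i ^ n * mconst c \<in> homog n" for i and c :: 'a
    by (auto simp: mvar_power mpmon_mult homog_def mps_nth_mpmon)
  have "(\<Sum>i\<in>I. mvar i ^ n * mconst (c i)) \<in> homog n" for I :: "nat set" and c :: "nat \<Rightarrow> 'a"
    using 1 by (simp add: homog_def)
  from this[of "\<lambda>_. 1"] this[of t] this[of "\<lambda>i. t i ^ 3"] this[of "\<lambda>i. (t i)\<^sup>2"] show ?thesis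
    by (simp add: fermat_mat_def mats_def curve_mat_def mconst_hom)
qed

text \<open>Each variable occurs in one summand only, so differentiation isolates it. The factor x_i
  restores the exponent n and puts the product into the tangent module, which has only m-multiples
  of derivatives.\<close>

lemma mderiv_fermat_mat:
  assumes "i < s" "0 < n"
  shows "smul (mvar i) (map_m2 (mderiv i) (fermat_mat s n t)) = smul (of_nat n * mvar i ^ n) (curve_mat (mconst (t i)))"
proof -
  have 1: "mderiv i (mvar l ^ n * mconst c) = (if l = i then of_nat n * mvar i ^ (n - 1) * mconst c else 0)"
    for l and c :: 'a
    by (simp add: mderiv_mult mderiv_power mderiv_var)
  have 2: "mvar i * mderiv i (\<Sum>l<s. mvar l ^ n * mconst (c l)) = of_nat n * mvar i ^ n * mconst (c i)" for c :: "nat \<Rightarrow> 'a"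
  proof -
    have "mvar i * mderiv i (\<Sum>l<s. mvar l ^ n * mconst (c l))
      = mvar i * (\<Sum>l<s. if l = i then of_nat n * mvar i ^ (n - 1) * mconst (c l) else 0)"
      by (simp only: mderiv_sum 1)
    also have "\<dots> = of_nat n * (mvar i ^ (n - 1) * mvar i) * mconst (c i)"
      using assms(1) by (simp add: mult_ac)
    finally show ?thesis using assms(2) by (simp only: power_minus_mult)
  qed
  from 2[of "\<lambda>_. 1"] 2[of t] 2[of "\<lambda>i. t i ^ 3"] 2[of "\<lambda>i. (t i)\<^sup>2"] show ?thesis
    by (simp add: fermat_mat_def m2_eq_iff curve_mat_def mconst_hom)
qed

lemma fermat_mat_finite_codim:
  fixes t :: "nat \<Rightarrow> 'a::field"
  assumes gen: "generic_points s t" and n: "0 < n" "(of_nat n :: 'a) \<noteq> 0"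
  shows "\<exists>D. mats (Pser s) \<inter> mats (ordge D) \<subseteq> tmod s (fermat_mat s n t)"
proof -
  interpret fermat_pencil s "\<lambda>i. mvar i ^ n" t "tmod s (fermat_mat s n t)"
  proof
    fix i assume i: "i < s"
    have "smul (mvar i) (map_m2 (mderiv i) (fermat_mat s n t)) \<in> tmod s (fermat_mat s n t)"
      using i by (intro tmod_contains_deriv) auto
    then have "smul (mconst (of_nat n)) (smul (mvar i ^ n) (curve_mat (mconst (t i)))) \<in> tmod s (fermat_mat s n t)"
      unfolding mderiv_fermat_mat[OF i n(1)] by (simp add: mconst_of_nat)
    then show "smul (mvar i ^ n) (curve_mat (mconst (t i))) \<in> tmod s (fermat_mat s n t)"
      by (rule submod_cancel_const[OF submod_tmod n(2)])
  qed (use gen tmod_contains in \<open>auto simp: submod_tmod simp flip: fermat_mat_def\<close>)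
  show ?thesis
  proof (rule ordge_in_submod[OF submod_tmod])
    fix i and E :: "'a mps m2" assume "i < s" "E \<in> m2_units"
    then have "smul ((mvar i ^ n) ^ 4) E \<in> tmod s (fermat_mat s n t)"
      using kills_one by (auto simp: kills_def m2_units_def mats_def)
    then show "\<exists>a. smul (mvar i ^ a) E \<in> tmod s (fermat_mat s n t)" by (metis power_mult)
  qed
qed

lemma ex_finite_codim_perturbation:
  fixes A :: "'a::field mps m2"
  assumes inf: "infinite (UNIV :: 'a set)" and A: "A \<in> mats (Pser s)"
  shows "\<exists>B m. B \<in> mats (Pser s) \<and> B - A \<in> mats (ordge (Suc k)) \<and> mats (Pser s) \<inter> mats (ordge m) \<subseteq> tmod s B"
proof -
  obtain t :: "nat \<Rightarrow> 'a" where t: "generic_points s t" using ex_generic_points[OF inf] by blast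
  \<comment> \<open>The two numbers differ by 1, so they cannot both vanish in K.\<close>
  have "(of_nat (k + 1) :: 'a) \<noteq> 0 \<or> (of_nat (k + 2) :: 'a) \<noteq> 0"
  proof (rule ccontr)
    assume "\<not> ?thesis"
    then have "(of_nat (k + 2) :: 'a) - of_nat (k + 1) = 0" by (simp only: de_Morgan_disj not_not) simp
    then show False by simp
  qed
  then obtain n where n: "k < n" "(of_nat n :: 'a) \<noteq> 0"
    by (metis add_2_eq_Suc' add.commute less_add_Suc1 less_Suc_eq plus_1_eq_Suc)
  \<comment> \<open>Since n exceeds k, cutting A off above degree k makes the added form the top
    degree part and changes A only in order above k.\<close>
  define A' where "A' = map_m2 (trunc s k) A"
  have A'P: "A' \<in> mats (Pser s)" by (simp add: A'_def mats_def)
  have "trunc s k f \<in> degless n" for f :: "'a mps" using n by (simp add: degless_def mps_nth_trunc)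
  then have A'd: "A' \<in> mats (degless n)" by (simp add: A'_def mats_def)
  have "A - A' \<in> mats (ordge (Suc k))" using A trunc_ordge by (auto simp: A'_def mats_def)
  moreover have "fermat_mat s n t \<in> mats (ordge (Suc k))"
    using fermat_mat_homog[of s n t] homog_ordge[of _ n "Suc k"] n by (auto simp: mats_def)
  ultimately have "fermat_mat s n t - (A - A') \<in> mats (ordge (Suc k))" by (rule mats_ordge_closed(3)[rotated])
  then have "(A' + fermat_mat s n t) - A \<in> mats (ordge (Suc k))" by (simp add: algebra_simps)
  moreover obtain D where D: "mats (Pser s) \<inter> mats (ordge D) \<subseteq> tmod s (fermat_mat s n t)"
    using fermat_mat_finite_codim[OF t _ n(2)] n by auto
  moreover obtain m where "mats (Pser s) \<inter> mats (ordge m) \<subseteq> tmod s (A' + fermat_mat s n t)"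
    using finite_codim_of_top_forms[OF A'P A'd fermat_mat_Pser fermat_mat_homog _ D] n by auto
  moreover have "A' + fermat_mat s n t \<in> mats (Pser s)" by (intro mats_Pser_closed(3) A'P fermat_mat_Pser)
  ultimately show ?thesis by blast
qed

section \<open>Translation of coefficient functions\<close>

definition of_ps :: "'a ps \<Rightarrow> 'a mps" where
  "of_ps f = Mps (\<lambda>\<alpha>. f (lookup \<alpha>))"

text \<open>\<open>Abs_poly_mapping\<close> is meaningful only for finite support. The value 0
  elsewhere agrees with \<open>PS s\<close>, whose members vanish at such exponents.\<close>

definition to_ps :: "'a::zero mps \<Rightarrow> 'a ps" where
  "to_ps f = (\<lambda>a. if finite {i. a i \<noteq> 0} then mps_nth f (Abs_poly_mapping a) else 0)"

lemma mps_nth_of_ps: "mps_nth (of_ps f) \<alpha> = f (lookup \<alpha>)"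
  by (simp add: of_ps_def)

lemma of_ps_to_ps [simp]: "of_ps (to_ps f) = f"
  by (rule mps_eqI) (simp add: mps_nth_of_ps to_ps_def lookup_inverse)

lemma expvecs_finite:
  assumes "a \<in> expvecs s"
  shows "finite {i. a i \<noteq> 0}"
proof (rule finite_subset)
  have "i < s" if "a i \<noteq> 0" for i
    using that assms by (cases "i < s") (auto simp: expvecs_def)
  then show "{i. a i \<noteq> 0} \<subseteq> {..<s}" by auto
qed simp

lemma lookup_expvecs: "lookup \<alpha> \<in> expvecs s \<longleftrightarrow> \<alpha> \<in> evecs s"
  by (simp add: expvecs_def evecs_iff)

lemma to_ps_of_ps [simp]: "f \<in> PS s \<Longrightarrow> to_ps (of_ps f) = f"
  using expvecs_finite[of _ s] by (fastforce simp: to_ps_def mps_nth_of_ps PS_def)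

lemma of_ps_Pser [simp]: "f \<in> PS s \<Longrightarrow> of_ps f \<in> Pser s"
  by (auto simp: PS_def Pser_def mps_nth_of_ps lookup_expvecs)

lemma to_ps_PS [simp]:
  assumes "f \<in> Pser s"
  shows "to_ps f \<in> PS s"
  unfolding PS_def
proof (intro CollectI allI impI)
  fix a assume "a \<notin> expvecs s"
  then show "to_ps f a = 0"
    using assms lookup_expvecs[of "Abs_poly_mapping a" s] by (auto simp: to_ps_def PserD)
qed

lemma of_ps_inj: "f \<in> PS s \<Longrightarrow> g \<in> PS s \<Longrightarrow> of_ps f = of_ps g \<Longrightarrow> f = g"
  by (metis to_ps_of_ps)

lemma PS_closed [simp]:
  "ps_zero \<in> PS s" "ps_const c \<in> PS s" "ps_one \<in> PS s" "i < s \<Longrightarrow> ps_X i \<in> PS s"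
  by (auto simp: PS_def ps_zero_def ps_const_def ps_one_def ps_X_def expvecs_def)

lemma PS_add [simp]: "f \<in> PS s \<Longrightarrow> g \<in> PS s \<Longrightarrow> ps_add f g \<in> PS s" for f :: "'a::comm_ring_1 ps"
  by (simp add: PS_def ps_add_def)

lemma PS_sub [simp]: "f \<in> PS s \<Longrightarrow> g \<in> PS s \<Longrightarrow> ps_sub f g \<in> PS s" for f :: "'a::comm_ring_1 ps"
  by (simp add: PS_def ps_sub_def)

lemma PS_mult [simp]:
  fixes f :: "'a::comm_ring_1 ps"
  assumes "f \<in> PS s" "g \<in> PS s"
  shows "ps_mult f g \<in> PS s"
  unfolding PS_def
proof (intro CollectI allI impI)
  fix a :: "nat \<Rightarrow> nat" assume a: "a \<notin> expvecs s"
  show "ps_mult f g a = 0" unfolding ps_mult_def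
  proof (intro sum.neutral ballI)
    fix b assume b: "b \<in> {b. \<forall>i. b i \<le> a i}"
    show "f b * g (\<lambda>i. a i - b i) = 0"
    proof (cases "b \<in> expvecs s \<and> (\<lambda>i. a i - b i) \<in> expvecs s")
      case True
      then have "a \<in> expvecs s" using b by (fastforce simp: expvecs_def)
      with a show ?thesis by simp
    next
      case False
      then show ?thesis using assms by (auto simp: PS_def)
    qed
  qed
qed

lemma PS_deriv [simp]: "f \<in> PS s \<Longrightarrow> ps_deriv \<nu> f \<in> PS s" for f :: "'a::comm_ring_1 ps"
proof -
  assume f: "f \<in> PS s"
  have "\<alpha> \<in> expvecs s" if "\<alpha>(\<nu> := \<alpha> \<nu> + 1) \<in> expvecs s" for \<alpha>
  proof -
    have "\<alpha> i = 0" if "s \<le> i" for i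
      using that \<open>\<alpha>(\<nu> := \<alpha> \<nu> + 1) \<in> expvecs s\<close> by (cases "i = \<nu>") (auto simp: expvecs_def split: if_splits)
    then show ?thesis by (simp add: expvecs_def)
  qed
  then have "f (\<alpha>(\<nu> := \<alpha> \<nu> + 1)) = 0" if "\<alpha> \<notin> expvecs s" for \<alpha>
    using that f unfolding PS_def by blast
  then show ?thesis by (simp add: PS_def ps_deriv_def)
qed

lemma PS_sum [simp]: "(\<And>x. x \<in> F \<Longrightarrow> f x \<in> PS s) \<Longrightarrow> (\<lambda>\<alpha>. \<Sum>x\<in>F. f x \<alpha>) \<in> PS s" for f :: "'i \<Rightarrow> 'a::comm_ring_1 ps"
  by (auto simp: PS_def intro!: sum.neutral)

lemma of_ps_zero [simp]: "of_ps ps_zero = 0"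
  by (rule mps_eqI) (simp add: mps_nth_of_ps ps_zero_def)

lemma lookup_eq_zero_fun: "lookup \<alpha> = (\<lambda>_. 0) \<longleftrightarrow> \<alpha> = 0"
  by (metis lookup_inject lookup_zero ext)

lemma of_ps_const [simp]: "of_ps (ps_const c) = mconst c"
  by (rule mps_eqI) (simp add: mps_nth_of_ps ps_const_def mps_nth_mpmon lookup_eq_zero_fun)

lemma of_ps_one [simp]: "of_ps ps_one = 1"
  by (simp add: ps_one_def mpmon_0_1)

lemma of_ps_add [simp]: "of_ps (ps_add f g) = of_ps f + of_ps g"
  by (rule mps_eqI) (simp add: mps_nth_of_ps ps_add_def)

lemma of_ps_sub [simp]: "of_ps (ps_sub f g) = of_ps f - of_ps g"
  by (rule mps_eqI) (simp add: mps_nth_of_ps ps_sub_def)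

lemma of_ps_sum [simp]: "of_ps (\<lambda>\<alpha>. \<Sum>x\<in>F. f x \<alpha>) = (\<Sum>x\<in>F. of_ps (f x))"
  by (rule mps_eqI) (simp add: mps_nth_of_ps)

lemma of_ps_X [simp]: "of_ps (ps_X i) = mvar i"
proof (rule mps_eqI)
  fix \<alpha> :: "nat \<Rightarrow>\<^sub>0 nat"
  have "(\<lambda>j. if j = i then 1 else 0) = lookup (single i (1 :: nat))"
    by (auto simp: fun_eq_iff lookup_single when_def)
  then show "mps_nth (of_ps (ps_X i)) \<alpha> = mps_nth (mvar i :: 'a mps) \<alpha>"
    by (simp add: mps_nth_of_ps ps_X_def mvar_def mps_nth_mpmon lookup_inject)
qed

lemma of_ps_deriv [simp]: "of_ps (ps_deriv \<nu> f) = mderiv \<nu> (of_ps f)"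
proof (rule mps_eqI)
  fix \<alpha> :: "nat \<Rightarrow>\<^sub>0 nat"
  have "(lookup \<alpha>)(\<nu> := lookup \<alpha> \<nu> + 1) = lookup (\<alpha> + single \<nu> 1)"
    by (auto simp: fun_eq_iff lookup_add lookup_single when_def)
  then show "mps_nth (of_ps (ps_deriv \<nu> f)) \<alpha> = mps_nth (mderiv \<nu> (of_ps f)) \<alpha>"
    by (simp add: mps_nth_of_ps ps_deriv_def mps_nth_mderiv)
qed

text \<open>A function bounded by a finitely supported exponent is finitely supported itself, so
  both index sets of the convolution correspond.\<close>

lemma of_ps_mult [simp]: "of_ps (ps_mult f g) = of_ps f * of_ps g" for f :: "'a::comm_ring_1 ps"
proof (rule mps_eqI)
  fix \<gamma> :: "nat \<Rightarrow>\<^sub>0 nat"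
  have fin: "finite {i. b i \<noteq> 0}" if "\<forall>i. b i \<le> lookup \<gamma> i" for b :: "nat \<Rightarrow> nat"
  proof (rule finite_subset[OF _ finite_keys[of \<gamma>]])
    have "i \<in> keys \<gamma>" if "b i \<noteq> 0" for i
      using that \<open>\<forall>i. b i \<le> lookup \<gamma> i\<close> by (metis in_keys_iff le_zero_eq)
    then show "{i. b i \<noteq> 0} \<subseteq> keys \<gamma>" by auto
  qed
  have "(\<Sum>b | \<forall>i. b i \<le> lookup \<gamma> i. f b * g (\<lambda>i. lookup \<gamma> i - b i))
    = (\<Sum>(\<alpha>, \<beta>)\<in>decomps \<gamma>. f (lookup \<alpha>) * g (lookup \<beta>))"
  proof (rule sum.reindex_bij_witness[where i = "\<lambda>(\<alpha>, \<beta>). lookup \<alpha>"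
        and j = "\<lambda>b. (Abs_poly_mapping b, Abs_poly_mapping (\<lambda>i. lookup \<gamma> i - b i))"])
    fix b assume "b \<in> {b. \<forall>i. b i \<le> lookup \<gamma> i}"
    then have b: "\<forall>i. b i \<le> lookup \<gamma> i" by simp
    have [simp]: "lookup (Abs_poly_mapping b) = b" using fin[OF b] by simp
    have [simp]: "lookup (Abs_poly_mapping (\<lambda>i. lookup \<gamma> i - b i)) = (\<lambda>i. lookup \<gamma> i - b i)"
      using fin[of "\<lambda>i. lookup \<gamma> i - b i"] by simp
    show "(case (Abs_poly_mapping b, Abs_poly_mapping (\<lambda>i. lookup \<gamma> i - b i)) of (\<alpha>, \<beta>) \<Rightarrow> lookup \<alpha>) = b"
      by simp
    show "(Abs_poly_mapping b, Abs_poly_mapping (\<lambda>i. lookup \<gamma> i - b i)) \<in> decomps \<gamma>"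
      using b by (auto intro!: poly_mapping_eqI simp: lookup_add)
    show "(case (Abs_poly_mapping b, Abs_poly_mapping (\<lambda>i. lookup \<gamma> i - b i)) of (\<alpha>, \<beta>) \<Rightarrow> f (lookup \<alpha>) * g (lookup \<beta>))
      = f b * g (\<lambda>i. lookup \<gamma> i - b i)" by simp
  next
    fix p assume "p \<in> decomps \<gamma>"
    then obtain \<alpha> \<beta> where p: "p = (\<alpha>, \<beta>)" "\<gamma> = \<alpha> + \<beta>" by (auto simp: decomps_def)
    have "(\<lambda>i. lookup \<gamma> i - lookup \<alpha> i) = lookup \<beta>" by (simp add: p lookup_add)
    then show "(Abs_poly_mapping (case p of (\<alpha>, \<beta>) \<Rightarrow> lookup \<alpha>),
        Abs_poly_mapping (\<lambda>i. lookup \<gamma> i - (case p of (\<alpha>, \<beta>) \<Rightarrow> lookup \<alpha>) i)) = p"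
      by (simp add: p(1) lookup_inverse)
    show "(case p of (\<alpha>, \<beta>) \<Rightarrow> lookup \<alpha>) \<in> {b. \<forall>i. b i \<le> lookup \<gamma> i}" by (simp add: p lookup_add)
  qed
  then show "mps_nth (of_ps (ps_mult f g)) \<gamma> = mps_nth (of_ps f * of_ps g) \<gamma>"
    by (simp add: mps_nth_of_ps ps_mult_def mps_nth_mult)
qed

lemma to_ps_const: "to_ps (mconst c) = ps_const c"
  by (metis PS_closed(2) of_ps_const to_ps_of_ps)

section \<open>The maximal ideal and its powers as order conditions\<close>

lemma mideal_iff: "f \<in> mideal s \<longleftrightarrow> f \<in> PS s \<and> of_ps f \<in> ordge 1" for f :: "'a::comm_ring_1 ps"
proof
  assume "f \<in> mideal s"
  then obtain F :: "nat set" and r g where f: "f = (\<lambda>\<alpha>. \<Sum>x\<in>F. ps_mult (r x) (g x) \<alpha>)"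
    and rg: "\<forall>x\<in>F. r x \<in> PS s \<and> g x \<in> {ps_X i | i. i < s}"
    unfolding mideal_def ideal_gen_def by blast
  have g: "g x \<in> PS s \<and> of_ps (g x) \<in> ordge 1" if "x \<in> F" for x
    using rg that by fastforce
  have "of_ps f \<in> ordge 1" unfolding f of_ps_sum of_ps_mult using g by (intro ordge_sum ordge_mult_left) blast
  moreover have "f \<in> PS s" unfolding f using g rg by (intro PS_sum PS_mult) blast+
  ultimately show "f \<in> PS s \<and> of_ps f \<in> ordge 1" by blast
next
  assume f: "f \<in> PS s \<and> of_ps f \<in> ordge 1"
  then have "of_ps f \<in> Pser s" "of_ps f \<in> ordge (Suc 0)" by auto
  then obtain g where g: "\<And>i. g i \<in> Pser s" "of_ps f = (\<Sum>i<s. mvar i * g i)"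
    by (rule ordge_Suc_decompose) blast
  have "f = (\<lambda>\<alpha>. \<Sum>i\<in>{..<s}. ps_mult (to_ps (g i)) (ps_X i) \<alpha>)"
    by (rule of_ps_inj) (use f g in \<open>auto simp: mult.commute intro!: PS_sum\<close>)
  then show "f \<in> mideal s" unfolding mideal_def ideal_gen_def using g(1)
    by (intro CollectI exI[of _ "{..<s}"] exI[of _ "\<lambda>i. to_ps (g i)"] exI[of _ ps_X]) auto
qed

lemma ideal_pow_iff: "f \<in> ideal_pow s (mideal s) n \<longleftrightarrow> f \<in> PS s \<and> of_ps f \<in> ordge n" for f :: "'a::comm_ring_1 ps"
proof (induction n arbitrary: f)
  case (Suc n)
  show ?case
  proof
    assume "f \<in> ideal_pow s (mideal s) (Suc n)"
    then obtain F :: "nat set" and r g where f: "f = (\<lambda>\<alpha>. \<Sum>x\<in>F. ps_mult (r x) (g x) \<alpha>)"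
      and rg: "\<forall>x\<in>F. r x \<in> PS s \<and> g x \<in> {ps_mult a b | a b. a \<in> mideal s \<and> b \<in> ideal_pow s (mideal s) n}"
      unfolding ideal_pow.simps ideal_mult_def ideal_gen_def by blast
    have g: "g x \<in> PS s \<and> of_ps (g x) \<in> ordge (Suc n)" if x: "x \<in> F" for x
    proof -
      obtain a b where ab: "g x = ps_mult a b" "a \<in> mideal s" "b \<in> ideal_pow s (mideal s) n"
        using rg x by blast
      then have "of_ps a \<in> ordge 1" "of_ps b \<in> ordge n" "a \<in> PS s" "b \<in> PS s"
        using Suc.IH mideal_iff by auto
      then show ?thesis using ordge_mult[of "of_ps a" 1 "of_ps b" n] by (simp add: ab(1))
    qed
    have "of_ps f \<in> ordge (Suc n)"
      unfolding f of_ps_sum of_ps_mult using g by (intro ordge_sum ordge_mult_left) blast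
    moreover have "f \<in> PS s" unfolding f using g rg by (intro PS_sum PS_mult) blast+
    ultimately show "f \<in> PS s \<and> of_ps f \<in> ordge (Suc n)" by blast
  next
    assume f: "f \<in> PS s \<and> of_ps f \<in> ordge (Suc n)"
    then have "of_ps f \<in> Pser s" "of_ps f \<in> ordge (Suc n)" by auto
    then obtain g where g: "\<And>i. g i \<in> Pser s" "\<And>i. g i \<in> ordge n" "of_ps f = (\<Sum>i<s. mvar i * g i)"
      by (rule ordge_Suc_decompose) blast
    have eq: "f = (\<lambda>\<alpha>. \<Sum>i\<in>{..<s}. ps_mult ps_one (ps_mult (ps_X i) (to_ps (g i))) \<alpha>)"
      by (rule of_ps_inj) (use f g in \<open>auto intro!: PS_sum\<close>)
    have "(ps_X i :: 'a ps) \<in> mideal s" if "i < s" for i using that by (simp add: mideal_iff)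
    moreover have "to_ps (g i) \<in> ideal_pow s (mideal s) n" for i using g by (simp add: Suc.IH)
    ultimately show "f \<in> ideal_pow s (mideal s) (Suc n)"
      unfolding ideal_pow.simps ideal_mult_def ideal_gen_def using eq
      by (intro CollectI exI[of _ "{..<s}"] exI[of _ "\<lambda>_. ps_one"] exI[of _ "\<lambda>i. ps_mult (ps_X i) (to_ps (g i))"]) auto
  qed
qed simp

section \<open>Translation of matrices\<close>

definition to_m2 :: "'a mat2 \<Rightarrow> 'a mps m2" where
  "to_m2 A = M2 (of_ps (A 0 0)) (of_ps (A 0 1)) (of_ps (A 1 0)) (of_ps (A 1 1))"

definition of_m2 :: "'a::zero mps m2 \<Rightarrow> 'a mat2" where
  "of_m2 A = (\<lambda>i j. if i < 2 \<and> j < 2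
     then to_ps (if i = 0 then (if j = 0 then e00 A else e01 A) else (if j = 0 then e10 A else e11 A)) else ps_zero)"

lemma nat_less_2_iff: "(i :: nat) < 2 \<longleftrightarrow> i = 0 \<or> i = 1"
  by auto

lemma to_m2_of_m2 [simp]: "to_m2 (of_m2 A) = A"
  by (cases A) (simp add: to_m2_def of_m2_def)

lemma M22_eqI:
  assumes "A \<in> M22 s" "B \<in> M22 s" "to_m2 A = to_m2 B"
  shows "A = B"
proof (rule ext, rule ext)
  fix i j
  show "A i j = B i j"
  proof (cases "i < 2 \<and> j < 2")
    case True
    then have "A i j \<in> PS s" "B i j \<in> PS s" using assms by (auto simp: M22_def)
    moreover have "of_ps (A i j) = of_ps (B i j)"
      using True assms(3) by (auto simp: to_m2_def nat_less_2_iff)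
    ultimately show ?thesis by (rule of_ps_inj)
  qed (use assms in \<open>auto simp: M22_def\<close>)
qed

lemma of_m2_M22 [simp]: "A \<in> mats (Pser s) \<Longrightarrow> of_m2 A \<in> M22 s" for A :: "'a::comm_ring_1 mps m2"
  by (auto simp: of_m2_def M22_def mats_def)

lemma to_m2_mats [simp]: "A \<in> M22 s \<Longrightarrow> to_m2 A \<in> mats (Pser s)" for A :: "'a::comm_ring_1 mat2"
  by (auto simp: to_m2_def M22_def mats_def)

lemma ps_zero_arith: "ps_add ps_zero ps_zero = (ps_zero :: 'a::comm_ring_1 ps)"
  "ps_sub ps_zero ps_zero = (ps_zero :: 'a::comm_ring_1 ps)" "ps_mult f ps_zero = (ps_zero :: 'a::comm_ring_1 ps)"
  "ps_deriv \<nu> ps_zero = (ps_zero :: 'a::comm_ring_1 ps)"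
  by (simp_all add: fun_eq_iff ps_add_def ps_sub_def ps_mult_def ps_zero_def ps_deriv_def)

context
  fixes A B :: "'a::comm_ring_1 mat2" and s :: nat
  assumes A: "A \<in> M22 s"
begin

lemma M22_add: "B \<in> M22 s \<Longrightarrow> mat_add A B \<in> M22 s"
  using A by (auto simp: M22_def mat_add_def ps_zero_arith)

lemma M22_sub: "B \<in> M22 s \<Longrightarrow> mat_sub A B \<in> M22 s"
  using A by (auto simp: M22_def mat_sub_def ps_zero_arith)

lemma M22_mult: "B \<in> M22 s \<Longrightarrow> mat_mult A B \<in> M22 s"
  using A by (auto simp: M22_def mat_mult_def)

lemma M22_scale: "r \<in> PS s \<Longrightarrow> mat_scale r A \<in> M22 s"
  using A by (auto simp: M22_def mat_scale_def ps_zero_arith)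

lemma M22_deriv: "mat_deriv \<nu> A \<in> M22 s"
  using A by (auto simp: M22_def mat_deriv_def ps_zero_arith)

lemma M22_map: "(\<And>f. f \<in> PS s \<Longrightarrow> \<phi> f \<in> PS s) \<Longrightarrow> mat_map \<phi> A \<in> M22 s"
  using A by (auto simp: M22_def mat_map_def)

end

lemma M22_E: "p < 2 \<Longrightarrow> q < 2 \<Longrightarrow> mat_E p q \<in> M22 s"
  by (auto simp: M22_def mat_E_def)

lemma M22_id: "mat_id \<in> M22 s"
  by (auto simp: M22_def mat_id_def)

lemma M22_sum:
  fixes f :: "'i \<Rightarrow> 'a::comm_ring_1 mat2"
  assumes "\<And>x. x \<in> F \<Longrightarrow> f x \<in> M22 s"
  shows "(\<lambda>i j \<alpha>. \<Sum>x\<in>F. f x i j \<alpha>) \<in> M22 s"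
  unfolding M22_def
proof (intro CollectI conjI allI impI)
  fix i j :: nat assume "i < 2 \<and> j < 2"
  then show "(\<lambda>\<alpha>. \<Sum>x\<in>F. f x i j \<alpha>) \<in> PS s" using assms by (intro PS_sum) (auto simp: M22_def)
next
  fix i j :: nat assume "\<not> (i < 2 \<and> j < 2)"
  then have "f x i j = ps_zero" if "x \<in> F" for x using assms[OF that] by (simp add: M22_def)
  then show "(\<lambda>\<alpha>. \<Sum>x\<in>F. f x i j \<alpha>) = ps_zero" by (simp add: ps_zero_def fun_eq_iff)
qed

lemma to_m2_simps [simp]:
  fixes A B :: "'a::comm_ring_1 mat2"
  shows "to_m2 (mat_add A B) = to_m2 A + to_m2 B" "to_m2 (mat_sub A B) = to_m2 A - to_m2 B"
    "to_m2 (mat_mult A B) = to_m2 A * to_m2 B" "to_m2 (mat_scale r A) = smul (of_ps r) (to_m2 A)"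
    "to_m2 (mat_deriv \<nu> A) = map_m2 (mderiv \<nu>) (to_m2 A)" "to_m2 mat_id = (1 :: 'a mps m2)"
    "to_m2 (\<lambda>i j \<alpha>. \<Sum>x\<in>F. f x i j \<alpha>) = (\<Sum>x\<in>F. to_m2 (f x))"
  by (simp_all add: m2_eq_iff to_m2_def mat_add_def mat_sub_def mat_mult_def mat_scale_def mat_deriv_def mat_id_def)

lemma to_m2_map:
  "A \<in> M22 s \<Longrightarrow> to_m2 (mat_map \<phi> A) = map_m2 (\<lambda>f. of_ps (\<phi> (to_ps f))) (to_m2 A)" for A :: "'a::comm_ring_1 mat2"
  using to_ps_of_ps[of "A 0 0" s] to_ps_of_ps[of "A 0 1" s] to_ps_of_ps[of "A 1 0" s] to_ps_of_ps[of "A 1 1" s]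
  by (simp add: m2_eq_iff to_m2_def mat_map_def M22_def)

lemma ideal_mat_iff:
  "A \<in> ideal_mat (ideal_pow s (mideal s) n) \<longleftrightarrow> A \<in> M22 s \<and> to_m2 A \<in> mats (ordge n)" for A :: "'a::comm_ring_1 mat2"
  by (auto simp: ideal_mat_def M22_def ideal_pow_iff to_m2_def mats_def nat_less_2_iff)

section \<open>Generated modules and finite codimension in both encodings\<close>

lemma lin_comb_in_submod:
  fixes S :: "'a::comm_ring_1 mat2 set"
  assumes N: "submod s N" and I: "I \<subseteq> PS s" and S: "S \<subseteq> M22 s"
    and gen: "\<And>r B. r \<in> I \<Longrightarrow> B \<in> S \<Longrightarrow> smul (of_ps r) (to_m2 B) \<in> N" and C: "C \<in> lin_comb I S"
  shows "C \<in> M22 s \<and> to_m2 C \<in> N"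
proof -
  obtain F :: "nat set" and r B where C: "C = (\<lambda>i j \<alpha>. \<Sum>x\<in>F. mat_scale (r x) (B x) i j \<alpha>)"
    and rB: "\<forall>x\<in>F. r x \<in> I \<and> B x \<in> S"
    using C unfolding lin_comb_def by blast
  have "C \<in> M22 s" unfolding C using rB I S by (intro M22_sum M22_scale) auto
  moreover have "to_m2 C = (\<Sum>x\<in>F. smul (of_ps (r x)) (to_m2 (B x)))"
    unfolding C by simp
  then have "to_m2 C \<in> N" using rB gen by (auto intro!: submod_sum[OF N])
  ultimately show ?thesis by blast
qed

lemma lin_combI:
  fixes C :: "'a::comm_ring_1 mat2"
  assumes "finite (F :: nat set)" "\<And>x. x \<in> F \<Longrightarrow> r x \<in> I" "\<And>x. x \<in> F \<Longrightarrow> B x \<in> S"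
    and "I \<subseteq> PS s" "S \<subseteq> M22 s" "C \<in> M22 s" "to_m2 C = (\<Sum>x\<in>F. smul (of_ps (r x)) (to_m2 (B x)))"
  shows "C \<in> lin_comb I S"
proof -
  have "C = (\<lambda>i j \<alpha>. \<Sum>x\<in>F. mat_scale (r x) (B x) i j \<alpha>)"
    by (rule M22_eqI[where s = s]) (use assms in \<open>auto intro!: M22_sum M22_scale\<close>)
  then show ?thesis unfolding lin_comb_def using assms(1-3) by blast
qed

lemma tangent_image_iff:
  fixes A :: "'a::comm_ring_1 mat2"
  assumes A: "A \<in> M22 s"
  shows "C \<in> tangent_image s A \<longleftrightarrow> C \<in> M22 s \<and> to_m2 C \<in> tmod s (to_m2 A)"
proof
  let ?T = "tmod s (to_m2 A)"
  let ?L = "{mat_mult (mat_E p q) A | p q. p < 2 \<and> q < 2}" and ?R = "{mat_mult A (mat_E h l) | h l. h < 2 \<and> l < 2}"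
  let ?D = "{mat_deriv \<nu> A | \<nu>. \<nu> < s}"
  note sub = submod_tmod[of s "to_m2 A"]
  have mP: "(mideal s :: 'a ps set) \<subseteq> PS s" by (auto simp: mideal_iff)
  have L: "?L \<subseteq> M22 s" and R: "?R \<subseteq> M22 s" and D: "?D \<subseteq> M22 s"
    using A by (auto intro!: M22_mult M22_E M22_deriv)
  {
    assume "C \<in> tangent_image s A"
    then obtain X Y Z where C: "C = mat_add (mat_add X Y) Z" and X: "X \<in> lin_comb (PS s) ?L"
      and Y: "Y \<in> lin_comb (PS s) ?R" and Z: "Z \<in> lin_comb (mideal s) (lin_comb (PS s) ?D)"
      unfolding tangent_image_def mod_sum_def by blast
    have "X \<in> M22 s \<and> to_m2 X \<in> ?T"
      by (rule lin_comb_in_submod[OF sub _ L _ X])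
         (auto intro!: submod_smul[OF sub] tmod_contains to_m2_mats M22_E)
    moreover have "Y \<in> M22 s \<and> to_m2 Y \<in> ?T"
      by (rule lin_comb_in_submod[OF sub _ R _ Y])
         (auto intro!: submod_smul[OF sub] tmod_contains to_m2_mats M22_E)
    \<comment> \<open>The definition multiplies m with an already generated module. The W carried
      into the tangent module by all of m form a submodule, so testing the derivatives
      suffices.\<close>
    moreover have DM: "W \<in> M22 s \<and> to_m2 W \<in> {W. \<forall>r\<in>Pser s \<inter> ordge 1. smul r W \<in> ?T}"
      if W: "W \<in> lin_comb (PS s) ?D" for W
    proof (rule lin_comb_in_submod[OF _ _ D _ W])
      show "submod s {W. \<forall>r\<in>Pser s \<inter> ordge 1. smul r W \<in> ?T}"
        unfolding submod_def using submod_zero[OF sub]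
        by (auto simp: smul_add submod_add[OF sub] mult.commute)
    next
      fix r :: "'a ps" and B :: "'a mat2" assume "r \<in> PS s" "B \<in> ?D"
      then obtain \<nu> where "\<nu> < s" "B = mat_deriv \<nu> A" by blast
      then show "smul (of_ps r) (to_m2 B) \<in> {W. \<forall>r\<in>Pser s \<inter> ordge 1. smul r W \<in> ?T}"
        using \<open>r \<in> PS s\<close> by (auto intro!: tmod_contains_deriv)
    qed simp
    moreover have "Z \<in> M22 s \<and> to_m2 Z \<in> ?T"
      by (rule lin_comb_in_submod[OF sub mP _ _ Z]) (use DM in \<open>auto simp: mideal_iff\<close>)
    ultimately show "C \<in> M22 s \<and> to_m2 C \<in> ?T"
      unfolding C by (auto intro!: M22_add submod_add[OF sub])
  next
    assume C: "C \<in> M22 s \<and> to_m2 C \<in> ?T"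
    then obtain u v d where t: "to_m2 C = tmap s (to_m2 A) u v d" and uv: "u \<in> mats (Pser s)" "v \<in> mats (Pser s)"
      and d: "\<forall>\<nu>. d \<nu> \<in> Pser s \<and> d \<nu> \<in> ordge 1"
      unfolding tmod_def by blast
    have A': "to_m2 A \<in> mats (Pser s)" using A by simp
    let ?X = "of_m2 (u * to_m2 A)" and ?Y = "of_m2 (to_m2 A * v)"
      and ?Z = "of_m2 (\<Sum>\<nu><s. smul (d \<nu>) (map_m2 (mderiv \<nu>) (to_m2 A)))"
    have ZP: "(\<Sum>\<nu><s. smul (d \<nu>) (map_m2 (mderiv \<nu>) (to_m2 A))) \<in> mats (Pser s)"
      using A' d by (intro mats_Pser_sum mats_Pser_closed) auto
    have XYZ: "?X \<in> M22 s" "?Y \<in> M22 s" "?Z \<in> M22 s"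
      using A' uv ZP by (auto intro!: of_m2_M22 mats_Pser_closed)
    have units: "to_m2 (mat_E 0 0) = (M2 1 0 0 0 :: 'a mps m2)" "to_m2 (mat_E 0 1) = (M2 0 1 0 0 :: 'a mps m2)"
      "to_m2 (mat_E 1 0) = (M2 0 0 1 0 :: 'a mps m2)" "to_m2 (mat_E 1 1) = (M2 0 0 0 1 :: 'a mps m2)"
      by (simp_all add: to_m2_def mat_E_def)
    have four: "(\<Sum>x<4. f x) = f 0 + f 1 + f 2 + f 3" for f :: "nat \<Rightarrow> 'a mps m2"
      by (simp add: eval_nat_numeral)
    \<comment> \<open>The summands of \<open>lin_comb\<close> are indexed by naturals; x < 4 encodes
      the matrix position (x div 2, x mod 2).\<close>
    let ?r = "\<lambda>w x. to_ps ([e00 w, e01 w, e10 w, e11 w] ! x)"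
    have rP: "?r w x \<in> PS s" if "w \<in> mats (Pser s)" "x \<in> {..<4}" for w x
      using that by (auto simp: mats_def less_Suc_eq numeral_eq_Suc)
    have mem: "mat_mult (mat_E (x div 2) (x mod 2)) A \<in> ?L" "mat_mult A (mat_E (x div 2) (x mod 2)) \<in> ?R"
      if "x \<in> {..<4}" for x
    proof -
      have "x div 2 < 2" "x mod 2 < 2" using that by auto
      then show "mat_mult (mat_E (x div 2) (x mod 2)) A \<in> ?L" "mat_mult A (mat_E (x div 2) (x mod 2)) \<in> ?R"
        by blast+
    qed
    have "?X \<in> lin_comb (PS s) ?L"
      by (rule lin_combI[where F = "{..<4}" and r = "?r u" and B = "\<lambda>x. mat_mult (mat_E (x div 2) (x mod 2)) A" and s = s])
         (rule mem rP uv L XYZ | assumption | simp add: four units m2_eq_iff del: One_nat_def)+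
    moreover have "?Y \<in> lin_comb (PS s) ?R"
      by (rule lin_combI[where F = "{..<4}" and r = "?r v" and B = "\<lambda>x. mat_mult A (mat_E (x div 2) (x mod 2))" and s = s])
         (rule mem rP uv R XYZ | assumption | simp add: four units m2_eq_iff mult.commute del: One_nat_def)+
    moreover have "?Z \<in> lin_comb (mideal s) (lin_comb (PS s) ?D)"
    proof (rule lin_combI[where F = "{..<s}" and r = "\<lambda>\<nu>. to_ps (d \<nu>)" and B = "\<lambda>\<nu>. mat_deriv \<nu> A" and s = s])
      show "mat_deriv \<nu> A \<in> lin_comb (PS s) ?D" if "\<nu> \<in> {..<s}" for \<nu>
        by (rule lin_combI[where F = "{0}" and r = "\<lambda>_. ps_one" and B = "\<lambda>_. mat_deriv \<nu> A" and s = s])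
           (use that D A M22_deriv in auto)
      \<comment> \<open>Taking \<open>UNIV\<close> as the submodule extracts just the membership in
        \<open>M22 s\<close>.\<close>
      show "lin_comb (PS s) ?D \<subseteq> M22 s"
        using lin_comb_in_submod[of s UNIV "PS s" ?D] D by (auto simp: submod_def)
    qed (use d mP XYZ in \<open>auto simp: mideal_iff\<close>)
    moreover have "C = mat_add (mat_add ?X ?Y) ?Z"
      by (rule M22_eqI[where s = s]) (use C XYZ t in \<open>auto intro!: M22_add simp: tmap_def\<close>)
    ultimately show "C \<in> tangent_image s A" unfolding tangent_image_def mod_sum_def by blast
  }
qed

text \<open>Finite codimension represents in particular all x_i^j E, which yields a power of m.
  Conversely, a matrix differs from its truncation by an element of order n, and truncations are
  spanned by finitely many monomial matrices.\<close>

lemma finite_codim_iff: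
  fixes A :: "'a::field mat2"
  assumes A: "A \<in> M22 s"
  shows "finite_codim s (tangent_image s A) \<longleftrightarrow> (\<exists>n. mats (Pser s) \<inter> mats (ordge n) \<subseteq> tmod s (to_m2 A))"
proof
  assume "finite_codim s (tangent_image s A)"
  then obtain F :: "nat set" and C where F: "finite F" "\<forall>x\<in>F. C x \<in> M22 s"
    and sub: "M22 s \<subseteq> mod_sum (lin_comb {ps_const c | c. True} (C ` F)) (tangent_image s A)"
    unfolding finite_codim_def by blast
  let ?G = "to_m2 ` C ` F"
  have G: "finite ?G" using F by simp
  have rep: "\<exists>r\<in>kspan ?G. X - r \<in> tmod s (to_m2 A)" if "X \<in> mats (Pser s)" for X
  proof -
    have "of_m2 X \<in> M22 s" using that by simp
    then obtain K T where KT: "of_m2 X = mat_add K T" "K \<in> lin_comb {ps_const c | c. True} (C ` F)" "T \<in> tangent_image s A"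
      using sub unfolding mod_sum_def by blast
    obtain F' :: "nat set" and r B where K: "K = (\<lambda>i j \<alpha>. \<Sum>x\<in>F'. mat_scale (r x) (B x) i j \<alpha>)"
      and rB: "\<forall>x\<in>F'. r x \<in> {ps_const c | c. True} \<and> B x \<in> C ` F"
      using KT(2) unfolding lin_comb_def by blast
    have "smul (of_ps (r x)) (to_m2 (B x)) \<in> kspan ?G" if x: "x \<in> F'" for x
    proof -
      obtain c where "r x = ps_const c" using rB x by blast
      then show ?thesis using kspan_base[OF G, of "to_m2 (B x)" c] rB x by auto
    qed
    then have "to_m2 K \<in> kspan ?G" unfolding K by (simp add: kspan_sum)
    moreover have "X = to_m2 K + to_m2 T" using arg_cong[OF KT(1), of to_m2] by simp
    moreover have "to_m2 T \<in> tmod s (to_m2 A)" using KT(3) tangent_image_iff[OF A] by blast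
    ultimately show ?thesis by (intro bexI[of _ "to_m2 K"]) simp_all
  qed
  show "\<exists>n. mats (Pser s) \<inter> mats (ordge n) \<subseteq> tmod s (to_m2 A)"
  proof (rule ordge_in_submod_of_kspan[OF submod_tmod G])
    fix i j and E :: "'a mps m2" assume "i < s" "E \<in> m2_units"
    then have "smul (mvar i ^ j) E \<in> mats (Pser s)" by (auto simp: m2_units_def mats_def)
    then show "\<exists>r\<in>kspan ?G. smul (mvar i ^ j) E - r \<in> tmod s (to_m2 A)" by (rule rep)
  qed
next
  assume "\<exists>n. mats (Pser s) \<inter> mats (ordge n) \<subseteq> tmod s (to_m2 A)"
  then obtain n where n: "mats (Pser s) \<inter> mats (ordge n) \<subseteq> tmod s (to_m2 A)" by blast
  let ?G = "monomial_mats s n :: 'a mps m2 set"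
  \<comment> \<open>\<open>finite_codim\<close> indexes the spanning matrices by naturals, hence the
    enumeration.\<close>
  obtain h where h: "bij_betw h {..<card ?G} ?G"
    using ex_bij_betw_nat_finite[OF finite_monomial_mats, of s n] by (auto simp: lessThan_atLeast0)
  let ?F = "{..<card ?G}"
  have GP: "?G \<subseteq> mats (Pser s)" by (auto simp: monomial_mats_def m2_units_def mats_def)
  have hG: "h x \<in> mats (Pser s)" if "x \<in> ?F" for x using h GP that by (auto simp: bij_betw_def)
  have "X \<in> mod_sum (lin_comb {ps_const c | c. True} ((\<lambda>x. of_m2 (h x)) ` ?F)) (tangent_image s A)"
    if X: "X \<in> M22 s" for X
  proof -
    define K where "K = map_m2 (trunc s n) (to_m2 X)"
    obtain c where c: "K = (\<Sum>g\<in>?G. smul (mconst (c g)) g)"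
      using trunc_kspan[of s n "to_m2 X"] unfolding kspan_def K_def by blast
    have K: "K \<in> mats (Pser s)" by (simp add: K_def mats_def)
    have "to_m2 X - K \<in> mats (ordge n)"
      using to_m2_mats[OF X] ordge_antimono[OF trunc_ordge, of _ s n n] by (auto simp: K_def mats_def)
    then have "to_m2 X - K \<in> tmod s (to_m2 A)" using n X K by auto
    then have "of_m2 (to_m2 X - K) \<in> tangent_image s A"
      using tangent_image_iff[OF A] X K by simp
    moreover have "of_m2 K \<in> lin_comb {ps_const c | c. True} ((\<lambda>x. of_m2 (h x)) ` ?F)"
    proof (rule lin_combI[where F = ?F and r = "\<lambda>x. ps_const (c (h x))" and B = "\<lambda>x. of_m2 (h x)" and s = s])
      show "to_m2 (of_m2 K) = (\<Sum>x<card ?G. smul (of_ps (ps_const (c (h x)))) (to_m2 (of_m2 (h x))))"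
        unfolding c using sum.reindex_bij_betw[OF h, of "\<lambda>g. smul (mconst (c g)) g"] by simp
    qed (use hG K in auto)
    moreover have "X = mat_add (of_m2 K) (of_m2 (to_m2 X - K))"
      by (rule M22_eqI[where s = s]) (use X K in \<open>auto intro!: M22_add\<close>)
    ultimately show ?thesis unfolding mod_sum_def by blast
  qed
  then show "finite_codim s (tangent_image s A)"
    unfolding finite_codim_def using hG
    by (intro exI[of _ ?F] exI[of _ "\<lambda>x. of_m2 (h x)"]) auto
qed

section \<open>The equivalence\<close>

lemma Kalg_aut_power_series_automorphism:
  fixes \<phi> :: "'a::field ps \<Rightarrow> 'a ps"
  assumes "Kalg_aut s \<phi>"
  shows "power_series_automorphism s (\<lambda>f. of_ps (\<phi> (to_ps f)))"
proof
  have to: "bij_betw to_ps (Pser s :: 'a mps set) (PS s)"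
    by (rule bij_betw_byWitness[where f' = of_ps]) auto
  have from': "bij_betw of_ps (PS s) (Pser s :: 'a mps set)"
    by (rule bij_betw_byWitness[where f' = to_ps]) auto
  have "bij_betw (of_ps \<circ> (\<phi> \<circ> to_ps)) (Pser s) (Pser s)"
    using assms by (intro bij_betw_trans[OF bij_betw_trans[OF to] from']) (simp add: Kalg_aut_def)
  then show "bij_betw (\<lambda>f. of_ps (\<phi> (to_ps f))) (Pser s) (Pser s)" by (simp add: comp_def)
  fix f g :: "'a mps" assume fg: "f \<in> Pser s" "g \<in> Pser s"
  have "to_ps (f + g) = ps_add (to_ps f) (to_ps g)" "to_ps (f * g) = ps_mult (to_ps f) (to_ps g)"
    by (rule of_ps_inj[where s = s]; use fg in simp)+
  then show "of_ps (\<phi> (to_ps (f + g))) = of_ps (\<phi> (to_ps f)) + of_ps (\<phi> (to_ps g))"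
    "of_ps (\<phi> (to_ps (f * g))) = of_ps (\<phi> (to_ps f)) * of_ps (\<phi> (to_ps g))"
    using assms fg by (simp_all add: Kalg_aut_def)
next
  fix c show "of_ps (\<phi> (to_ps (mconst c))) = mconst c"
    using assms by (simp add: to_ps_const Kalg_aut_def)
qed

text \<open>Increments in m^2 leave the identity as linear part, and \<open>msubst_bij\<close> then
  provides invertibility.\<close>

lemma Kalg_aut_msubst:
  fixes d :: "nat \<Rightarrow> 'a::field mps"
  assumes d: "\<And>i. d i \<in> Pser s" "\<And>i. d i \<in> ordge 2"
  shows "Kalg_aut s (\<lambda>f. to_ps (msubst s (\<lambda>i. mvar i + d i) (of_ps f)))"
proof -
  let ?\<phi> = "msubst s (\<lambda>i. mvar i + d i)"
  have o: "mvar i + d i \<in> ordge 1" for i using ordge_antimono[OF d(2), of 1 i] by simp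
  have to: "bij_betw to_ps (Pser s :: 'a mps set) (PS s)"
    by (rule bij_betw_byWitness[where f' = of_ps]) auto
  have from': "bij_betw of_ps (PS s) (Pser s :: 'a mps set)"
    by (rule bij_betw_byWitness[where f' = to_ps]) auto
  have "bij_betw (to_ps \<circ> (?\<phi> \<circ> of_ps)) (PS s) (PS s)"
    by (rule bij_betw_trans[OF bij_betw_trans[OF from'] to]) (use msubst_bij[of s d] d in simp)
  then have "bij_betw (\<lambda>f. to_ps (?\<phi> (of_ps f))) (PS s) (PS s)" by (simp add: comp_def)
  moreover have P: "?\<phi> f \<in> Pser s" for f using d(1) by simp
  have "to_ps (?\<phi> (of_ps (ps_add f g))) = ps_add (to_ps (?\<phi> (of_ps f))) (to_ps (?\<phi> (of_ps g)))" for f g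
    by (rule of_ps_inj[where s = s]) (use P in \<open>simp_all add: msubst_add\<close>)
  moreover have "to_ps (?\<phi> (of_ps (ps_mult f g))) = ps_mult (to_ps (?\<phi> (of_ps f))) (to_ps (?\<phi> (of_ps g)))"
    if "f \<in> PS s" "g \<in> PS s" for f g
    by (rule of_ps_inj[where s = s]) (use P o that msubst_mult[of s "\<lambda>i. mvar i + d i"] in \<open>simp_all del: One_nat_def\<close>)
  moreover have "to_ps (?\<phi> (of_ps (ps_const c))) = ps_const c" for c
    using msubst_const[of s "\<lambda>i. mvar i + d i"] o by (simp add: to_ps_const)
  ultimately show ?thesis unfolding Kalg_aut_def by blast
qed

text \<open>The determinant of 1 + u is congruent to 1 modulo m, hence a unit.\<close>

lemma GL2_of_unipotent:
  fixes u :: "'a::field mps m2"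
  assumes u: "u \<in> mats (Pser s)" "u \<in> mats (ordge 1)"
  shows "of_m2 (1 + u) \<in> GL2 s"
proof -
  have P: "1 + u \<in> mats (Pser s)" using u by simp
  have "mps_nth (mdet (1 + u)) 0 = 1"
    using u(2) unfolding mats_def mem_Collect_eq mps_ordge_1_iff by (simp add: mdet_def mps_nth_one)
  then obtain W where W: "W \<in> mats (Pser s)" "(1 + u) * W = 1" "W * (1 + u) = 1"
    using mats_invertible[OF P] by auto
  have "mat_mult (of_m2 (1 + u)) (of_m2 W) = mat_id" "mat_mult (of_m2 W) (of_m2 (1 + u)) = mat_id"
    by (rule M22_eqI[where s = s]; use W P in \<open>simp add: M22_mult M22_id\<close>)+
  then show ?thesis unfolding GL2_def using W P by (intro CollectI conjI bexI[of _ "of_m2 W"]) auto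
qed

theorem theorem1p2:
  fixes s :: nat and A :: "'a::field mat2"
  assumes "infinite (UNIV :: 'a set)"
    and "A \<in> M22 s" and "A \<in> ideal_mat (mideal s)"
  shows "finitely_G_determined s A \<longleftrightarrow> finite_codim s (tangent_image s A)"
proof -
  note A = assms(2)
  have A': "to_m2 A \<in> mats (Pser s)" using A by simp
  show ?thesis unfolding finite_codim_iff[OF A]
  proof
    assume "finitely_G_determined s A"
    then obtain k where k: "G_k_determined s k A" unfolding finitely_G_determined_def by blast
    obtain B m where B: "B \<in> mats (Pser s)" "B - to_m2 A \<in> mats (ordge (Suc k))"
      and m: "mats (Pser s) \<inter> mats (ordge m) \<subseteq> tmod s B"
      using ex_finite_codim_perturbation[OF assms(1) A'] by blast
    have "mat_sub (of_m2 B) A \<in> ideal_mat (ideal_pow s (mideal s) (k + 1))"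
      unfolding ideal_mat_iff using B A by (simp add: M22_sub)
    then have "of_m2 B \<in> G_orbit s A" using k B by (simp add: G_k_determined_def G_equiv_def)
    then obtain U V \<phi> where UV: "of_m2 B = mat_mult (mat_mult U (mat_map \<phi> A)) V" "U \<in> GL2 s" "V \<in> GL2 s"
      and \<phi>: "Kalg_aut s \<phi>"
      unfolding G_orbit_def by blast
    interpret power_series_automorphism s "\<lambda>f. of_ps (\<phi> (to_ps f))"
      by (rule Kalg_aut_power_series_automorphism[OF \<phi>])
    obtain U' where U': "U \<in> M22 s" "U' \<in> M22 s" "mat_mult U' U = mat_id" using UV(2) unfolding GL2_def by blast
    obtain V' where V': "V \<in> M22 s" "V' \<in> M22 s" "mat_mult V V' = mat_id" using UV(3) unfolding GL2_def by blast
    have "to_m2 U' * to_m2 U = 1" "to_m2 V * to_m2 V' = 1"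
      using arg_cong[OF U'(3), of to_m2] arg_cong[OF V'(3), of to_m2] by simp_all
    moreover have "B = to_m2 U * mmap (to_m2 A) * to_m2 V"
      using arg_cong[OF UV(1), of to_m2] by (simp add: to_m2_map[OF A])
    ultimately have "mats (Pser s) \<inter> mats (ordge m) \<subseteq> tmod s (to_m2 A)"
      using tmod_codim_invariant[OF A', of "to_m2 U" "to_m2 U'" "to_m2 V" "to_m2 V'" m] U' V' m by simp
    then show "\<exists>n. mats (Pser s) \<inter> mats (ordge n) \<subseteq> tmod s (to_m2 A)" by blast
  next
    assume "\<exists>n. mats (Pser s) \<inter> mats (ordge n) \<subseteq> tmod s (to_m2 A)"
    then obtain n where n: "mats (Pser s) \<inter> mats (ordge n) \<subseteq> tmod s (to_m2 A)" by blast
    \<comment> \<open>Determinacy demands a positive order. It will be 2 c, because k + 1 must equal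
      the bound 2 c + 1 of \<open>gact_transitive\<close>, so c is made positive.\<close>
    define c where "c = Suc n"
    have c: "mats (Pser s) \<inter> mats (ordge c) \<subseteq> tmod s (to_m2 A)"
      using n mats_ordge_antimono[of _ c n] by (auto simp: c_def)
    have "G_equiv s A B" if B: "B \<in> M22 s" "mat_sub B A \<in> ideal_mat (ideal_pow s (mideal s) (2 * c + 1))" for B
    proof -
      have "to_m2 B - to_m2 A \<in> mats (ordge (2 * c + 1))" using B(2) unfolding ideal_mat_iff by simp
      then obtain u v d where uv: "u \<in> mats (Pser s)" "u \<in> mats (ordge 1)" "v \<in> mats (Pser s)" "v \<in> mats (ordge 1)"
        and d: "\<forall>i. d i \<in> Pser s \<and> d i \<in> ordge 2" and eq: "gact s (to_m2 A) u v d = to_m2 B"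
        using gact_transitive[OF A' c to_m2_mats[OF B(1)]] by blast
      let ?\<phi> = "\<lambda>f. to_ps (msubst s (\<lambda>i. mvar i + d i) (of_ps f))"
      have aut: "Kalg_aut s ?\<phi>" using d by (intro Kalg_aut_msubst) auto
      have \<phi>: "?\<phi> f \<in> PS s" if "f \<in> PS s" for f using aut that by (auto simp: Kalg_aut_def bij_betw_def)
      have "B = mat_mult (mat_mult (of_m2 (1 + u)) (mat_map ?\<phi> A)) (of_m2 (1 + v))"
      proof (rule M22_eqI[where s = s])
        show "mat_mult (mat_mult (of_m2 (1 + u)) (mat_map ?\<phi> A)) (of_m2 (1 + v)) \<in> M22 s"
          using uv A \<phi> by (intro M22_mult M22_map of_m2_M22 mats_Pser_closed) auto
        show "to_m2 B = to_m2 (mat_mult (mat_mult (of_m2 (1 + u)) (mat_map ?\<phi> A)) (of_m2 (1 + v)))"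
          using eq by (simp add: to_m2_map[OF A] gact_def)
      qed (rule B(1))
      then show ?thesis
        unfolding G_equiv_def G_orbit_def using GL2_of_unipotent[OF uv(1,2)] GL2_of_unipotent[OF uv(3,4)] aut by blast
    qed
    then have "G_k_determined s (2 * c) A" unfolding G_k_determined_def by simp
    moreover have "0 < 2 * c" by (simp add: c_def)
    ultimately show "finitely_G_determined s A" unfolding finitely_G_determined_def by blast
  qed
qed

end
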